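(* Assume that the limit $\ell:=\lim_{s\uparrow+\infty}-\frac1s\ln\mathbb{P}[S_1>s]$ exists in $[0,+\infty]$. The positive occupation time $F_t:=\int_0^t\mathds{1}_{\{Z_\tau>0\}}\,d\tau$ of the reset Brownian motion satisfies a full large deviation principle with the rate function $I(w):=\sup_{k\in\mathbb{R}}\{wk+\varphi(k)\}$, $w\in\mathbb{R}$, for any resetting protocol (i.e. any law of the waiting times as in the context). Moreover, its asymptotic logarithmic moment generating function $g(k):=\lim_{t\uparrow+\infty}\frac1t\ln\mathbb{E}[e^{kF_t}]$ exists for every $k\in\mathbb{R}$ and $g=-\varphi$.
   Context: Let $(\Omega,\mathcal{F},\mathbb{P})$ be a probability space with expectation $\mathbb{E}$. Let $S_1,S_2,\ldots$ (waiting times) be i.i.d. non-negative real random variables with $\mathbb{P}[S_1=0]<1$; put $T_0:=0$, $T_n:=S_1+\cdots+S_n$, and $N_t:=\sup\{n\ge 0:T_n\le t\}$ for $t\ge 0$ (almost surely finite for all $t$). Let $\{B_{1,t}\}_{t\ge 0},\{B_{2,t}\}_{t\ge 0},\ldots$ be independent standard Brownian motions (started at $0$), independent of the waiting times. The reset Brownian motion is $Z_t:=B_{N_t+1,\,t-T_{N_t}}$, $t\ge 0$. Here $\mathds{1}$ denotes an indicator function. Set $X_1:=\int_0^{S_1}\mathds{1}_{\{B_{1,\tau}>0\}}\,d\tau$ and, for $k\in\mathbb{R}$, $$\varphi(k):=\sup\Big\{\zeta\in\mathbb{R}:\ \mathbb{E}\big[e^{\zeta S_1+kX_1}\big]\le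 1\Big\}$$ (extended real valued, $\sup\emptyset=-\infty$). Also $\ln 0=-\infty$, $\inf\emptyset=+\infty$. $F_t$ satisfies a full large deviation principle with rate function $I$ if $I$ is lower semicontinuous on $\mathbb{R}$ and $\liminf_{t\uparrow+\infty}\frac1t\ln\mathbb{P}[F_t/t\in G]\ge-\inf_{w\in G}I(w)$ for each open $G\subseteq\mathbb{R}$, and $\limsup_{t\uparrow+\infty}\frac1t\ln\mathbb{P}[F_t/t\in K]\le-\inf_{w\in K}I(w)$ for each closed $K\subseteq\mathbb{R}$. *)

theory Defs
  imports "HOL-Probability.Probability"
begin

(* The library's ln on real has ln 0 = 0, whereas here ln 0 = -infinity is needed. *)
definition ln_ennreal :: "ennreal \<Rightarrow> ereal" where
  "ln_ennreal x = (if x = 0 then -\<infinity> else if x = \<infinity> then \<infinity> else ereal (ln (enn2real x)))"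

(* Only times t at least 0 are constrained; every path is continuous and starts at 0. *)
definition (in prob_space) standard_Brownian_motion :: "(real \<Rightarrow> 'a \<Rightarrow> real) \<Rightarrow> bool" where
  "standard_Brownian_motion W \<longleftrightarrow>
     (\<forall>t\<ge>0. random_variable borel (W t)) \<and>
     (\<forall>\<omega>\<in>space M. W 0 \<omega> = 0) \<and>
     (\<forall>\<omega>\<in>space M. continuous_on {0..} (\<lambda>t. W t \<omega>)) \<and>
     (\<forall>(n::nat) u. 0 \<le> u 0 \<and> mono_on {..n} u \<longrightarrow>
        indep_vars (\<lambda>_. borel) (\<lambda>i \<omega>. W (u (Suc i)) \<omega> - W (u i) \<omega>) {..<n}) \<and>
     (\<forall>s t. 0 \<le> s \<and> s < t \<longrightarrow>
        distributed M lborel (\<lambda>\<omega>. W t \<omega> - W s \<omega>) (normal_density 0 (sqrt (t - s))))"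

(* Sequences are indexed from 1: the values of S and B at index 0 are irrelevant.
   Processes are regarded as random elements of product spaces, so that independence of
   processes is independence of the sigma-algebras generated by all their coordinates. *)
locale reset_Brownian_motion = prob_space M
  for M :: "'a measure" and S :: "nat \<Rightarrow> 'a \<Rightarrow> real" and B :: "nat \<Rightarrow> real \<Rightarrow> 'a \<Rightarrow> real" +
  assumes S_nonneg: "\<And>n \<omega>. n \<ge> 1 \<Longrightarrow> \<omega> \<in> space M \<Longrightarrow> 0 \<le> S n \<omega>"
    and S_indep: "indep_vars (\<lambda>_. borel) S {1..}"
    and S_ident: "\<And>n. n \<ge> 1 \<Longrightarrow> distr M borel (S n) = distr M borel (S 1)"
    and S_nontrivial: "prob {\<omega> \<in> space M. S 1 \<omega> = 0} < 1"
    and B_Brownian: "\<And>i. i \<ge> 1 \<Longrightarrow> standard_Brownian_motion (B i)"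
    and B_indep: "indep_vars (\<lambda>_. Pi\<^sub>M {0..} (\<lambda>_. borel)) (\<lambda>i \<omega>. \<lambda>t\<in>{0..}. B i t \<omega>) {1..}"
    and S_B_indep:
      "indep_set
         (sets (vimage_algebra (space M) (\<lambda>\<omega>. \<lambda>n\<in>{1..}. S n \<omega>) (Pi\<^sub>M {1..} (\<lambda>_. borel))))
         (sets (vimage_algebra (space M) (\<lambda>\<omega>. \<lambda>(i, t)\<in>{1..} \<times> {0..}. B i t \<omega>)
                  (Pi\<^sub>M ({1..} \<times> {0..}) (\<lambda>_. borel))))"

definition renewal_time :: "(nat \<Rightarrow> 'a \<Rightarrow> real) \<Rightarrow> nat \<Rightarrow> 'a \<Rightarrow> real" where
  "renewal_time S n \<omega> = (\<Sum>i=1..n. S i \<omega>)"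

(* The supremum is taken in nat, so its value is meaningful only when the set is finite,
   i.e. outside a null event under the assumptions of reset_Brownian_motion. *)
definition renewal_count :: "(nat \<Rightarrow> 'a \<Rightarrow> real) \<Rightarrow> real \<Rightarrow> 'a \<Rightarrow> nat" where
  "renewal_count S t \<omega> = Sup {n. renewal_time S n \<omega> \<le> t}"

definition reset_process ::
    "(nat \<Rightarrow> 'a \<Rightarrow> real) \<Rightarrow> (nat \<Rightarrow> real \<Rightarrow> 'a \<Rightarrow> real) \<Rightarrow> real \<Rightarrow> 'a \<Rightarrow> real" where
  "reset_process S B t \<omega> =
     (let n = renewal_count S t \<omega> in B (n + 1) (t - renewal_time S n \<omega>) \<omega>)"

definition positive_occupation :: "(real \<Rightarrow> real) \<Rightarrow> real \<Rightarrow> real" where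
  "positive_occupation z t = (LBINT \<tau>:{0..t}. indicator {0<..} (z \<tau>))"

definition reset_occupation_time ::
    "(nat \<Rightarrow> 'a \<Rightarrow> real) \<Rightarrow> (nat \<Rightarrow> real \<Rightarrow> 'a \<Rightarrow> real) \<Rightarrow> real \<Rightarrow> 'a \<Rightarrow> real" where
  "reset_occupation_time S B t \<omega> = positive_occupation (\<lambda>\<tau>. reset_process S B \<tau> \<omega>) t"

definition first_reward ::
    "(nat \<Rightarrow> 'a \<Rightarrow> real) \<Rightarrow> (nat \<Rightarrow> real \<Rightarrow> 'a \<Rightarrow> real) \<Rightarrow> 'a \<Rightarrow> real" where
  "first_reward S B \<omega> = positive_occupation (\<lambda>\<tau>. B 1 \<tau> \<omega>) (S 1 \<omega>)"

definition phi ::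
    "'a measure \<Rightarrow> (nat \<Rightarrow> 'a \<Rightarrow> real) \<Rightarrow> (nat \<Rightarrow> real \<Rightarrow> 'a \<Rightarrow> real) \<Rightarrow> real \<Rightarrow> ereal" where
  "phi M S B k =
     Sup (ereal ` {\<zeta>. (\<integral>\<^sup>+\<omega>. ennreal (exp (\<zeta> * S 1 \<omega> + k * first_reward S B \<omega>)) \<partial>M) \<le> 1})"

definition lower_semicontinuous :: "(real \<Rightarrow> ereal) \<Rightarrow> bool" where
  "lower_semicontinuous I \<longleftrightarrow> (\<forall>w. I w \<le> Liminf (at w) I)"

definition full_LDP :: "'a measure \<Rightarrow> (real \<Rightarrow> 'a \<Rightarrow> real) \<Rightarrow> (real \<Rightarrow> ereal) \<Rightarrow> bool" where
  "full_LDP M F I \<longleftrightarrow>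
     lower_semicontinuous I \<and>
     (\<forall>G. open G \<longrightarrow>
        Liminf at_top (\<lambda>t. ereal (1 / t) * ln_ennreal (emeasure M {\<omega> \<in> space M. F t \<omega> / t \<in> G}))
          \<ge> - (INF w\<in>G. I w)) \<and>
     (\<forall>K. closed K \<longrightarrow>
        Limsup at_top (\<lambda>t. ereal (1 / t) * ln_ennreal (emeasure M {\<omega> \<in> space M. F t \<omega> / t \<in> K}))
          \<le> - (INF w\<in>K. I w))"

end

theory Submission
  imports Defs
begin

text \<open>
  At every renewal the process starts afresh, so the occupation time gathered up to the \<open>n\<close>-th renewal
  is the reward \<open>R\<^sub>n\<close> of a planar random walk \<open>(T\<^sub>n, R\<^sub>n)\<close> with independent, identically distributed
  steps \<open>(S\<^sub>i, X\<^sub>i)\<close>, \<open>0 \<le> X\<^sub>i \<le> S\<^sub>i\<close>. Occupation times increase with slope at most one, hence \<open>F\<^sub>t\<close> differs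
  from \<open>R\<^sub>n\<close> by at most \<open>\<bar>t - T\<^sub>n\<bar>\<close>, for every \<open>n\<close>. Large deviations of \<open>F\<^sub>t\<close> are therefore read off from the
  walk, and from its last, incomplete step. Write \<open>\<theta>(\<zeta>, k)\<close> for the expectation of \<open>exp (\<zeta> S\<^sub>1 + k X\<^sub>1)\<close>
  (the constant \<open>mgf\<close>); the exponent \<open>\<phi>(k)\<close> is the supremum of the \<open>\<zeta>\<close> with
  \<open>\<theta>(\<zeta>, k) \<le> 1\<close>.

  Lower bound. Call \<open>(w, c)\<close> achievable if for all large \<open>t\<close> there is an \<open>n\<close> such that \<open>(T\<^sub>n, R\<^sub>n)\<close> lies
  near \<open>(t, w t)\<close> with probability about \<open>exp (- c t)\<close> or more. Placing independent stretches of the walk one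
  after the other shows that the achievable pairs form a closed convex set (\<open>convex_achievable\<close>,
  \<open>closed_achievable\<close>). If \<open>\<theta>(\<zeta>, k) > 1\<close>, then the part of the expectation with \<open>S\<^sub>1 \<le> C\<close> already exceeds
  one for some \<open>C\<close>, so the corresponding expectation over \<open>n\<close> steps grows exponentially. Its mass is
  spread over a number of small boxes that does not depend on \<open>n\<close>, and the box carrying most of it
  gives an achievable pair with \<open>c = \<zeta> + k w\<close> (\<open>achievable_on_line\<close>). Since \<open>C\<close> is arbitrary, this covers
  both the regime of many typical cycles and that of a few very long ones. Thus each line
  \<open>c = \<zeta> + k w\<close> with \<open>\<zeta> > \<phi>(k)\<close> meets the achievable set, and separating a point from a closed convex
  set shows that the set contains every \<open>(w, c)\<close> with \<open>I(w) \<le> c\<close> (\<open>rate_le_imp_achievable\<close>). This yields the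
  bound for open sets, and also the lower bound for the logarithmic moment generating function.

  Upper bound. Let \<open>\<zeta> < \<phi>(k)\<close>, so that \<open>q = \<theta>(\<zeta>, k) < 1\<close>. Splitting according to the number \<open>n\<close> of
  renewals before \<open>t\<close> bounds the expectation of \<open>exp (k F\<^sub>t)\<close> by \<open>K exp (- \<zeta> t)\<close> times the geometric series
  in \<open>q\<close> (\<open>mgf_F_upper\<close>). The constant \<open>K\<close> comes from the incomplete step, and requires that
  \<open>exp ((\<zeta> + max k 0) u) P(S\<^sub>1 > u)\<close> is bounded in \<open>u\<close>. Chernoff's inequality and a finite cover of the compact range
  \<open>[0, 1]\<close> of \<open>F\<^sub>t / t\<close> give the bound for closed sets.

  Apart from making the cycles independent and identically distributed, Brownian motion enters only
  through the boundedness just mentioned. With a probability bounded below uniformly in the horizon, Brownian motion is positive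
  for at least the fraction \<open>1 - \<epsilon>\<close> of the time, and likewise negative
  (\<open>Brownian_occupation_high\<close>). Hence \<open>\<theta>(\<zeta>', k) \<le> 1\<close> with \<open>\<zeta>' > \<zeta>\<close> bounds the expectation of
  \<open>exp ((\<zeta> + max k 0) S\<^sub>1)\<close>, and Markov's inequality applies (\<open>waiting_time_tail\<close>).
\<close>

section \<open>Exponential rates in the extended reals\<close>

lemma ln_ennreal_mono: "x \<le> y \<Longrightarrow> ln_ennreal x \<le> ln_ennreal y"
  unfolding ln_ennreal_def
  by (auto simp: top_unique less_top enn2real_mono enn2real_positive_iff zero_less_iff_neq_zero
      intro!: ln_mono)

lemma ln_ennreal_exp: "ln_ennreal (ennreal (exp x)) = ereal x"
  by (simp add: ln_ennreal_def)

lemma Liminf_rate_ge: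
  fixes f :: "real \<Rightarrow> ennreal" and a :: real
  assumes "\<forall>\<^sub>F t in at_top. ennreal (exp (- (t * a))) \<le> f t"
  shows "ereal (- a) \<le> Liminf at_top (\<lambda>t. ereal (1 / t) * ln_ennreal (f t))"
proof (rule Liminf_bounded)
  show "\<forall>\<^sub>F t in at_top. ereal (- a) \<le> ereal (1 / t) * ln_ennreal (f t)"
    using assms eventually_gt_at_top[of 0]
  proof eventually_elim
    case (elim t)
    have "ereal (- a) = ereal (1 / t) * ln_ennreal (ennreal (exp (- (t * a))))"
      using elim by (simp add: ln_ennreal_exp)
    also have "\<dots> \<le> ereal (1 / t) * ln_ennreal (f t)"
      using elim by (intro ereal_mult_left_mono ln_ennreal_mono) auto
    finally show ?case .
  qed
qed

lemma Limsup_rate_le: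
  fixes f :: "real \<Rightarrow> ennreal" and a K :: real
  assumes "\<forall>\<^sub>F t in at_top. f t \<le> ennreal (K * exp (- (t * a)))"
  shows "Limsup at_top (\<lambda>t. ereal (1 / t) * ln_ennreal (f t)) \<le> ereal (- a)"
proof -
  define K' where "K' = max K 1"
  have "K' > 0" by (simp add: K'_def)
  have "Limsup at_top (\<lambda>t. ereal (1 / t) * ln_ennreal (f t)) \<le> Limsup at_top (\<lambda>t. ereal (ln K' / t - a))"
  proof (rule Limsup_mono)
    show "\<forall>\<^sub>F t in at_top. ereal (1 / t) * ln_ennreal (f t) \<le> ereal (ln K' / t - a)"
      using assms eventually_gt_at_top[of 0]
    proof eventually_elim
      case (elim t)
      have "f t \<le> ennreal (K' * exp (- (t * a)))"
        using elim(1) by (rule order_trans) (auto intro!: ennreal_leI simp: K'_def)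
      also have "K' * exp (- (t * a)) = exp (ln K' - t * a)"
        using \<open>K' > 0\<close> by (simp add: exp_diff exp_minus divide_inverse)
      finally have "ereal (1 / t) * ln_ennreal (f t) \<le> ereal (1 / t) * ln_ennreal (ennreal (exp (ln K' - t * a)))"
        using elim by (intro ereal_mult_left_mono ln_ennreal_mono) auto
      also have "\<dots> = ereal (ln K' / t - a)"
        using elim by (simp add: ln_ennreal_exp field_simps)
      finally show ?case .
    qed
  qed
  also have "((\<lambda>t. ln K' / t - a) \<longlongrightarrow> 0 - a) at_top"
    by (intro tendsto_diff tendsto_const tendsto_divide_0[OF tendsto_const]
        filterlim_at_top_imp_at_infinity filterlim_ident)
  then have "((\<lambda>t. ereal (ln K' / t - a)) \<longlongrightarrow> ereal (- a)) at_top"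
    by simp
  then have "Limsup at_top (\<lambda>t. ereal (ln K' / t - a)) = ereal (- a)"
    by (intro lim_imp_Limsup) auto
  finally show ?thesis .
qed

lemma lower_semicontinuous_SUP_affine:
  "lower_semicontinuous (\<lambda>w. SUP k. ereal (w * k) + c k)"
  unfolding lower_semicontinuous_def
proof
  fix w
  show "(SUP k. ereal (w * k) + c k) \<le> Liminf (at w) (\<lambda>w. SUP k. ereal (w * k) + c k)"
  proof (rule SUP_least)
    fix k :: real
    have "((\<lambda>v. v * k) \<longlongrightarrow> w * k) (at w)" by (intro tendsto_intros)
    then have "((\<lambda>v. ereal (v * k)) \<longlongrightarrow> ereal (w * k)) (at w)" by simp
    then have "((\<lambda>v. ereal (v * k) + c k) \<longlongrightarrow> ereal (w * k) + c k) (at w)"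
      by (intro tendsto_add_ereal_general2 tendsto_const) auto
    then have "ereal (w * k) + c k = Liminf (at w) (\<lambda>v. ereal (v * k) + c k)"
      by (intro lim_imp_Liminf[symmetric]) auto
    also have "\<dots> \<le> Liminf (at w) (\<lambda>w. SUP k. ereal (w * k) + c k)"
      by (intro Liminf_mono always_eventually allI SUP_upper) auto
    finally show "ereal (w * k) + c k \<le> Liminf (at w) (\<lambda>w. SUP k. ereal (w * k) + c k)" .
  qed
qed

lemma fst_measurable_borel [measurable]: "fst \<in> borel_measurable (borel :: (real \<times> real) measure)"
  and snd_measurable_borel [measurable]: "snd \<in> borel_measurable (borel :: (real \<times> real) measure)"
  by (intro borel_measurable_continuous_onI continuous_intros)+

section \<open>Renewal-reward walks and their achievable costs\<close>

text \<open>The two components of \<open>W n\<close> are the length of the \<open>n\<close>-th cycle and the reward gathered during it;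
  as with the waiting times, numbering starts at 1.\<close>
locale renewal_reward = prob_space M
  for M :: "'a measure" and W :: "nat \<Rightarrow> 'a \<Rightarrow> real \<times> real" +
  assumes W_indep: "indep_vars (\<lambda>_. borel) W {1..}"
    and W_ident: "\<And>n. n \<ge> 1 \<Longrightarrow> distr M borel (W n) = distr M borel (W 1)"
    and reward_nonneg: "\<And>n \<omega>. n \<ge> 1 \<Longrightarrow> \<omega> \<in> space M \<Longrightarrow> 0 \<le> snd (W n \<omega>)"
    and reward_le: "\<And>n \<omega>. n \<ge> 1 \<Longrightarrow> \<omega> \<in> space M \<Longrightarrow> snd (W n \<omega>) \<le> fst (W n \<omega>)"
    and waiting_nontrivial: "prob {\<omega> \<in> space M. fst (W 1 \<omega>) = 0} < 1"
begin

definition partial :: "nat \<Rightarrow> 'a \<Rightarrow> real \<times> real" where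
  "partial n \<omega> = (\<Sum>i=1..n. W i \<omega>)"

abbreviation time :: "nat \<Rightarrow> 'a \<Rightarrow> real" where "time n \<omega> \<equiv> fst (partial n \<omega>)"
abbreviation reward :: "nat \<Rightarrow> 'a \<Rightarrow> real" where "reward n \<omega> \<equiv> snd (partial n \<omega>)"

lemma W_measurable: "n \<ge> 1 \<Longrightarrow> W n \<in> borel_measurable M"
  using W_indep by (auto simp: indep_vars_def)

lemma W_measurable_Suc [measurable]: "W (Suc n) \<in> borel_measurable M"
  by (rule W_measurable) simp

lemma partial_measurable [measurable]: "partial n \<in> borel_measurable M"
  unfolding partial_def[abs_def] by (intro borel_measurable_sum W_measurable) auto

lemma partial_0 [simp]: "partial 0 \<omega> = 0"
  by (simp add: partial_def)

lemma partial_Suc: "partial (Suc n) \<omega> = partial n \<omega> + W (Suc n) \<omega>"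
  by (simp add: partial_def)

lemma partial_shift: "partial (n + m) \<omega> = partial n \<omega> + (\<Sum>i=1..m. W (n + i) \<omega>)"
  by (induction m) (auto simp: partial_Suc add.assoc)

lemma fst_W_nonneg: "n \<ge> 1 \<Longrightarrow> \<omega> \<in> space M \<Longrightarrow> 0 \<le> fst (W n \<omega>)"
  using reward_nonneg reward_le by (meson order_trans)

lemma time_mono: "m \<le> n \<Longrightarrow> \<omega> \<in> space M \<Longrightarrow> time m \<omega> \<le> time n \<omega>"
  by (rule lift_Suc_mono_le[of "\<lambda>n. time n \<omega>"]) (auto simp: partial_Suc fst_W_nonneg)

lemma time_nonneg: "\<omega> \<in> space M \<Longrightarrow> 0 \<le> time n \<omega>"
  using time_mono[of 0 n \<omega>] by simp

lemma reward_bounds: "\<omega> \<in> space M \<Longrightarrow> 0 \<le> reward n \<omega> \<and> reward n \<omega> \<le> time n \<omega>"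
proof (induction n)
  case (Suc n)
  then show ?case
    using reward_nonneg[of "Suc n" \<omega>] reward_le[of "Suc n" \<omega>] by (auto simp: partial_Suc)
qed simp

lemma indep_partial_shift:
  "indep_var borel (partial n) borel (\<lambda>\<omega>. \<Sum>i=1..m. W (n + i) \<omega>)"
proof -
  have "indep_var (PiM {1..n} (\<lambda>_. borel)) (\<lambda>\<omega>. \<lambda>i\<in>{1..n}. W i \<omega>)
        (PiM {n+1..n+m} (\<lambda>_. borel)) (\<lambda>\<omega>. \<lambda>i\<in>{n+1..n+m}. W i \<omega>)"
    by (rule indep_var_restrict[OF W_indep]) auto
  then have "indep_var borel ((\<lambda>f. \<Sum>i=1..n. f i) \<circ> (\<lambda>\<omega>. \<lambda>i\<in>{1..n}. W i \<omega>))
     borel ((\<lambda>f. \<Sum>i=n+1..n+m. f i) \<circ> (\<lambda>\<omega>. \<lambda>i\<in>{n+1..n+m}. W i \<omega>))"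
    by (rule indep_var_compose) measurable
  moreover have "(\<Sum>i=n+1..n+m. W i \<omega>) = (\<Sum>i=1..m. W (n + i) \<omega>)" for \<omega>
    using sum.shift_bounds_cl_nat_ivl[of "\<lambda>i. W i \<omega>" 1 n m] by (simp add: add.commute)
  ultimately show ?thesis
    by (simp add: comp_def partial_def[abs_def])
qed

text \<open>Stationarity: the law of a stretch of \<open>m\<close> steps does not depend on where it starts. Together
  with \<open>indep_partial_shift\<close> this lets probabilities of consecutive stretches be multiplied.\<close>
lemma distr_shifted_sum:
  "distr M borel (\<lambda>\<omega>. \<Sum>i=1..m. W (n + i) \<omega>) = distr M borel (partial m)"
proof (cases "m = 0")
  case False
  have law: "distr M (PiM {1..m} (\<lambda>_. borel)) (\<lambda>\<omega>. \<lambda>i\<in>{1..m}. W (k + i) \<omega>)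
      = PiM {1..m} (\<lambda>_. distr M borel (W 1))" for k
  proof -
    let ?I = "(+) k ` {1..m}"
    have "distr M (PiM {1..m} (\<lambda>_. borel)) (\<lambda>\<omega>. \<lambda>i\<in>{1..m}. W (k + i) \<omega>) =
        distr (distr M (PiM ?I (\<lambda>_. borel)) (\<lambda>\<omega>. \<lambda>i\<in>?I. W i \<omega>))
          (PiM {1..m} (\<lambda>_. borel)) (\<lambda>f. \<lambda>i\<in>{1..m}. f (k + i))"
      by (subst distr_distr)
         (auto simp: comp_def intro!: W_measurable measurable_restrict measurable_component_singleton
           distr_cong)
    also have "distr M (PiM ?I (\<lambda>_. borel)) (\<lambda>\<omega>. \<lambda>i\<in>?I. W i \<omega>) = PiM ?I (\<lambda>i. distr M borel (W i))"
      using False indep_vars_subset[OF W_indep, of ?I]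
      by (subst indep_vars_iff_distr_eq_PiM'[symmetric]) (auto intro!: W_measurable)
    also have "distr \<dots> (PiM {1..m} (\<lambda>_. borel)) (\<lambda>f. \<lambda>i\<in>{1..m}. f (k + i)) =
        distr \<dots> (PiM {1..m} (\<lambda>i. distr M borel (W (k + i)))) (\<lambda>f. \<lambda>i\<in>{1..m}. f (k + i))"
      by (intro distr_cong refl sets_PiM_cong) auto
    also have "\<dots> = PiM {1..m} (\<lambda>i. distr M borel (W (k + i)))"
      by (rule distr_PiM_reindex) (auto intro!: prob_space_distr W_measurable)
    also have "\<dots> = PiM {1..m} (\<lambda>_. distr M borel (W 1))"
      by (intro PiM_cong refl W_ident) auto
    finally show ?thesis .
  qed
  have "distr M borel (\<lambda>\<omega>. \<Sum>i=1..m. W (k + i) \<omega>) =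
     distr (distr M (PiM {1..m} (\<lambda>_. borel)) (\<lambda>\<omega>. \<lambda>i\<in>{1..m}. W (k + i) \<omega>)) borel (\<lambda>f. \<Sum>i=1..m. f i)" for k
    by (subst distr_distr) (auto simp: comp_def intro!: W_measurable measurable_restrict)
  from this[of n] this[of 0] show ?thesis
    by (simp only: law) (simp add: partial_def[abs_def])
qed (simp add: partial_def[abs_def])

text \<open>The weight \<open>f\<close> is kept general because it is used both with the full exponential weight and with
  its truncation to bounded cycle lengths.\<close>
lemma mgf_partial:
  assumes [measurable]: "f \<in> borel_measurable borel"
  shows "(\<integral>\<^sup>+\<omega>. (\<Prod>i=1..n. f (W i \<omega>)) \<partial>M) = (\<integral>\<^sup>+\<omega>. (f (W 1 \<omega>) :: ennreal) \<partial>M) ^ n"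
proof -
  have "(\<integral>\<^sup>+\<omega>. (\<Prod>i=1..n. f (W i \<omega>)) \<partial>M) = (\<Prod>i=1..n. \<integral>\<^sup>+\<omega>. f (W i \<omega>) \<partial>M)"
  proof (rule indep_vars_nn_integral)
    show "indep_vars (\<lambda>_. borel) (\<lambda>i \<omega>. f (W i \<omega>)) {1..n}"
      by (rule indep_vars_compose2[OF indep_vars_subset[OF W_indep]]) auto
  qed auto
  also have "\<dots> = (\<Prod>i=1..n. \<integral>\<^sup>+\<omega>. f (W 1 \<omega>) \<partial>M)"
  proof (rule prod.cong)
    fix i assume "i \<in> {1..n}"
    then have "(\<integral>\<^sup>+\<omega>. f (W i \<omega>) \<partial>M) = (\<integral>\<^sup>+x. f x \<partial>distr M borel (W i))"
      by (subst nn_integral_distr) (auto intro: W_measurable)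
    also have "\<dots> = (\<integral>\<^sup>+x. f x \<partial>distr M borel (W 1))"
      using W_ident[of i] \<open>i \<in> {1..n}\<close> by simp
    also have "\<dots> = (\<integral>\<^sup>+\<omega>. f (W 1 \<omega>) \<partial>M)"
      by (subst nn_integral_distr) (auto intro: W_measurable)
    finally show "(\<integral>\<^sup>+\<omega>. f (W i \<omega>) \<partial>M) = (\<integral>\<^sup>+\<omega>. f (W 1 \<omega>) \<partial>M)" .
  qed simp
  finally show ?thesis by simp
qed

definition box_prob :: "nat \<Rightarrow> real \<Rightarrow> real \<Rightarrow> real \<Rightarrow> real" where
  "box_prob n a b r = prob {\<omega> \<in> space M. \<bar>time n \<omega> - a\<bar> \<le> r \<and> \<bar>reward n \<omega> - b\<bar> \<le> r}"

lemma box_event_measurable [measurable]: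
  "{\<omega> \<in> space M. \<bar>time n \<omega> - a\<bar> \<le> r \<and> \<bar>reward n \<omega> - b\<bar> \<le> r} \<in> events"
  by measurable

text \<open>If the first \<open>n\<close> steps lead near \<open>(a, b)\<close> and the following \<open>m\<close> steps advance by about \<open>(a', b')\<close>, then the
  walk is near the sum after \<open>n + m\<close> steps; the two stretches are independent, and errors add up.
  All convexity in the large deviation principle originates here.\<close>
lemma box_prob_superadditive:
  "box_prob n a b r * box_prob m a' b' r' \<le> box_prob (n + m) (a + a') (b + b') (r + r')"
proof -
  define A where "A = {z :: real \<times> real. \<bar>fst z - a\<bar> \<le> r \<and> \<bar>snd z - b\<bar> \<le> r}"
  define A' where "A' = {z :: real \<times> real. \<bar>fst z - a'\<bar> \<le> r' \<and> \<bar>snd z - b'\<bar> \<le> r'}"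
  define Y where "Y = (\<lambda>\<omega>. \<Sum>i=1..m. W (n + i) \<omega>)"
  have A [measurable]: "A \<in> sets borel" "A' \<in> sets borel"
    unfolding A_def A'_def
    by (auto intro!: borel_closed closed_Collect_conj closed_Collect_le continuous_intros)
  have Y [measurable]: "Y \<in> borel_measurable M"
    unfolding Y_def by (intro borel_measurable_sum W_measurable) auto
  have "box_prob m a' b' r' = prob (partial m -` A' \<inter> space M)"
    unfolding box_prob_def A'_def by (auto intro!: arg_cong[where f=prob])
  also have "\<dots> = measure (distr M borel (partial m)) A'"
    by (subst measure_distr) auto
  also have "\<dots> = measure (distr M borel Y) A'"
    unfolding Y_def distr_shifted_sum ..
  also have "\<dots> = prob (Y -` A' \<inter> space M)"
    by (subst measure_distr) auto
  finally have 1: "box_prob m a' b' r' = prob (Y -` A' \<inter> space M)" .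
  have 2: "box_prob n a b r = prob (partial n -` A \<inter> space M)"
    unfolding box_prob_def A_def by (auto intro!: arg_cong[where f=prob])
  have "box_prob n a b r * box_prob m a' b' r' = prob ((\<lambda>x. (partial n x, Y x)) -` (A \<times> A') \<inter> space M)"
    unfolding 1 2 by (rule indep_varD[symmetric, OF indep_partial_shift[of n m, folded Y_def]]) auto
  also have "\<dots> \<le> box_prob (n + m) (a + a') (b + b') (r + r')"
    unfolding box_prob_def
  proof (rule finite_measure_mono[OF _ box_event_measurable])
    have "partial (n + m) \<omega> = partial n \<omega> + Y \<omega>" for \<omega>
      by (simp only: partial_shift Y_def)
    then show "(\<lambda>x. (partial n x, Y x)) -` (A \<times> A') \<inter> space M \<subseteq>
        {\<omega> \<in> space M. \<bar>time (n + m) \<omega> - (a + a')\<bar> \<le> r + r' \<and>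
          \<bar>reward (n + m) \<omega> - (b + b')\<bar> \<le> r + r'}"
      by (auto simp: A_def A'_def)
  qed
  finally show ?thesis .
qed

lemma box_prob_nonneg: "0 \<le> box_prob n a b r" and box_prob_le_1: "box_prob n a b r \<le> 1"
  unfolding box_prob_def by auto

lemma box_prob_mono:
  assumes "\<bar>a - a'\<bar> + r \<le> r'" "\<bar>b - b'\<bar> + r \<le> r'"
  shows "box_prob n a b r \<le> box_prob n a' b' r'"
  unfolding box_prob_def using assms by (intro finite_measure_mono box_event_measurable) auto

lemma box_prob_power: "box_prob n a b r ^ m \<le> box_prob (m * n) (m * a) (m * b) (m * r)"
proof (induction m)
  case 0
  show ?case by (simp add: box_prob_def prob_space)
next
  case (Suc m)
  have "box_prob n a b r ^ Suc m \<le> box_prob n a b r * box_prob (m * n) (m * a) (m * b) (m * r)"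
    using Suc by (auto intro!: mult_left_mono box_prob_nonneg)
  also have "\<dots> \<le> box_prob (n + m * n) (a + m * a) (b + m * b) (r + m * r)"
    by (rule box_prob_superadditive)
  finally show ?case by (simp add: algebra_simps)
qed


text \<open>Asking for the estimate at all large times, rather than along a sequence, is what makes convex
  combinations and the transfer to the occupation time immediate. One good block for each precision
  suffices by \<open>achievableI\<close>.\<close>
definition achievable :: "(real \<times> real) set" where
  "achievable = {(w, c). \<forall>\<delta>>0. \<forall>\<^sub>F t in at_top. \<exists>n. exp (- (t * (c + \<delta>))) \<le> box_prob n t (w * t) (\<delta> * t)}"

text \<open>One block of duration \<open>s\<close> is repeated \<open>\<lfloor>t / s\<rfloor>\<close> times. The time left over is less than \<open>s\<close> and is
  absorbed in the error \<open>\<delta> t\<close> once \<open>t\<close> is large.\<close>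
lemma achievableI:
  assumes "\<And>\<delta>. \<delta> > 0 \<Longrightarrow> \<exists>t>0. \<exists>n. exp (- (t * (c + \<delta>))) \<le> box_prob n t (w * t) (\<delta> * t)"
  shows "(w, c) \<in> achievable"
  unfolding achievable_def
proof (clarify)
  fix \<delta> :: real assume "\<delta> > 0"
  then obtain s n where s: "s > 0" and sn: "exp (- (s * (c + \<delta>/2))) \<le> box_prob n s (w * s) (\<delta>/2 * s)"
    using assms[of "\<delta>/2"] by auto
  have "exp (- (s * (c + \<delta>/2))) \<le> 1"
    using sn box_prob_le_1 order_trans by blast
  then have c: "0 \<le> c + \<delta>/2"
    using s by (simp add: zero_le_mult_iff)
  have "\<forall>\<^sub>F t in at_top. t \<ge> s \<and> t \<ge> 2 * (s * (1 + \<bar>w\<bar>)) / \<delta>"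
    by (intro eventually_conj eventually_ge_at_top)
  then show "\<forall>\<^sub>F t in at_top. \<exists>n. exp (- (t * (c + \<delta>))) \<le> box_prob n t (w * t) (\<delta> * t)"
  proof eventually_elim
    case (elim t)
    define m where "m = nat \<lfloor>t / s\<rfloor>"
    have "real m \<le> t / s" "t / s \<le> real m + 1"
      using elim s unfolding m_def by (auto simp: of_nat_nat)
    then have m: "m * s \<le> t" "t \<le> m * s + s"
      using s by (auto simp: field_simps)
    have slack: "s + \<bar>w\<bar> * s \<le> \<delta>/2 * t"
      using elim \<open>\<delta> > 0\<close> by (auto simp: field_simps)
    have nn: "0 \<le> \<bar>w\<bar> * s" using s by simp
    have "exp (- (t * (c + \<delta>))) \<le> exp (- (m * s * (c + \<delta>/2)))"
    proof -
      have "m * s * (c + \<delta>/2) \<le> t * (c + \<delta>/2)"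
        using m c by (intro mult_right_mono) auto
      also have "\<dots> \<le> t * (c + \<delta>)"
        using elim s \<open>\<delta> > 0\<close> by (intro mult_left_mono) auto
      finally show ?thesis by simp
    qed
    also have "\<dots> = exp (- (s * (c + \<delta>/2))) ^ m"
      by (simp add: exp_of_nat_mult[symmetric] algebra_simps)
    also have "\<dots> \<le> box_prob n s (w * s) (\<delta>/2 * s) ^ m"
      using sn by (intro power_mono) auto
    also have "\<dots> \<le> box_prob (m * n) (m * s) (m * (w * s)) (m * (\<delta>/2 * s))"
      by (rule box_prob_power)
    also have "\<dots> \<le> box_prob (m * n) t (w * t) (\<delta> * t)"
    proof (rule box_prob_mono)
      have r: "m * (\<delta>/2 * s) \<le> \<delta>/2 * t"
        using m \<open>\<delta> > 0\<close> by (simp add: field_simps)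
      show "\<bar>m * s - t\<bar> + m * (\<delta>/2 * s) \<le> \<delta> * t"
        using r m slack nn by linarith
      have "\<bar>m * (w * s) - w * t\<bar> = \<bar>w\<bar> * \<bar>m * s - t\<bar>"
        by (simp add: abs_mult[symmetric] algebra_simps)
      also have "\<dots> \<le> \<bar>w\<bar> * s"
        using m by (intro mult_left_mono) auto
      finally show "\<bar>m * (w * s) - w * t\<bar> + m * (\<delta>/2 * s) \<le> \<delta> * t"
        using r slack s by linarith
    qed
    finally show ?case by blast
  qed
qed

lemma achievableD:
  "(w, c) \<in> achievable \<Longrightarrow> \<delta> > 0 \<Longrightarrow>
    \<forall>\<^sub>F t in at_top. \<exists>n. exp (- (t * (c + \<delta>))) \<le> box_prob n t (w * t) (\<delta> * t)"
  by (simp add: achievable_def)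

lemma achievable_nonneg:
  assumes "(w, c) \<in> achievable"
  shows "0 \<le> c"
proof (rule field_le_epsilon)
  fix \<delta> :: real assume "\<delta> > 0"
  then have "\<forall>\<^sub>F t in at_top. (\<exists>n. exp (- (t * (c + \<delta>))) \<le> box_prob n t (w * t) (\<delta> * t)) \<and> t > 0"
    using assms by (intro eventually_conj eventually_gt_at_top achievableD)
  then obtain t n where t: "t > 0" "exp (- (t * (c + \<delta>))) \<le> box_prob n t (w * t) (\<delta> * t)"
    using eventually_happens'[OF trivial_limit_at_top_linorder] by blast
  then have "exp (- (t * (c + \<delta>))) \<le> 1"
    using box_prob_le_1 order_trans by blast
  with t show "0 \<le> c + \<delta>" by (simp add: zero_le_mult_iff)
qed

text \<open>Closedness and monotonicity in the cost at once. The precision is split between the approximation and the box.\<close>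
lemma achievable_approx:
  assumes "\<And>e. e > 0 \<Longrightarrow> \<exists>(w', c') \<in> achievable. \<bar>w' - w\<bar> \<le> e \<and> c' \<le> c + e"
  shows "(w, c) \<in> achievable"
  unfolding achievable_def
proof clarify
  fix \<delta> :: real assume "\<delta> > 0"
  then obtain w' c' where wc: "(w', c') \<in> achievable" "\<bar>w' - w\<bar> \<le> \<delta>/2" "c' \<le> c + \<delta>/2"
    using assms[of "\<delta>/2"] by auto
  have "\<forall>\<^sub>F t in at_top. \<exists>n. exp (- (t * (c' + \<delta>/2))) \<le> box_prob n t (w' * t) (\<delta>/2 * t)"
    using \<open>\<delta> > 0\<close> by (intro achievableD[OF wc(1)]) simp
  then show "\<forall>\<^sub>F t in at_top. \<exists>n. exp (- (t * (c + \<delta>))) \<le> box_prob n t (w * t) (\<delta> * t)"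
    using eventually_gt_at_top[of 0]
  proof eventually_elim
    case (elim t)
    then obtain n where n: "exp (- (t * (c' + \<delta>/2))) \<le> box_prob n t (w' * t) (\<delta>/2 * t)" by blast
    have "exp (- (t * (c + \<delta>))) \<le> exp (- (t * (c' + \<delta>/2)))"
      using elim wc by simp
    also note n
    also have "box_prob n t (w' * t) (\<delta>/2 * t) \<le> box_prob n t (w * t) (\<delta> * t)"
    proof (rule box_prob_mono)
      show "\<bar>t - t\<bar> + \<delta>/2 * t \<le> \<delta> * t"
        using elim \<open>\<delta> > 0\<close> by simp
      have "\<bar>w' * t - w * t\<bar> = \<bar>w' - w\<bar> * t"
        using elim by (simp add: abs_mult left_diff_distrib[symmetric])
      also have "\<dots> \<le> \<delta>/2 * t"
        using wc elim by (intro mult_right_mono) auto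
      finally show "\<bar>w' * t - w * t\<bar> + \<delta>/2 * t \<le> \<delta> * t"
        by (simp add: field_simps)
    qed
    finally show ?case by blast
  qed
qed

lemma achievable_upward: "(w, c) \<in> achievable \<Longrightarrow> c \<le> c' \<Longrightarrow> (w, c') \<in> achievable"
  by (rule achievable_approx) (auto intro!: bexI[of _ "(w, c)"])

lemma closed_achievable: "closed achievable"
proof -
  have "(w, c) \<in> achievable" if "(w, c) \<in> closure achievable" for w c
  proof (rule achievable_approx)
    fix e :: real assume "e > 0"
    then obtain w' c' where wc: "(w', c') \<in> achievable" "dist (w', c') (w, c) < e"
      using \<open>(w, c) \<in> closure achievable\<close> unfolding closure_approachable by fastforce
    have "dist w' w \<le> dist (w', c') (w, c)" "dist c' c \<le> dist (w', c') (w, c)"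
      using dist_fst_le[of "(w', c')" "(w, c)"] dist_snd_le[of "(w', c')" "(w, c)"] by auto
    with wc show "\<exists>(w', c') \<in> achievable. \<bar>w' - w\<bar> \<le> e \<and> c' \<le> c + e"
      by (intro bexI[of _ "(w', c')"]) (auto simp: dist_real_def)
  qed
  then have "closure achievable \<subseteq> achievable" by auto
  then show ?thesis using closure_subset_eq by blast
qed

text \<open>To combine \<open>(w, c)\<close> and \<open>(w', c')\<close> with weights \<open>u + v = 1\<close>, follow the strategy of the first pair
  for the time \<open>u t\<close> and that of the second pair for the time \<open>v t\<close>.\<close>
lemma convex_achievable: "convex achievable"
proof (rule convexI, clarsimp)
  fix w c w' c' u v :: real
  assume wc: "(w, c) \<in> achievable" "(w', c') \<in> achievable" and uv: "0 \<le> u" "0 \<le> v" "u + v = 1"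
  show "(u * w + v * w', u * c + v * c') \<in> achievable"
  proof (cases "u = 0 \<or> v = 0")
    case True
    then show ?thesis using wc uv by auto
  next
    case False
    then have pos: "u > 0" "v > 0" using uv by auto
    show ?thesis
      unfolding achievable_def
    proof clarify
      fix \<delta> :: real assume "\<delta> > 0"
      have scale: "filterlim (\<lambda>t. x * t) at_top at_top" if "x > 0" for x :: real
        by (rule filterlim_tendsto_pos_mult_at_top[OF tendsto_const that filterlim_ident])
      have "\<forall>\<^sub>F t in at_top. \<exists>n. exp (- (u * t * (c + \<delta>))) \<le> box_prob n (u * t) (w * (u * t)) (\<delta> * (u * t))"
        by (rule eventually_compose_filterlim[OF achievableD[OF wc(1) \<open>\<delta> > 0\<close>] scale[OF pos(1)]])
      moreover have "\<forall>\<^sub>F t in at_top. \<exists>n. exp (- (v * t * (c' + \<delta>))) \<le> box_prob n (v * t) (w' * (v * t)) (\<delta> * (v * t))"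
        by (rule eventually_compose_filterlim[OF achievableD[OF wc(2) \<open>\<delta> > 0\<close>] scale[OF pos(2)]])
      ultimately show "\<forall>\<^sub>F t in at_top. \<exists>n. exp (- (t * (u * c + v * c' + \<delta>)))
          \<le> box_prob n t ((u * w + v * w') * t) (\<delta> * t)"
      proof eventually_elim
        case (elim t)
        then obtain n m where
          n: "exp (- (u * t * (c + \<delta>))) \<le> box_prob n (u * t) (w * (u * t)) (\<delta> * (u * t))" and
          m: "exp (- (v * t * (c' + \<delta>))) \<le> box_prob m (v * t) (w' * (v * t)) (\<delta> * (v * t))"
          by blast
        have v: "v = 1 - u" using uv by simp
        have "exp (- (t * (u * c + v * c' + \<delta>))) = exp (- (u * t * (c + \<delta>))) * exp (- (v * t * (c' + \<delta>)))"
          unfolding v exp_add[symmetric] by (simp add: algebra_simps)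
        also have "\<dots> \<le> box_prob n (u * t) (w * (u * t)) (\<delta> * (u * t)) *
            box_prob m (v * t) (w' * (v * t)) (\<delta> * (v * t))"
          using n m by (intro mult_mono box_prob_nonneg) auto
        also have "\<dots> \<le> box_prob (n + m) (u * t + v * t) (w * (u * t) + w' * (v * t)) (\<delta> * (u * t) + \<delta> * (v * t))"
          by (rule box_prob_superadditive)
        also have "\<dots> = box_prob (n + m) t ((u * w + v * w') * t) (\<delta> * t)"
          unfolding v by (simp add: algebra_simps)
        finally show ?case by blast
      qed
    qed
  qed
qed

definition mgf :: "real \<Rightarrow> real \<Rightarrow> ennreal" where
  "mgf \<zeta> k = (\<integral>\<^sup>+\<omega>. ennreal (exp (\<zeta> * fst (W 1 \<omega>) + k * snd (W 1 \<omega>))) \<partial>M)"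

definition exponent :: "real \<Rightarrow> ereal" where
  "exponent k = Sup (ereal ` {\<zeta>. mgf \<zeta> k \<le> 1})"

text \<open>The exponential weight of a cycle, restricted to cycles of length at most \<open>C\<close>. On such cycles the
  position after \<open>n\<close> steps is confined to a square of side \<open>n C\<close>, so finitely many boxes of side
  proportional to \<open>n\<close> cover all of it.\<close>
definition truncated_weight :: "real \<Rightarrow> real \<Rightarrow> real \<Rightarrow> real \<times> real \<Rightarrow> ennreal" where
  "truncated_weight \<zeta> k C z = ennreal (exp (\<zeta> * fst z + k * snd z)) * indicator {z. fst z \<le> C} z"

lemma truncated_weight_measurable [measurable]: "truncated_weight \<zeta> k C \<in> borel_measurable borel"
  unfolding truncated_weight_def[abs_def] by measurable

text \<open>Monotone convergence in the truncation level.\<close>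
lemma truncation:
  assumes "mgf \<zeta> k > 1"
  obtains C where "(\<integral>\<^sup>+\<omega>. truncated_weight \<zeta> k C (W 1 \<omega>) \<partial>M) > 1" "C > 0"
proof -
  have [measurable]: "W 1 \<in> borel_measurable M" by (rule W_measurable) simp
  have "mgf \<zeta> k = (\<integral>\<^sup>+\<omega>. (SUP j. truncated_weight \<zeta> k (real j) (W 1 \<omega>)) \<partial>M)"
    unfolding mgf_def
  proof (rule nn_integral_cong)
    fix \<omega>
    obtain j where j: "fst (W 1 \<omega>) \<le> real j" using real_arch_simple by blast
    show "ennreal (exp (\<zeta> * fst (W 1 \<omega>) + k * snd (W 1 \<omega>))) = (SUP j. truncated_weight \<zeta> k (real j) (W 1 \<omega>))"
      using j by (intro antisym SUP_upper2[of j] SUP_least) (auto simp: truncated_weight_def indicator_def)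
  qed
  also have "\<dots> = (SUP j. \<integral>\<^sup>+\<omega>. truncated_weight \<zeta> k (real j) (W 1 \<omega>) \<partial>M)"
  proof (rule nn_integral_monotone_convergence_SUP)
    show "incseq (\<lambda>j \<omega>. truncated_weight \<zeta> k (real j) (W 1 \<omega>))"
      by (auto simp: incseq_def le_fun_def truncated_weight_def indicator_def)
  qed measurable
  finally obtain j where j: "(\<integral>\<^sup>+\<omega>. truncated_weight \<zeta> k (real j) (W 1 \<omega>) \<partial>M) > 1"
    using assms by (auto simp: less_SUP_iff)
  also have "(\<integral>\<^sup>+\<omega>. truncated_weight \<zeta> k (real j) (W 1 \<omega>) \<partial>M)
      \<le> (\<integral>\<^sup>+\<omega>. truncated_weight \<zeta> k (real (Suc j)) (W 1 \<omega>) \<partial>M)"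
    by (intro nn_integral_mono) (auto simp: truncated_weight_def indicator_def)
  finally show thesis by (intro that[of "real (Suc j)"]) auto
qed

lemma prod_truncated_weight:
  "(\<Prod>i=1..n. truncated_weight \<zeta> k C (W i \<omega>)) =
    (if \<forall>i\<in>{1..n}. fst (W i \<omega>) \<le> C then ennreal (exp (\<zeta> * time n \<omega> + k * reward n \<omega>)) else 0)"
proof (induction n)
  case (Suc n)
  show ?case
    using Suc by (auto simp: truncated_weight_def indicator_def partial_Suc ennreal_mult[symmetric]
        exp_add[symmetric] algebra_simps atLeastAtMostSuc_conv)
qed simp

text \<open>Pigeonhole. With \<open>exp r\<close> a lower bound exceeding one for the truncated expectation, the \<open>n\<close>-step
  expectation is at least \<open>exp (n r)\<close>. Cover the positions by \<open>(N + 1)\<^sup>2\<close> boxes of side \<open>n \<eta>\<close>. If no box had the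
  asserted probability, then each would contribute at most \<open>exp (n r / 2)\<close>, which contradicts the
  growth of the total when \<open>n\<close> is large. Boxes at times below \<open>n \<sigma>\<close> are treated apart: there the weight
  itself is at most \<open>exp (n r / 2)\<close>. For the others the side of the box is small compared with the
  elapsed time, so the box fits into the required square.\<close>
lemma block_exists:
  assumes mgf: "mgf \<zeta> k > 1" and "\<delta> > 0"
  shows "\<exists>w\<in>{0..1}. \<exists>t>0. \<exists>n. exp (- (t * (\<zeta> + k * w))) \<le> box_prob n t (w * t) (\<delta> * t)"
proof (rule ccontr)
  assume contra: "\<not> ?thesis"
  from mgf obtain C where C: "(\<integral>\<^sup>+\<omega>. truncated_weight \<zeta> k C (W 1 \<omega>) \<partial>M) > 1" "C > 0"
    by (rule truncation)
  then obtain q where q: "1 < q" "q < (\<integral>\<^sup>+\<omega>. truncated_weight \<zeta> k C (W 1 \<omega>) \<partial>M)"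
    using dense by blast
  then obtain y where "q = ennreal y" "y \<ge> 0"
    by (cases q) auto
  with q have y: "1 < y" "ennreal y < (\<integral>\<^sup>+\<omega>. truncated_weight \<zeta> k C (W 1 \<omega>) \<partial>M)"
    by auto
  define r where "r = ln y"
  have r: "r > 0" and exp_r: "exp r = y" using y by (auto simp: r_def)
  \<comment> \<open>Moving by \<open>d\<close> in both coordinates changes the exponent by at most \<open>\<kappa> d\<close>; the summand 1 keeps \<open>\<kappa>\<close> positive.\<close>
  define \<kappa> where "\<kappa> = \<bar>\<zeta>\<bar> + \<bar>k\<bar> + 1"
  have "\<kappa> > 0" by (auto simp: \<kappa>_def)
  \<comment> \<open>Up to time \<open>n \<sigma>\<close> the exponent is at most \<open>n r / 2\<close>. The mesh \<open>\<eta>\<close> is small enough for the exponent to vary by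
    at most \<open>n r / 2\<close> within a box, and for the box to be small relative to times beyond \<open>n \<sigma> / 2\<close>.\<close>
  define \<sigma> where "\<sigma> = r / (2 * \<kappa>)"
  have "\<sigma> > 0" using r \<open>\<kappa> > 0\<close> by (simp add: \<sigma>_def)
  define \<eta> where "\<eta> = min (\<sigma> / 2) (\<delta> * \<sigma> / 2)"
  have \<eta>: "\<eta> > 0" "\<eta> \<le> \<sigma> / 2" "\<eta> \<le> \<delta> * \<sigma> / 2"
    using \<open>\<sigma> > 0\<close> \<open>\<delta> > 0\<close> by (auto simp: \<eta>_def)
  have \<kappa>\<sigma>: "\<kappa> * \<sigma> = r / 2" using \<open>\<kappa> > 0\<close> by (simp add: \<sigma>_def)
  define N where "N = nat \<lceil>C / \<eta>\<rceil>"
  obtain n :: nat where n: "real n * (r / 2) > ln ((real N + 1)\<^sup>2)" "n > 0"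
  proof -
    obtain n0 :: nat where "real n0 > ln ((real N + 1)\<^sup>2) / (r / 2)" using reals_Archimedean2 by blast
    then have "real (Suc n0) * (r / 2) > ln ((real N + 1)\<^sup>2)" using r by (simp add: field_simps)
    then show thesis by (intro that[of "Suc n0"]) auto
  qed
  define h where "h = n * \<eta>"
  have "h > 0" using n \<eta> by (simp add: h_def)
  define box where "box = (\<lambda>(i, j). {\<omega> \<in> space M. real i * h \<le> time n \<omega> \<and> time n \<omega> < (real i + 1) * h \<and>
     real j * h \<le> reward n \<omega> \<and> reward n \<omega> < (real j + 1) * h})"
  have box_meas [measurable]: "box p \<in> events" for p
    unfolding box_def by (cases p) (simp, measurable)
  have box_int: "(\<integral>\<^sup>+\<omega>. ennreal (exp (\<zeta> * time n \<omega> + k * reward n \<omega>)) * indicator (box p) \<omega> \<partial>M)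
      \<le> ennreal (exp (n * (r / 2)))" for p
  proof -
    obtain i j where p: "p = (i, j)" by (cases p)
    show ?thesis
    \<comment> \<open>Either the box lies below time \<open>n \<sigma>\<close>, or its lower edge is at least \<open>n \<sigma> / 2\<close> because \<open>\<eta> \<le> \<sigma> / 2\<close>.\<close>
    proof (cases "(real i + 1) * \<eta> \<le> \<sigma>")
      case True
      have "(\<integral>\<^sup>+\<omega>. ennreal (exp (\<zeta> * time n \<omega> + k * reward n \<omega>)) * indicator (box p) \<omega> \<partial>M)
          \<le> (\<integral>\<^sup>+\<omega>. ennreal (exp (n * (r / 2))) \<partial>M)"
      proof (intro nn_integral_mono)
        fix \<omega> assume \<omega>: "\<omega> \<in> space M"
        have "\<zeta> * time n \<omega> + k * reward n \<omega> \<le> n * (r / 2)" if "\<omega> \<in> box p"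
        proof -
          have "time n \<omega> \<le> n * \<sigma>"
          proof -
            have "time n \<omega> \<le> n * ((real i + 1) * \<eta>)"
              using that by (auto simp: box_def p h_def algebra_simps)
            also have "\<dots> \<le> n * \<sigma>" using True by (intro mult_left_mono) auto
            finally show ?thesis .
          qed
          have "\<zeta> * time n \<omega> \<le> \<bar>\<zeta>\<bar> * time n \<omega>"
            using time_nonneg[OF \<omega>] by (intro mult_right_mono) auto
          moreover have "k * reward n \<omega> \<le> \<bar>k\<bar> * time n \<omega>"
            using reward_bounds[OF \<omega>, of n] by (intro mult_mono) auto
          ultimately have "\<zeta> * time n \<omega> + k * reward n \<omega> \<le> \<kappa> * time n \<omega>"
            using time_nonneg[OF \<omega>, of n] by (simp add: \<kappa>_def algebra_simps)
          also have "\<dots> \<le> \<kappa> * (n * \<sigma>)"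
            using \<open>\<kappa> > 0\<close> \<open>time n \<omega> \<le> n * \<sigma>\<close> by (intro mult_left_mono) auto
          also have "\<dots> = n * (r / 2)" using \<kappa>\<sigma> by (simp add: algebra_simps)
          finally show ?thesis .
        qed
        then show "ennreal (exp (\<zeta> * time n \<omega> + k * reward n \<omega>)) * indicator (box p) \<omega> \<le> ennreal (exp (n * (r / 2)))"
          by (auto simp: indicator_def intro!: ennreal_leI)
      qed
      then show ?thesis by (simp add: emeasure_space_1)
    next
      case False
      define t where "t = real i * h"
      define a where "a = \<zeta> * (real i * h) + k * (real j * h)"
      have i\<eta>: "real i * \<eta> \<ge> \<sigma> / 2" using False \<eta> by (simp add: algebra_simps)
      then have i: "i > 0" using \<open>\<sigma> > 0\<close> by (cases i) auto
      have t: "t > 0" using i \<open>h > 0\<close> by (simp add: t_def)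
      have h_le: "h \<le> \<delta> * t"
      proof -
        have "\<eta> \<le> \<delta> * (\<sigma> / 2)" using \<eta> by simp
        also have "\<dots> \<le> \<delta> * (real i * \<eta>)" using i\<eta> \<open>\<delta> > 0\<close> by (intro mult_left_mono) auto
        finally have "real n * \<eta> \<le> real n * (\<delta> * (real i * \<eta>))" by (intro mult_left_mono) auto
        then show ?thesis by (simp add: t_def h_def algebra_simps)
      qed
      have prob: "prob (box p) \<le> exp (- a)"
      proof (cases "j \<le> i")
        case True
        define w where "w = real j / real i"
        have w: "w \<in> {0..1}" "w * t = real j * h" using True i by (auto simp: w_def t_def)
        have "prob (box p) \<le> box_prob n t (w * t) (\<delta> * t)"
          unfolding box_prob_def
        proof (rule finite_measure_mono[OF _ box_event_measurable], rule subsetI)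
          fix \<omega> assume "\<omega> \<in> box p"
          then have "\<omega> \<in> space M" "t \<le> time n \<omega>" "time n \<omega> < t + h"
            "w * t \<le> reward n \<omega>" "reward n \<omega> < w * t + h"
            unfolding w(2) by (auto simp: box_def p t_def algebra_simps)
          with h_le show "\<omega> \<in> {\<omega> \<in> space M. \<bar>time n \<omega> - t\<bar> \<le> \<delta> * t \<and> \<bar>reward n \<omega> - w * t\<bar> \<le> \<delta> * t}"
            by (simp add: abs_le_iff)
        qed
        also have "\<dots> \<le> exp (- (t * (\<zeta> + k * w)))"
        proof -
          have "\<not> exp (- (t * (\<zeta> + k * w))) \<le> box_prob n t (w * t) (\<delta> * t)"
            using contra w(1) t by blast
          then show ?thesis by simp
        qed
        also have "t * (\<zeta> + k * w) = \<zeta> * t + k * (w * t)"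
          by (simp add: algebra_simps)
        also have "\<dots> = a"
          unfolding w(2) by (simp add: a_def t_def)
        finally show ?thesis .
      next
        case False
        have "box p = {}"
        proof (rule ccontr)
          assume "box p \<noteq> {}"
          then obtain \<omega> where \<omega>: "\<omega> \<in> space M" "real j * h \<le> reward n \<omega>" "time n \<omega> < (real i + 1) * h"
            by (auto simp: box_def p)
          have "(real i + 1) * h \<le> real j * h"
            using False \<open>h > 0\<close> by (intro mult_right_mono) auto
          with \<omega> reward_bounds[OF \<omega>(1), of n] show False by linarith
        qed
        then show ?thesis by simp
      qed
      have "(\<integral>\<^sup>+\<omega>. ennreal (exp (\<zeta> * time n \<omega> + k * reward n \<omega>)) * indicator (box p) \<omega> \<partial>M)
          \<le> (\<integral>\<^sup>+\<omega>. ennreal (exp (a + n * (r / 2))) * indicator (box p) \<omega> \<partial>M)"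
      proof (intro nn_integral_mono)
        fix \<omega> assume \<omega>: "\<omega> \<in> space M"
        have "\<zeta> * time n \<omega> + k * reward n \<omega> \<le> a + n * (r / 2)" if "\<omega> \<in> box p"
        proof -
          have bound: "c * d \<le> \<bar>c\<bar> * h" if "0 \<le> d" "d \<le> h" for c d
          proof -
            have "c * d \<le> \<bar>c\<bar> * d" using that by (intro mult_right_mono) auto
            also have "\<dots> \<le> \<bar>c\<bar> * h" using that by (intro mult_left_mono) auto
            finally show ?thesis .
          qed
          have "\<zeta> * (time n \<omega> - i * h) \<le> \<bar>\<zeta>\<bar> * h" "k * (reward n \<omega> - j * h) \<le> \<bar>k\<bar> * h"
            by (rule bound; use that in \<open>auto simp: box_def p algebra_simps\<close>)+
          then have "\<zeta> * time n \<omega> + k * reward n \<omega> \<le> a + \<kappa> * h"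
            using \<open>h > 0\<close> by (simp add: a_def \<kappa>_def algebra_simps)
          also have "\<kappa> * h \<le> n * (\<kappa> * \<sigma>)"
          proof -
            have "\<eta> \<le> \<sigma>" using \<eta>(2) \<open>\<sigma> > 0\<close> by simp
            then have "real n * (\<kappa> * \<eta>) \<le> n * (\<kappa> * \<sigma>)"
              using \<open>\<kappa> > 0\<close> by (intro mult_left_mono) auto
            then show ?thesis by (simp add: h_def mult_ac)
          qed
          finally show ?thesis using \<kappa>\<sigma> by simp
        qed
        then show "ennreal (exp (\<zeta> * time n \<omega> + k * reward n \<omega>)) * indicator (box p) \<omega>
            \<le> ennreal (exp (a + n * (r / 2))) * indicator (box p) \<omega>"
          by (auto simp: indicator_def intro!: ennreal_leI)
      qed
      also have "\<dots> = ennreal (exp (a + n * (r / 2)) * prob (box p))"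
        by (simp add: nn_integral_cmult_indicator emeasure_eq_measure ennreal_mult)
      also have "\<dots> \<le> ennreal (exp (a + n * (r / 2)) * exp (- a))"
        using prob by (intro ennreal_leI mult_left_mono) auto
      also have "exp (a + n * (r / 2)) * exp (- a) = exp (n * (r / 2))"
        by (simp add: exp_add[symmetric])
      finally show ?thesis .
    qed
  qed
  let ?P = "{..N} \<times> {..N}"
  have "ennreal (exp (n * r)) = ennreal y ^ n"
    using y exp_r by (simp add: exp_of_nat_mult ennreal_power)
  also have "\<dots> \<le> (\<integral>\<^sup>+\<omega>. truncated_weight \<zeta> k C (W 1 \<omega>) \<partial>M) ^ n"
    using y by (intro power_mono) auto
  also have "\<dots> = (\<integral>\<^sup>+\<omega>. (\<Prod>i=1..n. truncated_weight \<zeta> k C (W i \<omega>)) \<partial>M)"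
    by (rule mgf_partial[symmetric]) measurable
  also have "\<dots> \<le> (\<integral>\<^sup>+\<omega>. (\<Sum>p\<in>?P. ennreal (exp (\<zeta> * time n \<omega> + k * reward n \<omega>)) * indicator (box p) \<omega>) \<partial>M)"
  proof (rule nn_integral_mono)
    fix \<omega> assume \<omega>: "\<omega> \<in> space M"
    show "(\<Prod>i=1..n. truncated_weight \<zeta> k C (W i \<omega>)) \<le>
      (\<Sum>p\<in>?P. ennreal (exp (\<zeta> * time n \<omega> + k * reward n \<omega>)) * indicator (box p) \<omega>)"
    proof (cases "\<forall>i\<in>{1..n}. fst (W i \<omega>) \<le> C")
      case True
      have "time n \<omega> = (\<Sum>i=1..n. fst (W i \<omega>))" by (simp add: partial_def fst_sum)
      also have "\<dots> \<le> (\<Sum>i=1..n. C)" using True by (intro sum_mono) auto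
      finally have time: "time n \<omega> \<le> n * C" by simp
      define i where "i = nat \<lfloor>time n \<omega> / h\<rfloor>"
      define j where "j = nat \<lfloor>reward n \<omega> / h\<rfloor>"
      have rb: "0 \<le> reward n \<omega>" "reward n \<omega> \<le> time n \<omega>" "0 \<le> time n \<omega>"
        using reward_bounds[OF \<omega>, of n] by auto
      have i: "real i \<le> time n \<omega> / h" "time n \<omega> / h < real i + 1"
        and j: "real j \<le> reward n \<omega> / h" "reward n \<omega> / h < real j + 1"
        using rb \<open>h > 0\<close> by (auto simp: i_def j_def of_nat_nat)
      have "\<omega> \<in> box (i, j)"
        using i j \<open>h > 0\<close> \<omega> by (auto simp: box_def field_simps)
      have "time n \<omega> / h \<le> C / \<eta>"
        using time \<open>h > 0\<close> \<eta> n unfolding h_def by (simp add: field_simps)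
      moreover have "reward n \<omega> / h \<le> time n \<omega> / h" using rb \<open>h > 0\<close> by (intro divide_right_mono) auto
      ultimately have "i \<le> N" "j \<le> N"
        unfolding i_def j_def N_def by (intro nat_mono; linarith)+
      then have "(i, j) \<in> ?P" by auto
      have "(\<Prod>i=1..n. truncated_weight \<zeta> k C (W i \<omega>)) =
          ennreal (exp (\<zeta> * time n \<omega> + k * reward n \<omega>)) * indicator (box (i, j)) \<omega>"
        unfolding prod_truncated_weight using True \<open>\<omega> \<in> box (i, j)\<close> by simp
      also have "\<dots> \<le> (\<Sum>p\<in>?P. ennreal (exp (\<zeta> * time n \<omega> + k * reward n \<omega>)) * indicator (box p) \<omega>)"
        by (rule member_le_sum[OF \<open>(i, j) \<in> ?P\<close>]) auto
      finally show ?thesis .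
    next
      case False
      then show ?thesis by (subst prod_truncated_weight) (simp only: if_False zero_le)
    qed
  qed
  also have "\<dots> = (\<Sum>p\<in>?P. \<integral>\<^sup>+\<omega>. ennreal (exp (\<zeta> * time n \<omega> + k * reward n \<omega>)) * indicator (box p) \<omega> \<partial>M)"
    by (rule nn_integral_sum) measurable
  also have "\<dots> \<le> (\<Sum>p\<in>?P. ennreal (exp (n * (r / 2))))"
    by (rule sum_mono) (rule box_int)
  also have "\<dots> = ennreal ((real N + 1)\<^sup>2 * exp (n * (r / 2)))"
    by (subst sum_ennreal) (simp_all add: power2_eq_square algebra_simps)
  finally have "exp (n * r) \<le> (real N + 1)\<^sup>2 * exp (n * (r / 2))"
    by (simp add: ennreal_le_iff)
  also have "(real N + 1)\<^sup>2 < exp (n * (r / 2))"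
    using n(1) by (subst (asm) exp_less_cancel_iff[symmetric]) (simp add: exp_ln)
  then have "(real N + 1)\<^sup>2 * exp (n * (r / 2)) < exp (n * (r / 2)) * exp (n * (r / 2))"
    by (intro mult_strict_right_mono) auto
  also have "\<dots> = exp (n * r)" by (simp add: exp_add[symmetric])
  finally show False by simp
qed

text \<open>The slope \<open>w\<close> found by \<open>block_exists\<close> depends on the precision \<open>\<delta>\<close>. A limit point along a sequence of
  precisions tending to zero works for all of them, because the cost on the line is continuous in \<open>w\<close>.\<close>
lemma achievable_on_line:
  assumes "mgf \<zeta> k > 1"
  shows "\<exists>w. (w, \<zeta> + k * w) \<in> achievable"
proof -
  have "\<forall>j::nat. \<exists>w. w \<in> {0..1} \<and> (\<exists>t>0. \<exists>n. exp (- (t * (\<zeta> + k * w))) \<le> box_prob n t (w * t) (1 / (real j + 1) * t))"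
    using block_exists[OF assms] by (metis of_nat_0_le_iff add_nonneg_pos zero_less_divide_1_iff zero_less_one)
  then obtain w where w: "\<And>j::nat. w j \<in> {0..1}"
    and bl: "\<And>j::nat. \<exists>t>0. \<exists>n. exp (- (t * (\<zeta> + k * w j))) \<le> box_prob n t (w j * t) (1 / (real j + 1) * t)"
    by metis
  have "seq_compact {0..1::real}" by (intro compact_imp_seq_compact compact_Icc)
  then obtain l s where l: "strict_mono (s :: nat \<Rightarrow> nat)" "(w \<circ> s) \<longlonglongrightarrow> l"
    using w unfolding seq_compact_def by metis
  have "(l, \<zeta> + k * l) \<in> achievable"
  proof (rule achievableI)
    fix \<delta> :: real assume "\<delta> > 0"
    have "\<forall>\<^sub>F j in sequentially. dist ((w \<circ> s) j) l < \<delta> / 2 / (1 + \<bar>k\<bar>)"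
      using \<open>\<delta> > 0\<close> by (intro tendstoD[OF l(2)]) auto
    moreover have "(\<lambda>j. 1 / (real j + 1)) \<longlonglongrightarrow> 0"
      using LIMSEQ_inverse_real_of_nat by (simp add: inverse_eq_divide add.commute)
    then have "\<forall>\<^sub>F j in sequentially. 1 / (real j + 1) < \<delta> / 2"
      using \<open>\<delta> > 0\<close> by (intro order_tendstoD) auto
    then have "\<forall>\<^sub>F j in sequentially. 1 / (real (s j) + 1) < \<delta> / 2"
      using filterlim_subseq[OF l(1)] by (rule eventually_compose_filterlim)
    ultimately have "\<forall>\<^sub>F j in sequentially. dist ((w \<circ> s) j) l < \<delta> / 2 / (1 + \<bar>k\<bar>) \<and> 1 / (real (s j) + 1) < \<delta> / 2"
      by (rule eventually_conj)
    then obtain j where "dist ((w \<circ> s) j) l < \<delta> / 2 / (1 + \<bar>k\<bar>)" and d: "1 / (real (s j) + 1) < \<delta> / 2"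
      using eventually_happens'[OF sequentially_bot] by blast
    then have wl: "(1 + \<bar>k\<bar>) * \<bar>w (s j) - l\<bar> < \<delta> / 2"
      by (simp add: dist_real_def field_simps)
    have nn: "0 \<le> \<bar>k\<bar> * \<bar>w (s j) - l\<bar>" by simp
    have wl': "\<bar>w (s j) - l\<bar> + \<bar>k\<bar> * \<bar>w (s j) - l\<bar> < \<delta> / 2"
      using wl by (simp add: distrib_right)
    have a: "\<bar>w (s j) - l\<bar> \<le> \<delta> / 2"
      using wl' nn by linarith
    have b: "\<bar>k\<bar> * \<bar>w (s j) - l\<bar> \<le> \<delta>"
      using wl' \<open>\<delta> > 0\<close> by linarith
    obtain t n where t: "t > 0" and
      tn: "exp (- (t * (\<zeta> + k * w (s j)))) \<le> box_prob n t (w (s j) * t) (1 / (real (s j) + 1) * t)"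
      using bl[of "s j"] by blast
    have "\<bar>k * w (s j) - k * l\<bar> \<le> \<delta>"
      using b unfolding abs_mult[symmetric] right_diff_distrib .
    then have "\<zeta> + k * w (s j) \<le> \<zeta> + k * l + \<delta>"
      by linarith
    then have "t * (\<zeta> + k * w (s j)) \<le> t * (\<zeta> + k * l + \<delta>)"
      using t by (intro mult_left_mono) auto
    then have "exp (- (t * (\<zeta> + k * l + \<delta>))) \<le> exp (- (t * (\<zeta> + k * w (s j))))"
      by simp
    also note tn
    also have "box_prob n t (w (s j) * t) (1 / (real (s j) + 1) * t) \<le> box_prob n t (l * t) (\<delta> * t)"
    proof (rule box_prob_mono)
      have d': "1 / (real (s j) + 1) * t \<le> \<delta> / 2 * t"
        using d t by (intro mult_right_mono) auto
      then show "\<bar>t - t\<bar> + 1 / (real (s j) + 1) * t \<le> \<delta> * t"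
        using \<open>\<delta> > 0\<close> t by (simp add: field_simps)
      have "\<bar>w (s j) * t - l * t\<bar> = \<bar>w (s j) - l\<bar> * t"
        using t by (simp add: abs_mult left_diff_distrib[symmetric])
      also have "\<dots> \<le> \<delta> / 2 * t" using a t by (intro mult_right_mono) auto
      finally have "\<bar>w (s j) * t - l * t\<bar> \<le> \<delta> / 2 * t" .
      moreover have "\<delta> * t = \<delta> / 2 * t + \<delta> / 2 * t" by simp
      ultimately show "\<bar>w (s j) * t - l * t\<bar> + 1 / (real (s j) + 1) * t \<le> \<delta> * t"
        using d' by linarith
    qed
    finally show "\<exists>t>0. \<exists>n. exp (- (t * (\<zeta> + k * l + \<delta>))) \<le> box_prob n t (l * t) (\<delta> * t)"
      using t by blast
  qed
  then show ?thesis by blast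
qed

section \<open>Duality between exponent and achievable costs\<close>

definition rate :: "real \<Rightarrow> ereal" where
  "rate w = (SUP k. ereal (w * k) + exponent k)"

lemma exponent_less_imp: "exponent k < ereal \<zeta> \<Longrightarrow> mgf \<zeta> k > 1"
  by (rule ccontr) (use Sup_upper[of "ereal \<zeta>" "ereal ` {\<zeta>. mgf \<zeta> k \<le> 1}"] in \<open>auto simp: exponent_def not_less\<close>)

lemma exponent_geI:
  assumes "\<And>\<zeta>. mgf \<zeta> k > 1 \<Longrightarrow> a \<le> \<zeta>"
  shows "ereal a \<le> exponent k"
proof (rule ccontr)
  assume "\<not> ereal a \<le> exponent k"
  then have "exponent k < ereal a" by simp
  then obtain \<zeta> where "exponent k < ereal \<zeta>" "\<zeta> < a"
    using ereal_dense2[of "exponent k" "ereal a"] by auto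
  with assms exponent_less_imp show False by fastforce
qed

text \<open>Suppose \<open>(w, c)\<close> is not achievable and separate it strictly from the achievable set by a line with
  normal \<open>(a, b)\<close>. As costs may be increased, \<open>b \<ge> 0\<close>. If \<open>b > 0\<close>, the line has slope \<open>k = - a / b\<close>, and
  since all lines of that slope with intercept above \<open>exponent k\<close> meet the achievable set, this
  exponent is so large that \<open>rate w > c\<close>. If \<open>b = 0\<close>, then \<open>w\<close> itself is separated from all achievable slopes, and
  steeper and steeper lines show that \<open>rate w\<close> exceeds every bound, costs being non-negative.\<close>
lemma rate_le_imp_achievable:
  assumes "rate w \<le> ereal c"
  shows "(w, c) \<in> achievable"
proof (rule ccontr)
  assume "(w, c) \<notin> achievable"
  then obtain p \<beta> where sep: "p \<bullet> (w, c) < \<beta>" "\<forall>x\<in>achievable. p \<bullet> x > \<beta>"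
    using separating_hyperplane_closed_point[OF convex_achievable closed_achievable] by blast
  obtain a b where p: "p = (a, b)" by (cases p)
  have sep0: "a * w + b * c < \<beta>" and sep1: "\<And>v d. (v, d) \<in> achievable \<Longrightarrow> \<beta> < a * v + b * d"
    using sep by (auto simp: p inner_prod_def)
  have rate: "ereal (w * k) + exponent k \<le> ereal c" for k
    using assms unfolding rate_def by (simp add: SUP_le_iff)
  have exponent_real: "w * k + e \<le> c" if "ereal e \<le> exponent k" for e k
  proof -
    have "ereal (w * k) + ereal e \<le> ereal (w * k) + exponent k"
      using that by (intro add_left_mono) auto
    with rate[of k] have "ereal (w * k) + ereal e \<le> ereal c" by (rule order_trans[rotated])
    then show ?thesis by simp
  qed
  have line: "\<exists>v. (v, \<zeta> + k * v) \<in> achievable" if "mgf \<zeta> k > 1" for \<zeta> k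
    by (rule achievable_on_line[OF that])
  have ex_mgf: "\<exists>\<zeta>. mgf \<zeta> k > 1" for k
  proof (rule ccontr)
    assume "\<not> ?thesis"
    then have "ereal (c - w * k + 1) \<le> exponent k" by (intro exponent_geI) auto
    from exponent_real[OF this] show False by simp
  qed
  consider "b < 0" | "b = 0" | "b > 0" by linarith
  then show False
  proof cases
    case 1
    obtain v d where vd: "(v, d) \<in> achievable"
      using ex_mgf[of 0] line by blast
    define d' where "d' = max d ((a * v - \<beta>) / (- b))"
    have "(v, d') \<in> achievable" using achievable_upward[OF vd] by (simp add: d'_def)
    then have "\<beta> < a * v + b * d'" by (rule sep1)
    moreover have "(a * v - \<beta>) / (- b) \<le> d'" by (simp add: d'_def)
    ultimately show False using 1 by (simp add: field_simps)
  next
    case 2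
    \<comment> \<open>A steepness at which the resulting lower bound for \<open>rate w\<close> reaches \<open>c + 1\<close>.\<close>
    define m where "m = (c + 1) / (\<beta> - a * w)"
    have gap: "\<beta> - a * w > 0" using sep0 2 by simp
    define m' where "m' = max m 0"
    have "ereal (m' * \<beta>) \<le> exponent (- (m' * a))"
    proof (rule exponent_geI)
      fix \<zeta> assume "mgf \<zeta> (- (m' * a)) > 1"
      then obtain v where v: "(v, \<zeta> + - (m' * a) * v) \<in> achievable" using line by blast
      have "m' * \<beta> \<le> m' * (a * v)"
        using sep1[OF v] 2 by (intro mult_left_mono) (auto simp: m'_def)
      with achievable_nonneg[OF v] show "m' * \<beta> \<le> \<zeta>" by (simp add: algebra_simps)
    qed
    from exponent_real[OF this] have "m' * (\<beta> - a * w) \<le> c" by (simp add: algebra_simps)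
    moreover have "m * (\<beta> - a * w) \<le> m' * (\<beta> - a * w)"
      using gap by (intro mult_right_mono) (auto simp: m'_def)
    moreover have "m * (\<beta> - a * w) = c + 1" using gap by (simp add: m_def)
    ultimately show False by linarith
  next
    case 3
    have "ereal (\<beta> / b) \<le> exponent (- (a / b))"
    proof (rule exponent_geI)
      fix \<zeta> assume "mgf \<zeta> (- (a / b)) > 1"
      then obtain v where v: "(v, \<zeta> + - (a / b) * v) \<in> achievable" using line by blast
      from sep1[OF v] 3 show "\<beta> / b \<le> \<zeta>" by (simp add: field_simps)
    qed
    from exponent_real[OF this] sep0 3 show False by (simp add: field_simps)
  qed
qed

end

section \<open>Large deviations of a cumulative reward\<close>

text \<open>Independence is stated through the joint law so that the two variables may take values in
  different types, such as a waiting time and a path.\<close>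
lemma (in prob_space) nn_integral_product_law:
  assumes [measurable]: "X \<in> measurable M S" "Y \<in> measurable M T"
    and law: "distr M S X \<Otimes>\<^sub>M distr M T Y = distr M (S \<Otimes>\<^sub>M T) (\<lambda>\<omega>. (X \<omega>, Y \<omega>))"
    and [measurable]: "g \<in> borel_measurable (S \<Otimes>\<^sub>M T)"
  shows "(\<integral>\<^sup>+\<omega>. g (X \<omega>, Y \<omega>) \<partial>M) = (\<integral>\<^sup>+\<omega>. \<integral>\<^sup>+\<omega>'. g (X \<omega>, Y \<omega>') \<partial>M \<partial>M)"
proof -
  interpret Y: prob_space "distr M T Y" by (rule prob_space_distr) measurable
  have "(\<integral>\<^sup>+\<omega>. g (X \<omega>, Y \<omega>) \<partial>M) = (\<integral>\<^sup>+z. g z \<partial>distr M (S \<Otimes>\<^sub>M T) (\<lambda>\<omega>. (X \<omega>, Y \<omega>)))"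
    by (subst nn_integral_distr) auto
  also have "\<dots> = (\<integral>\<^sup>+z. g z \<partial>(distr M S X \<Otimes>\<^sub>M distr M T Y))"
    unfolding law ..
  also have "\<dots> = (\<integral>\<^sup>+x. \<integral>\<^sup>+y. g (x, y) \<partial>distr M T Y \<partial>distr M S X)"
    by (rule Y.nn_integral_fst[symmetric]) measurable
  also have "\<dots> = (\<integral>\<^sup>+\<omega>. \<integral>\<^sup>+y. g (X \<omega>, y) \<partial>distr M T Y \<partial>M)"
    by (subst nn_integral_distr) auto
  also have "\<dots> = (\<integral>\<^sup>+\<omega>. \<integral>\<^sup>+\<omega>'. g (X \<omega>, Y \<omega>') \<partial>M \<partial>M)"
    by (intro nn_integral_cong, subst nn_integral_distr) (auto dest: measurable_space)
  finally show ?thesis .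
qed

context renewal_reward
begin

lemma W1_measurable [measurable]: "W 1 \<in> borel_measurable M" "W (Suc 0) \<in> borel_measurable M"
  using W_measurable[of 1] by auto

text \<open>The inequality is strict because the waiting time is positive with positive probability.\<close>
lemma mgf_less_1:
  assumes "mgf \<zeta>' k \<le> 1" "\<zeta> < \<zeta>'"
  shows "mgf \<zeta> k < 1"
proof -
  have "mgf \<zeta> k < mgf \<zeta>' k"
    unfolding mgf_def
  proof (rule nn_integral_less)
    have le: "exp (\<zeta> * fst (W 1 \<omega>) + k * snd (W 1 \<omega>)) \<le> exp (\<zeta>' * fst (W 1 \<omega>) + k * snd (W 1 \<omega>))"
      if "\<omega> \<in> space M" for \<omega>
      using assms(2) fst_W_nonneg[OF _ that, of 1] by (simp add: mult_right_mono)
    have "mgf \<zeta> k \<le> mgf \<zeta>' k"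
      unfolding mgf_def using le by (intro nn_integral_mono ennreal_leI) auto
    also note assms(1)
    finally show "(\<integral>\<^sup>+\<omega>. ennreal (exp (\<zeta> * fst (W 1 \<omega>) + k * snd (W 1 \<omega>))) \<partial>M) \<noteq> \<infinity>"
      unfolding mgf_def by (auto simp: top_unique)
    show "AE \<omega> in M. ennreal (exp (\<zeta> * fst (W 1 \<omega>) + k * snd (W 1 \<omega>))) \<le>
        ennreal (exp (\<zeta>' * fst (W 1 \<omega>) + k * snd (W 1 \<omega>)))"
      using le by (intro AE_I2 ennreal_leI)
    show "\<not> (AE \<omega> in M. ennreal (exp (\<zeta>' * fst (W 1 \<omega>) + k * snd (W 1 \<omega>))) \<le>
        ennreal (exp (\<zeta> * fst (W 1 \<omega>) + k * snd (W 1 \<omega>))))"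
    proof
      assume ae: "AE \<omega> in M. ennreal (exp (\<zeta>' * fst (W 1 \<omega>) + k * snd (W 1 \<omega>))) \<le>
        ennreal (exp (\<zeta> * fst (W 1 \<omega>) + k * snd (W 1 \<omega>)))"
      have "AE \<omega> in M. fst (W 1 \<omega>) = 0"
        using ae AE_space
      proof eventually_elim
        case (elim \<omega>)
        then have "(\<zeta>' - \<zeta>) * fst (W 1 \<omega>) \<le> 0" by (simp add: algebra_simps)
        then have "fst (W 1 \<omega>) \<le> 0" using assms(2) by (simp add: mult_le_0_iff)
        with fst_W_nonneg[of 1 \<omega>] elim show ?case by simp
      qed
      then have "prob {\<omega> \<in> space M. fst (W 1 \<omega>) = 0} = 1"
        by (subst prob_Collect_eq_1) auto
      with waiting_nontrivial show False by simp
    qed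
  qed measurable
  with assms(1) show ?thesis by simp
qed

lemma mgf_power:
  "(\<integral>\<^sup>+\<omega>. ennreal (exp (\<zeta> * time n \<omega> + k * reward n \<omega>)) \<partial>M) = mgf \<zeta> k ^ n"
proof -
  have "(\<integral>\<^sup>+\<omega>. ennreal (exp (\<zeta> * time n \<omega> + k * reward n \<omega>)) \<partial>M) =
     (\<integral>\<^sup>+\<omega>. (\<Prod>i=1..n. ennreal (exp (\<zeta> * fst (W i \<omega>) + k * snd (W i \<omega>)))) \<partial>M)"
    by (simp add: partial_def fst_sum snd_sum prod_ennreal exp_sum[symmetric] sum.distrib sum_distrib_left)
  also have "\<dots> = mgf \<zeta> k ^ n"
    unfolding mgf_def by (rule mgf_partial) measurable
  finally show ?thesis .
qed

text \<open>By Markov's inequality for \<open>exp (- T\<^sub>n)\<close>, the probability of \<open>T\<^sub>n \<le> t\<close> decays geometrically in \<open>n\<close>.\<close>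
lemma AE_time_unbounded: "AE \<omega> in M. \<exists>n. t < time n \<omega>"
proof -
  let ?N = "{\<omega> \<in> space M. \<forall>n. time n \<omega> \<le> t}"
  have mgf00: "mgf 0 0 \<le> 1" by (simp add: mgf_def emeasure_space_1)
  have lt: "mgf (-1) 0 < 1" by (rule mgf_less_1[OF mgf00]) simp
  then obtain q where q: "mgf (-1) 0 = ennreal q" "0 \<le> q" "q < 1"
    by (cases "mgf (-1) 0") auto
  have le: "emeasure M ?N \<le> ennreal (exp t * q ^ n)" for n
  proof -
    have "emeasure M ?N = (\<integral>\<^sup>+\<omega>. indicator ?N \<omega> \<partial>M)"
      by (rule nn_integral_indicator[symmetric]) measurable
    also have "\<dots> \<le> (\<integral>\<^sup>+\<omega>. ennreal (exp t) * ennreal (exp ((-1) * time n \<omega> + 0 * reward n \<omega>)) \<partial>M)"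
    proof (rule nn_integral_mono)
      fix \<omega>
      show "indicator ?N \<omega> \<le> ennreal (exp t) * ennreal (exp ((-1) * time n \<omega> + 0 * reward n \<omega>))"
      proof (cases "\<omega> \<in> ?N")
        case True
        then have "1 \<le> exp (t - time n \<omega>)" by auto
        then show ?thesis using True
          by (simp add: ennreal_mult[symmetric] exp_add[symmetric])
      qed simp
    qed
    also have "\<dots> = ennreal (exp t) * mgf (-1) 0 ^ n"
      by (subst nn_integral_cmult, measurable) (simp only: mgf_power)
    also have "\<dots> = ennreal (exp t * q ^ n)"
      using q by (simp add: ennreal_power ennreal_mult)
    finally show ?thesis .
  qed
  have "(\<lambda>n. ennreal (exp t * q ^ n)) \<longlonglongrightarrow> ennreal (exp t * 0)"
    using q by (intro tendsto_ennrealI tendsto_mult tendsto_const LIMSEQ_power_zero) auto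
  then have "emeasure M ?N \<le> ennreal (exp t * 0)"
    by (rule LIMSEQ_le_const) (use le in auto)
  then have "emeasure M ?N = 0" by simp
  then show ?thesis
    by (intro AE_I[of _ _ ?N]) (auto simp: not_less)
qed

end

text \<open>A process that agrees with the reward at renewal times and increases with slope at most one in
  between, so it can be compared with the reward at any renewal, before or after \<open>t\<close>. The last
  assumption controls the contribution of a long incomplete cycle, during which the process may gain
  anything between \<open>0\<close> and the elapsed time.\<close>
locale cumulative_reward = renewal_reward +
  fixes F :: "real \<Rightarrow> 'a \<Rightarrow> real"
  assumes F_measurable: "\<And>t. 0 \<le> t \<Longrightarrow> F t \<in> borel_measurable M"
    and F_after: "\<And>n t \<omega>. \<omega> \<in> space M \<Longrightarrow> 0 \<le> t \<Longrightarrow> time n \<omega> \<le> t \<Longrightarrow>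
      reward n \<omega> \<le> F t \<omega> \<and> F t \<omega> \<le> reward n \<omega> + (t - time n \<omega>)"
    and F_before: "\<And>n t \<omega>. \<omega> \<in> space M \<Longrightarrow> 0 \<le> t \<Longrightarrow> t \<le> time n \<omega> \<Longrightarrow>
      F t \<omega> \<le> reward n \<omega> \<and> reward n \<omega> \<le> F t \<omega> + (time n \<omega> - t)"
    and waiting_tail: "\<And>k \<zeta> \<zeta>'. mgf \<zeta>' k \<le> 1 \<Longrightarrow> \<zeta> < \<zeta>' \<Longrightarrow>
      \<exists>K. \<forall>u\<ge>0. exp ((\<zeta> + max k 0) * u) * prob {\<omega> \<in> space M. u < fst (W 1 \<omega>)} \<le> K"
begin

lemma F_bounds: "\<omega> \<in> space M \<Longrightarrow> 0 \<le> t \<Longrightarrow> 0 \<le> F t \<omega> \<and> F t \<omega> \<le> t"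
  using F_after[of \<omega> t 0] by simp

lemma F_near_reward:
  assumes "\<omega> \<in> space M" "0 \<le> t"
  shows "\<bar>F t \<omega> - reward n \<omega>\<bar> \<le> \<bar>time n \<omega> - t\<bar>"
  using F_after[OF assms, of n] F_before[OF assms, of n] by linarith

text \<open>If the walk is near \<open>(t, w t)\<close> at some step, then \<open>F t\<close> is near \<open>w t\<close>, whatever the number of renewals is.\<close>
lemma prob_near_achievable:
  assumes "(w, c) \<in> achievable" "\<delta> > 0"
  shows "\<forall>\<^sub>F t in at_top. exp (- (t * (c + \<delta>))) \<le> prob {\<omega> \<in> space M. \<bar>F t \<omega> / t - w\<bar> \<le> \<delta>}"
proof -
  have "\<forall>\<^sub>F t in at_top. \<exists>n. exp (- (t * (c + \<delta>/2))) \<le> box_prob n t (w * t) (\<delta>/2 * t)"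
    using assms by (intro achievableD) auto
  then show ?thesis
    using eventually_gt_at_top[of 0]
  proof eventually_elim
    case (elim t)
    then obtain n where n: "exp (- (t * (c + \<delta>/2))) \<le> box_prob n t (w * t) (\<delta>/2 * t)" by blast
    have [measurable]: "F t \<in> borel_measurable M" using elim by (intro F_measurable) auto
    have "exp (- (t * (c + \<delta>))) \<le> exp (- (t * (c + \<delta>/2)))"
      using elim assms by simp
    also note n
    also have "box_prob n t (w * t) (\<delta>/2 * t) \<le> prob {\<omega> \<in> space M. \<bar>F t \<omega> / t - w\<bar> \<le> \<delta>}"
      unfolding box_prob_def
    proof (rule finite_measure_mono, rule subsetI)
      fix \<omega> assume "\<omega> \<in> {\<omega> \<in> space M. \<bar>time n \<omega> - t\<bar> \<le> \<delta> / 2 * t \<and> \<bar>reward n \<omega> - w * t\<bar> \<le> \<delta> / 2 * t}"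
      then have \<omega>: "\<omega> \<in> space M" "\<bar>time n \<omega> - t\<bar> \<le> \<delta> / 2 * t" "\<bar>reward n \<omega> - w * t\<bar> \<le> \<delta> / 2 * t" by auto
      have "\<bar>F t \<omega> - w * t\<bar> \<le> \<bar>F t \<omega> - reward n \<omega>\<bar> + \<bar>reward n \<omega> - w * t\<bar>" by linarith
      also have "\<dots> \<le> \<delta> / 2 * t + \<delta> / 2 * t"
        using F_near_reward[OF \<omega>(1), of t n] \<omega> elim by (intro add_mono) auto
      finally have "\<bar>F t \<omega> - w * t\<bar> \<le> \<delta> * t" by simp
      moreover have "F t \<omega> / t - w = (F t \<omega> - w * t) / t" using elim by (simp add: field_simps)
      ultimately show "\<omega> \<in> {\<omega> \<in> space M. \<bar>F t \<omega> / t - w\<bar> \<le> \<delta>}"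
        using elim \<omega> by (simp add: abs_divide pos_divide_le_eq)
    qed measurable
    finally show ?case .
  qed
qed

text \<open>On the event that exactly \<open>n\<close> renewals have occurred, the process has gained at most \<open>t - T\<^sub>n\<close> since the
  last one, so its exponential is at most \<open>exp (k R\<^sub>n + max k 0 * (t - T\<^sub>n))\<close>. The next cycle is independent of the
  first \<open>n\<close> and is longer than \<open>t - T\<^sub>n\<close>; the tail bound turns the product into \<open>K exp (- \<zeta> t)\<close> times
  \<open>exp (\<zeta> T\<^sub>n + k R\<^sub>n)\<close>.\<close>
lemma mgf_F_last_renewal:
  assumes t: "0 \<le> t"
    and K: "\<And>u. 0 \<le> u \<Longrightarrow> exp ((\<zeta> + max k 0) * u) * prob {\<omega> \<in> space M. u < fst (W 1 \<omega>)} \<le> K"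
  shows "(\<integral>\<^sup>+\<omega>. ennreal (exp (k * F t \<omega>)) * indicator {\<omega>. time n \<omega> \<le> t \<and> t < time (Suc n) \<omega>} \<omega> \<partial>M)
    \<le> ennreal (K * exp (- (t * \<zeta>))) * mgf \<zeta> k ^ n"
proof -
  define g where "g = (\<lambda>(x :: real \<times> real, y :: real \<times> real).
    ennreal (exp (k * snd x + max k 0 * (t - fst x))) * indicator {x. fst x \<le> t} x *
      indicator {p. t - fst (fst p) < fst (snd p)} (x, y))"
  have [measurable]: "g \<in> borel_measurable (borel \<Otimes>\<^sub>M borel)"
    unfolding g_def by measurable
  have K0: "0 \<le> K"
    by (rule order_trans[OF _ K[of 0]]) auto
  have "indep_var borel (partial n) borel (W (Suc n))"
    using indep_partial_shift[of n 1] by simp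
  then have law: "distr M borel (partial n) \<Otimes>\<^sub>M distr M borel (W (Suc n)) =
      distr M (borel \<Otimes>\<^sub>M borel) (\<lambda>\<omega>. (partial n \<omega>, W (Suc n) \<omega>))"
    by (simp add: indep_var_distribution_eq)
  have "(\<integral>\<^sup>+\<omega>. ennreal (exp (k * F t \<omega>)) * indicator {\<omega>. time n \<omega> \<le> t \<and> t < time (Suc n) \<omega>} \<omega> \<partial>M)
      \<le> (\<integral>\<^sup>+\<omega>. g (partial n \<omega>, W (Suc n) \<omega>) \<partial>M)"
  proof (rule nn_integral_mono)
    fix \<omega> assume \<omega>: "\<omega> \<in> space M"
    show "ennreal (exp (k * F t \<omega>)) * indicator {\<omega>. time n \<omega> \<le> t \<and> t < time (Suc n) \<omega>} \<omega> \<le> g (partial n \<omega>, W (Suc n) \<omega>)"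
    proof (cases "time n \<omega> \<le> t \<and> t < time (Suc n) \<omega>")
      case True
      have F: "0 \<le> F t \<omega> - reward n \<omega>" "F t \<omega> - reward n \<omega> \<le> t - time n \<omega>"
        using F_after[OF \<omega> t, of n] True by auto
      have "k * (F t \<omega> - reward n \<omega>) \<le> max k 0 * (F t \<omega> - reward n \<omega>)"
        using F by (intro mult_right_mono) auto
      also have "\<dots> \<le> max k 0 * (t - time n \<omega>)"
        using F by (intro mult_left_mono) auto
      finally have "k * F t \<omega> \<le> k * reward n \<omega> + max k 0 * (t - time n \<omega>)"
        by (simp add: algebra_simps)
      then show ?thesis
        using True by (auto simp: g_def indicator_def partial_Suc intro!: ennreal_leI)
    qed auto
  qed
  also have "\<dots> = (\<integral>\<^sup>+\<omega>. \<integral>\<^sup>+\<omega>'. g (partial n \<omega>, W (Suc n) \<omega>') \<partial>M \<partial>M)"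
    by (rule nn_integral_product_law[OF partial_measurable W_measurable_Suc law]) measurable
  also have "\<dots> \<le> (\<integral>\<^sup>+\<omega>. ennreal (K * exp (- (t * \<zeta>))) * ennreal (exp (\<zeta> * time n \<omega> + k * reward n \<omega>)) \<partial>M)"
  proof (rule nn_integral_mono)
    fix \<omega> assume \<omega>: "\<omega> \<in> space M"
    define u where "u = t - time n \<omega>"
    define e where "e = exp (k * reward n \<omega> + max k 0 * u)"
    have tail: "emeasure M {\<omega>' \<in> space M. u < fst (W (Suc n) \<omega>')} = ennreal (prob {\<omega> \<in> space M. u < fst (W 1 \<omega>)})"
    proof -
      have eq: "emeasure M {\<omega>' \<in> space M. u < fst (W (Suc i) \<omega>')} = emeasure (distr M borel (W (Suc i))) {z. u < fst z}" for i
        by (subst emeasure_distr) (auto intro!: arg_cong[where f="emeasure M"])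
      show ?thesis
        using eq[of n] eq[of 0] W_ident[of "Suc n"] by (simp add: emeasure_eq_measure)
    qed
    show "(\<integral>\<^sup>+\<omega>'. g (partial n \<omega>, W (Suc n) \<omega>') \<partial>M) \<le>
      ennreal (K * exp (- (t * \<zeta>))) * ennreal (exp (\<zeta> * time n \<omega> + k * reward n \<omega>))"
    proof (cases "0 \<le> u")
      case True
      have "(\<integral>\<^sup>+\<omega>'. g (partial n \<omega>, W (Suc n) \<omega>') \<partial>M) =
          (\<integral>\<^sup>+\<omega>'. ennreal e * indicator {\<omega>' \<in> space M. u < fst (W (Suc n) \<omega>')} \<omega>' \<partial>M)"
        using True by (intro nn_integral_cong) (auto simp: g_def e_def u_def indicator_def)
      also have "\<dots> = ennreal e * emeasure M {\<omega>' \<in> space M. u < fst (W (Suc n) \<omega>')}"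
        by (rule nn_integral_cmult_indicator) measurable
      also have "\<dots> = ennreal (e * prob {\<omega> \<in> space M. u < fst (W 1 \<omega>)})"
        unfolding tail by (simp add: ennreal_mult e_def)
      also have "e * prob {\<omega> \<in> space M. u < fst (W 1 \<omega>)} =
          exp (k * reward n \<omega> - \<zeta> * u) * (exp ((\<zeta> + max k 0) * u) * prob {\<omega> \<in> space M. u < fst (W 1 \<omega>)})"
        unfolding e_def mult.assoc[symmetric] exp_add[symmetric] by (simp add: algebra_simps)
      also have "\<dots> \<le> exp (k * reward n \<omega> - \<zeta> * u) * K"
        using K[OF True] by (intro mult_left_mono) auto
      also have "\<dots> = (K * exp (- (t * \<zeta>))) * exp (\<zeta> * time n \<omega> + k * reward n \<omega>)"
        unfolding mult.assoc exp_add[symmetric] by (simp add: u_def algebra_simps)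
      finally show ?thesis
        using K0 by (simp add: ennreal_mult ennreal_leI)
    qed (auto simp: g_def u_def indicator_def)
  qed
  also have "\<dots> = ennreal (K * exp (- (t * \<zeta>))) * mgf \<zeta> k ^ n"
    by (subst nn_integral_cmult, measurable) (simp only: mgf_power)
  finally show ?thesis .
qed

text \<open>A slightly larger exponent \<open>\<zeta>'\<close> gives both the strict inequality \<open>mgf \<zeta> k < 1\<close>, which makes the geometric
  series converge, and the tail bound for the incomplete cycle.\<close>
lemma mgf_F_upper:
  assumes "ereal \<zeta> < exponent k"
  shows "\<exists>K. \<forall>t\<ge>0. (\<integral>\<^sup>+\<omega>. ennreal (exp (k * F t \<omega>)) \<partial>M) \<le> ennreal (K * exp (- (t * \<zeta>)))"
proof -
  obtain \<zeta>' where \<zeta>': "mgf \<zeta>' k \<le> 1" "\<zeta> < \<zeta>'"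
    using assms by (auto simp: exponent_def less_Sup_iff)
  obtain K where K: "\<And>u. 0 \<le> u \<Longrightarrow> exp ((\<zeta> + max k 0) * u) * prob {\<omega> \<in> space M. u < fst (W 1 \<omega>)} \<le> K"
    using waiting_tail[OF \<zeta>'] by blast
  have K0: "0 \<le> K"
    by (rule order_trans[OF _ K[of 0]]) auto
  obtain q where q: "mgf \<zeta> k = ennreal q" "0 \<le> q" "q < 1"
    using mgf_less_1[OF \<zeta>'] by (cases "mgf \<zeta> k") auto
  show ?thesis
  proof (intro exI[of _ "K * (1 / (1 - q))"] allI impI)
    fix t :: real assume t: "t \<ge> 0"
    have [measurable]: "F t \<in> borel_measurable M" using t by (rule F_measurable)
    have "(\<integral>\<^sup>+\<omega>. ennreal (exp (k * F t \<omega>)) \<partial>M) \<le>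
      (\<integral>\<^sup>+\<omega>. (\<Sum>n. ennreal (exp (k * F t \<omega>)) * indicator {\<omega>. time n \<omega> \<le> t \<and> t < time (Suc n) \<omega>} \<omega>) \<partial>M)"
    proof (rule nn_integral_mono_AE)
      show "AE \<omega> in M. ennreal (exp (k * F t \<omega>)) \<le>
        (\<Sum>n. ennreal (exp (k * F t \<omega>)) * indicator {\<omega>. time n \<omega> \<le> t \<and> t < time (Suc n) \<omega>} \<omega>)"
        using AE_time_unbounded[of t]
      proof eventually_elim
        case (elim \<omega>)
        define m where "m = (LEAST n. t < time n \<omega>)"
        have m: "t < time m \<omega>" unfolding m_def using elim by (metis LeastI)
        then obtain n where n: "m = Suc n" using t by (cases m) auto
        have "\<not> t < time n \<omega>" using not_less_Least[of n "\<lambda>n. t < time n \<omega>"] n by (simp add: m_def)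
        then have "ennreal (exp (k * F t \<omega>)) = (\<Sum>n\<in>{n}. ennreal (exp (k * F t \<omega>)) * indicator {\<omega>. time n \<omega> \<le> t \<and> t < time (Suc n) \<omega>} \<omega>)"
          using m n by (simp add: indicator_def)
        also have "\<dots> \<le> (\<Sum>n. ennreal (exp (k * F t \<omega>)) * indicator {\<omega>. time n \<omega> \<le> t \<and> t < time (Suc n) \<omega>} \<omega>)"
          by (rule sum_le_suminf) auto
        finally show ?case .
      qed
    qed
    also have "\<dots> = (\<Sum>n. \<integral>\<^sup>+\<omega>. ennreal (exp (k * F t \<omega>)) * indicator {\<omega>. time n \<omega> \<le> t \<and> t < time (Suc n) \<omega>} \<omega> \<partial>M)"
      by (rule nn_integral_suminf) measurable
    also have "\<dots> \<le> (\<Sum>n. ennreal (K * exp (- (t * \<zeta>)) * q ^ n))"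
    proof (rule suminf_le)
      fix n
      show "(\<integral>\<^sup>+\<omega>. ennreal (exp (k * F t \<omega>)) * indicator {\<omega>. time n \<omega> \<le> t \<and> t < time (Suc n) \<omega>} \<omega> \<partial>M)
          \<le> ennreal (K * exp (- (t * \<zeta>)) * q ^ n)"
        using mgf_F_last_renewal[OF t K, of n] q K0 by (simp add: ennreal_power ennreal_mult)
    qed auto
    also have "\<dots> = ennreal (K * exp (- (t * \<zeta>)) * (1 / (1 - q)))"
      using q K0 by (intro suminf_ennreal_eq sums_mult geometric_sums) auto
    finally show "(\<integral>\<^sup>+\<omega>. ennreal (exp (k * F t \<omega>)) \<partial>M) \<le> ennreal (K * (1 / (1 - q)) * exp (- (t * \<zeta>)))"
      by (simp add: mult_ac)
  qed
qed

lemma LDP_lower: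
  assumes "open G"
  shows "- (INF w\<in>G. rate w) \<le>
    Liminf at_top (\<lambda>t. ereal (1 / t) * ln_ennreal (emeasure M {\<omega> \<in> space M. F t \<omega> / t \<in> G}))" (is "_ \<le> ?L")
proof -
  have "- ?L \<le> rate w" if "w \<in> G" for w
  proof (rule ereal_le_real)
    fix c assume c: "rate w \<le> ereal c"
    obtain d where d: "d > 0" "\<And>v. \<bar>v - w\<bar> \<le> d \<Longrightarrow> v \<in> G"
    proof -
      obtain d where "d > 0" "cball w d \<subseteq> G"
        using open_contains_cball[of G] assms \<open>w \<in> G\<close> by blast
      then show thesis
        by (intro that[of d]) (auto simp: dist_real_def abs_minus_commute)
    qed
    show "- ?L \<le> ereal c"
    proof (rule ereal_le_epsilon2)
      fix e :: real assume "e > 0"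
      define \<delta> where "\<delta> = min d e"
      have \<delta>: "\<delta> > 0" "\<delta> \<le> d" "\<delta> \<le> e" using d \<open>e > 0\<close> by (auto simp: \<delta>_def)
      have "ereal (- (c + \<delta>)) \<le> ?L"
      proof (rule Liminf_rate_ge)
        show "\<forall>\<^sub>F t in at_top. ennreal (exp (- (t * (c + \<delta>)))) \<le> emeasure M {\<omega> \<in> space M. F t \<omega> / t \<in> G}"
          using prob_near_achievable[OF rate_le_imp_achievable[OF c] \<delta>(1)] eventually_ge_at_top[of 0]
        proof eventually_elim
          case (elim t)
          have [measurable]: "F t \<in> borel_measurable M" "G \<in> sets borel"
            using elim assms by (auto intro: F_measurable)
          have "prob {\<omega> \<in> space M. \<bar>F t \<omega> / t - w\<bar> \<le> \<delta>} \<le> prob {\<omega> \<in> space M. F t \<omega> / t \<in> G}"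
            using d \<delta> by (intro finite_measure_mono) auto
          with elim show ?case by (simp add: emeasure_eq_measure ennreal_leI)
        qed
      qed
      then have "- ?L \<le> - ereal (- (c + \<delta>))" by (simp only: ereal_minus_le_minus)
      also have "\<dots> \<le> ereal c + ereal e" using \<delta> by simp
      finally show "- ?L \<le> ereal c + ereal e" .
    qed
  qed
  then have "- ?L \<le> (INF w\<in>G. rate w)" by (rule INF_greatest)
  then show ?thesis by (simp add: ereal_uminus_le_reorder)
qed

text \<open>Each point \<open>w\<close> with \<open>a < rate w\<close> lies in an open set \<open>a < v k + \<zeta>\<close> on which Chernoff's inequality, with a
  slope \<open>k\<close> nearly optimal for \<open>w\<close>, gives the decay \<open>exp (- a t)\<close>. Finitely many of these sets cover the
  part of the closed set in \<open>[0, 1]\<close>, which is where \<open>F t / t\<close> takes its values.\<close>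
lemma LDP_upper:
  assumes "closed C"
  shows "Limsup at_top (\<lambda>t. ereal (1 / t) * ln_ennreal (emeasure M {\<omega> \<in> space M. F t \<omega> / t \<in> C}))
    \<le> - (INF w\<in>C. rate w)" (is "?L \<le> _")
proof (rule ccontr)
  assume "\<not> ?thesis"
  then obtain b where b: "- (INF w\<in>C. rate w) < ereal b" "ereal b < ?L"
    using ereal_dense2[of "- (INF w\<in>C. rate w)" ?L] by (auto simp: not_le)
  define a where "a = - b"
  have a: "ereal a < (INF w\<in>C. rate w)"
    using b(1) unfolding a_def by (metis ereal_uminus_less_reorder uminus_ereal.simps(1))
  define P where "P = {(k, \<zeta>). ereal \<zeta> < exponent k}"
  \<comment> \<open>The set on which the exponential moment of slope \<open>k\<close> and rate \<open>\<zeta>\<close> yields the decay rate \<open>a\<close>.\<close>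
  define U where "U = (\<lambda>(k, \<zeta>). {v :: real. a < v * k + \<zeta>})"
  have openU: "open (U p)" for p
    unfolding U_def by (cases p) (auto intro!: open_Collect_less continuous_intros)
  have cover: "C \<inter> {0..1} \<subseteq> (\<Union>p\<in>P. U p)"
  proof
    fix w assume "w \<in> C \<inter> {0..1}"
    then have "ereal a < rate w" using a by (auto intro: less_INF_D)
    then obtain k where k: "ereal a < ereal (w * k) + exponent k"
      unfolding rate_def less_SUP_iff by auto
    then have "ereal (a - w * k) < exponent k"
      by (cases "exponent k") auto
    then obtain \<zeta> where "ereal (a - w * k) < ereal \<zeta>" "ereal \<zeta> < exponent k"
      using ereal_dense2 by blast
    then show "w \<in> (\<Union>p\<in>P. U p)"
      by (intro UN_I[of "(k, \<zeta>)"]) (auto simp: P_def U_def)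
  qed
  have "compact (C \<inter> {0..1})" using assms by (intro closed_Int_compact) auto
  then obtain D where D: "D \<subseteq> P" "finite D" "C \<inter> {0..1} \<subseteq> (\<Union>p\<in>D. U p)"
    using compactE_image[of "C \<inter> {0..1}" P U] openU cover by metis
  have "\<exists>K. \<forall>t\<ge>0. (\<integral>\<^sup>+\<omega>. ennreal (exp (fst p * F t \<omega>)) \<partial>M) \<le> ennreal (K * exp (- (t * snd p)))" if "p \<in> D" for p
    using mgf_F_upper[of "snd p" "fst p"] that D(1) by (auto simp: P_def)
  then obtain K where K: "\<And>p t. p \<in> D \<Longrightarrow> 0 \<le> t \<Longrightarrow>
      (\<integral>\<^sup>+\<omega>. ennreal (exp (fst p * F t \<omega>)) \<partial>M) \<le> ennreal (K p * exp (- (t * snd p)))"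
    by metis
  have "?L \<le> ereal (- a)"
  proof (rule Limsup_rate_le[of _ "\<Sum>p\<in>D. max (K p) 0"])
    show "\<forall>\<^sub>F t in at_top. emeasure M {\<omega> \<in> space M. F t \<omega> / t \<in> C} \<le> ennreal ((\<Sum>p\<in>D. max (K p) 0) * exp (- (t * a)))"
      using eventually_gt_at_top[of 0]
    proof eventually_elim
      case (elim t)
      have [measurable]: "F t \<in> borel_measurable M" using elim by (intro F_measurable) auto
      have [measurable]: "U p \<in> sets borel" for p using openU by auto
      have "emeasure M {\<omega> \<in> space M. F t \<omega> / t \<in> C} \<le> emeasure M (\<Union>p\<in>D. {\<omega> \<in> space M. F t \<omega> / t \<in> U p})"
      proof (rule emeasure_mono)
        show "{\<omega> \<in> space M. F t \<omega> / t \<in> C} \<subseteq> (\<Union>p\<in>D. {\<omega> \<in> space M. F t \<omega> / t \<in> U p})"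
        proof
          fix \<omega> assume \<omega>: "\<omega> \<in> {\<omega> \<in> space M. F t \<omega> / t \<in> C}"
          then have "F t \<omega> / t \<in> C \<inter> {0..1}" using F_bounds[of \<omega> t] elim by auto
          with D(3) \<omega> show "\<omega> \<in> (\<Union>p\<in>D. {\<omega> \<in> space M. F t \<omega> / t \<in> U p})" by blast
        qed
        show "(\<Union>p\<in>D. {\<omega> \<in> space M. F t \<omega> / t \<in> U p}) \<in> events"
          using D(2) by (intro sets.finite_UN) measurable
      qed
      also have "\<dots> \<le> (\<Sum>p\<in>D. emeasure M {\<omega> \<in> space M. F t \<omega> / t \<in> U p})"
        using D(2) by (intro emeasure_subadditive_finite) auto
      also have "\<dots> \<le> (\<Sum>p\<in>D. ennreal (max (K p) 0 * exp (- (t * a))))"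
      proof (rule sum_mono)
        fix p assume p: "p \<in> D"
        obtain k \<zeta> where kz: "p = (k, \<zeta>)" by (cases p)
        have "emeasure M {\<omega> \<in> space M. F t \<omega> / t \<in> U p} = (\<integral>\<^sup>+\<omega>. indicator {\<omega> \<in> space M. F t \<omega> / t \<in> U p} \<omega> \<partial>M)"
          by (rule nn_integral_indicator[symmetric]) measurable
        also have "\<dots> \<le> (\<integral>\<^sup>+\<omega>. ennreal (exp (- (t * (a - \<zeta>)))) * ennreal (exp (k * F t \<omega>)) \<partial>M)"
        proof (rule nn_integral_mono)
          fix \<omega>
          show "indicator {\<omega> \<in> space M. F t \<omega> / t \<in> U p} \<omega> \<le> ennreal (exp (- (t * (a - \<zeta>)))) * ennreal (exp (k * F t \<omega>))"
          proof (cases "F t \<omega> / t \<in> U p")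
            case True
            then have "0 \<le> - (t * (a - \<zeta>)) + k * F t \<omega>"
              using elim by (auto simp: U_def kz field_simps)
            then have "1 \<le> exp (- (t * (a - \<zeta>)) + k * F t \<omega>)" by simp
            then show ?thesis
              by (auto simp: indicator_def ennreal_mult[symmetric] exp_add[symmetric])
          qed simp
        qed
        also have "\<dots> = ennreal (exp (- (t * (a - \<zeta>)))) * (\<integral>\<^sup>+\<omega>. ennreal (exp (k * F t \<omega>)) \<partial>M)"
          by (rule nn_integral_cmult) measurable
        also have "\<dots> \<le> ennreal (exp (- (t * (a - \<zeta>)))) * ennreal (max (K p) 0 * exp (- (t * \<zeta>)))"
          using K[OF p, of t] elim
          by (intro mult_left_mono) (auto simp: kz intro: order_trans ennreal_leI mult_right_mono)
        also have "\<dots> = ennreal (max (K p) 0 * (exp (- (t * (a - \<zeta>))) * exp (- (t * \<zeta>))))"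
          by (simp add: ennreal_mult[symmetric] mult_ac)
        also have "exp (- (t * (a - \<zeta>))) * exp (- (t * \<zeta>)) = exp (- (t * a))"
          by (simp add: exp_add[symmetric] algebra_simps)
        finally show "emeasure M {\<omega> \<in> space M. F t \<omega> / t \<in> U p} \<le> ennreal (max (K p) 0 * exp (- (t * a)))" .
      qed
      also have "\<dots> = ennreal ((\<Sum>p\<in>D. max (K p) 0) * exp (- (t * a)))"
        by (simp add: sum_distrib_right)
      finally show ?case .
    qed
  qed
  with b(2) show False by (simp add: a_def)
qed

theorem full_LDP_rate: "full_LDP M F rate"
  unfolding full_LDP_def
  using LDP_lower LDP_upper lower_semicontinuous_SUP_affine[of exponent, folded rate_def[abs_def]]
  by blast

theorem log_mgf_limit:
  "((\<lambda>t. ereal (1 / t) * ln_ennreal (\<integral>\<^sup>+\<omega>. ennreal (exp (k * F t \<omega>)) \<partial>M)) \<longlongrightarrow> - exponent k) at_top"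
  (is "(?f \<longlongrightarrow> _) _")
proof -
  have upper: "Limsup at_top ?f \<le> - exponent k"
  proof (rule ccontr)
    assume "\<not> ?thesis"
    then obtain b where b: "- exponent k < ereal b" "ereal b < Limsup at_top ?f"
      using ereal_dense2[of "- exponent k" "Limsup at_top ?f"] by (auto simp: not_le)
    then have "ereal (- b) < exponent k"
      by (metis ereal_uminus_less_reorder uminus_ereal.simps(1))
    then obtain K where K: "\<And>t. t \<ge> 0 \<Longrightarrow> (\<integral>\<^sup>+\<omega>. ennreal (exp (k * F t \<omega>)) \<partial>M) \<le> ennreal (K * exp (- (t * (- b))))"
      using mgf_F_upper by blast
    have "Limsup at_top ?f \<le> ereal (- (- b))"
      by (rule Limsup_rate_le, rule eventually_mono[OF eventually_ge_at_top[of 0] K])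
    with b(2) show False by simp
  qed
  have "- Liminf at_top ?f \<le> exponent k"
  proof (rule ccontr)
    assume "\<not> ?thesis"
    then obtain \<zeta> where \<zeta>: "exponent k < ereal \<zeta>" "ereal \<zeta> < - Liminf at_top ?f"
      using ereal_dense2[of "exponent k" "- Liminf at_top ?f"] by (auto simp: not_le)
    obtain w where w: "(w, \<zeta> + k * w) \<in> achievable"
      using achievable_on_line exponent_less_imp[OF \<zeta>(1)] by blast
    have "- Liminf at_top ?f \<le> ereal \<zeta>"
    proof (rule ereal_le_epsilon2)
      fix e :: real assume "e > 0"
      define \<delta> where "\<delta> = e / (1 + \<bar>k\<bar>)"
      have "1 + \<bar>k\<bar> > 0" by simp
      then have "\<delta> > 0" "(1 + \<bar>k\<bar>) * \<delta> = e" using \<open>e > 0\<close> by (auto simp: \<delta>_def)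
      then have \<delta>: "\<delta> > 0" "\<delta> + \<bar>k\<bar> * \<delta> = e" by (simp_all add: distrib_right)
      have "ereal (- (\<zeta> + e)) \<le> Liminf at_top ?f"
      proof (rule Liminf_rate_ge)
        show "\<forall>\<^sub>F t in at_top. ennreal (exp (- (t * (\<zeta> + e)))) \<le> (\<integral>\<^sup>+\<omega>. ennreal (exp (k * F t \<omega>)) \<partial>M)"
          using prob_near_achievable[OF w \<delta>(1)] eventually_gt_at_top[of 0]
        proof eventually_elim
          case (elim t)
          have [measurable]: "F t \<in> borel_measurable M" using elim by (intro F_measurable) auto
          define A where "A = {\<omega> \<in> space M. \<bar>F t \<omega> / t - w\<bar> \<le> \<delta>}"
          have [measurable]: "A \<in> events" unfolding A_def by measurable
          have "exp (- (t * (\<zeta> + e))) = exp (t * (k * w - \<bar>k\<bar> * \<delta>)) * exp (- (t * (\<zeta> + k * w + \<delta>)))"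
            using \<delta>(2)[symmetric] by (simp add: exp_add[symmetric] algebra_simps)
          also have "\<dots> \<le> exp (t * (k * w - \<bar>k\<bar> * \<delta>)) * prob A"
            using elim unfolding A_def by (intro mult_left_mono) auto
          finally have "ennreal (exp (- (t * (\<zeta> + e)))) \<le> ennreal (exp (t * (k * w - \<bar>k\<bar> * \<delta>))) * emeasure M A"
            by (simp add: emeasure_eq_measure ennreal_mult[symmetric] ennreal_leI)
          also have "\<dots> = (\<integral>\<^sup>+\<omega>. ennreal (exp (t * (k * w - \<bar>k\<bar> * \<delta>))) * indicator A \<omega> \<partial>M)"
            by (rule nn_integral_cmult_indicator[symmetric]) measurable
          also have "\<dots> \<le> (\<integral>\<^sup>+\<omega>. ennreal (exp (k * F t \<omega>)) \<partial>M)"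
          proof (rule nn_integral_mono)
            fix \<omega>
            have "t * (k * w - \<bar>k\<bar> * \<delta>) \<le> k * F t \<omega>" if "\<omega> \<in> A"
            proof -
              have "\<bar>k * (F t \<omega> / t - w)\<bar> \<le> \<bar>k\<bar> * \<delta>"
                using that unfolding abs_mult A_def by (intro mult_left_mono) auto
              then have "k * w - \<bar>k\<bar> * \<delta> \<le> k * (F t \<omega> / t)" by (simp add: algebra_simps abs_le_iff)
              then have "t * (k * w - \<bar>k\<bar> * \<delta>) \<le> t * (k * (F t \<omega> / t))"
                using elim by (intro mult_left_mono) auto
              then show ?thesis using elim by simp
            qed
            then show "ennreal (exp (t * (k * w - \<bar>k\<bar> * \<delta>))) * indicator A \<omega> \<le> ennreal (exp (k * F t \<omega>))"
              by (auto simp: indicator_def intro!: ennreal_leI)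
          qed
          finally show ?case .
        qed
      qed
      then have "- Liminf at_top ?f \<le> - ereal (- (\<zeta> + e))" by (simp only: ereal_minus_le_minus)
      then show "- Liminf at_top ?f \<le> ereal \<zeta> + ereal e" by (simp add: add.commute)
    qed
    with \<zeta>(2) show False by simp
  qed
  then have lower: "- exponent k \<le> Liminf at_top ?f"
    by (simp add: ereal_uminus_le_reorder)
  have "Liminf at_top ?f \<le> Limsup at_top ?f" by (rule Liminf_le_Limsup) simp
  with upper lower show ?thesis
    by (intro Liminf_eq_Limsup) auto
qed

end

section \<open>Positive occupation of a path\<close>

lemma positive_occupation_eq_measure:
  "positive_occupation z t = measure lborel {\<tau>. 0 \<le> \<tau> \<and> \<tau> \<le> t \<and> 0 < z \<tau>}"
proof -
  have "positive_occupation z t = (\<integral>\<tau>. indicator {\<tau>. 0 \<le> \<tau> \<and> \<tau> \<le> t \<and> 0 < z \<tau>} \<tau> \<partial>lborel)"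
    unfolding positive_occupation_def set_lebesgue_integral_def
    by (intro Bochner_Integration.integral_cong) (auto simp: indicator_def)
  then show ?thesis by simp
qed

lemma positive_occupation_cong:
  "(\<And>\<tau>. 0 \<le> \<tau> \<Longrightarrow> \<tau> \<le> t \<Longrightarrow> z \<tau> = z' \<tau>) \<Longrightarrow> positive_occupation z t = positive_occupation z' t"
  unfolding positive_occupation_eq_measure by (rule arg_cong[where f="measure lborel"]) auto

lemma positive_occupation_nonneg: "0 \<le> positive_occupation z t"
  unfolding positive_occupation_eq_measure by simp

lemma Icc_fmeasurable: "{a..b :: real} \<in> fmeasurable lborel"
  by (auto simp: fmeasurable_def emeasure_lborel_Icc_eq)

lemma interval_part_lmeasurable:
  assumes "A \<in> sets borel" "A \<subseteq> {a..b :: real}"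
  shows "A \<in> fmeasurable lborel"
  by (rule fmeasurableI2[OF Icc_fmeasurable]) (use assms in auto)

lemma positive_occupation_Lipschitz:
  assumes z: "{\<tau>. 0 \<le> \<tau> \<and> 0 < z \<tau>} \<in> sets borel" and st: "s \<le> t"
  shows "positive_occupation z s \<le> positive_occupation z t"
    and "positive_occupation z t \<le> positive_occupation z s + (t - s)"
proof -
  let ?A = "\<lambda>t. {\<tau>. 0 \<le> \<tau> \<and> \<tau> \<le> t \<and> 0 < z \<tau>}"
  have m: "?A r \<in> sets borel" for r
  proof -
    have "?A r = {\<tau>. 0 \<le> \<tau> \<and> 0 < z \<tau>} \<inter> {..r}" by auto
    then show ?thesis using z by auto
  qed
  have f: "?A r \<in> fmeasurable lborel" for r
    by (rule interval_part_lmeasurable[OF m, of _ 0 r]) auto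
  show "positive_occupation z s \<le> positive_occupation z t"
    unfolding positive_occupation_eq_measure
    using st m[of s] by (intro measure_mono_fmeasurable f) auto
  have "measure lborel (?A t) \<le> measure lborel (?A s \<union> {s..t})"
    using m[of t] by (intro measure_mono_fmeasurable fmeasurable.Un f Icc_fmeasurable) auto
  also have "\<dots> \<le> measure lborel (?A s) + measure lborel {s..t}"
    using m[of s] by (intro measure_Un_le) auto
  finally show "positive_occupation z t \<le> positive_occupation z s + (t - s)"
    unfolding positive_occupation_eq_measure using st by simp
qed

lemma positive_occupation_le:
  assumes z: "{\<tau>. 0 \<le> \<tau> \<and> 0 < z \<tau>} \<in> sets borel" and t: "0 \<le> t"
  shows "positive_occupation z t \<le> t"
proof -
  have "{\<tau>. 0 \<le> \<tau> \<and> \<tau> \<le> 0 \<and> 0 < z \<tau>} = (if 0 < z 0 then {0} else {})" by auto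
  then have "positive_occupation z 0 = 0" by (simp add: positive_occupation_eq_measure)
  with positive_occupation_Lipschitz(2)[OF z t] show ?thesis by simp
qed

text \<open>Half-open intervals match the cycles, on which the renewal count is constant only up to, and
  excluding, the next renewal time.\<close>
lemma positive_occupation_half_open:
  assumes z: "{\<tau>. 0 \<le> \<tau> \<and> 0 < z \<tau>} \<in> sets borel"
  shows "positive_occupation z t = measure lborel {\<tau>. 0 \<le> \<tau> \<and> \<tau> < t \<and> 0 < z \<tau>}"
proof -
  let ?A = "{\<tau>. 0 \<le> \<tau> \<and> \<tau> < t \<and> 0 < z \<tau>}"
  have "?A = {\<tau>. 0 \<le> \<tau> \<and> 0 < z \<tau>} \<inter> {..<t}" by auto
  then have m: "?A \<in> sets borel" using z by auto
  have "measure lborel (?A \<union> (if 0 \<le> t \<and> 0 < z t then {t} else {})) = measure lborel ?A"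
  proof (rule measure_Un_null_set)
    show "?A \<in> sets lborel" using m by simp
    show "(if 0 \<le> t \<and> 0 < z t then {t} else {}) \<in> null_sets lborel"
      by (simp add: null_sets_def)
  qed
  moreover have "?A \<union> (if 0 \<le> t \<and> 0 < z t then {t} else {}) = {\<tau>. 0 \<le> \<tau> \<and> \<tau> \<le> t \<and> 0 < z \<tau>}"
    by (auto simp: less_le)
  ultimately show ?thesis unfolding positive_occupation_eq_measure by simp
qed

text \<open>Translation invariance of Lebesgue measure: after time \<open>T\<close> the path \<open>z\<close> follows the shifted path \<open>b\<close>.\<close>
lemma positive_occupation_concat:
  assumes z: "{\<tau>. 0 \<le> \<tau> \<and> 0 < z \<tau>} \<in> sets borel" and b: "{\<tau>. 0 \<le> \<tau> \<and> 0 < b \<tau>} \<in> sets borel"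
    and T: "0 \<le> T" and s: "0 \<le> s" and eq: "\<And>\<tau>. T \<le> \<tau> \<Longrightarrow> \<tau> < T + s \<Longrightarrow> z \<tau> = b (\<tau> - T)"
  shows "positive_occupation z (T + s) = positive_occupation z T + positive_occupation b s"
proof -
  let ?A = "{\<tau>. 0 \<le> \<tau> \<and> \<tau> < T \<and> 0 < z \<tau>}" and ?B = "{\<tau>. 0 \<le> \<tau> \<and> \<tau> < s \<and> 0 < b \<tau>}"
  have "?A = {\<tau>. 0 \<le> \<tau> \<and> 0 < z \<tau>} \<inter> {..<T}" "?B = {\<tau>. 0 \<le> \<tau> \<and> 0 < b \<tau>} \<inter> {..<s}" by auto
  then have mA: "?A \<in> sets borel" and mB: "?B \<in> sets borel" using z b by auto
  have "(+) T ` ?B = {\<tau>. 0 \<le> \<tau> \<and> 0 < z \<tau>} \<inter> {T..<T+s}"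
  proof (intro set_eqI iffI)
    fix x assume "x \<in> {\<tau>. 0 \<le> \<tau> \<and> 0 < z \<tau>} \<inter> {T..<T+s}"
    then show "x \<in> (+) T ` ?B"
      using eq[of x] by (intro image_eqI[of _ _ "x - T"]) auto
  qed (use T eq in auto)
  then have mC: "(+) T ` ?B \<in> sets borel" using z by auto
  have "measure lborel ((+) T ` ?B) = measure lborel ?B"
    using measure_translation[of T ?B] mB mC by (simp add: measure_completion)
  moreover have "{\<tau>. 0 \<le> \<tau> \<and> \<tau> < T + s \<and> 0 < z \<tau>} = ?A \<union> (+) T ` ?B"
    unfolding \<open>(+) T ` ?B = _\<close> using T s by auto
  moreover have "measure lborel (?A \<union> (+) T ` ?B) = measure lborel ?A + measure lborel ((+) T ` ?B)"
  proof (rule measure_Un2[THEN trans])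
    show "?A \<in> fmeasurable lborel" by (rule interval_part_lmeasurable[OF mA, of 0 T]) auto
    show "(+) T ` ?B \<in> fmeasurable lborel" by (rule interval_part_lmeasurable[OF mC, of T "T + s"]) auto
    have "(+) T ` ?B - ?A = (+) T ` ?B" by auto
    then show "measure lborel ?A + measure lborel ((+) T ` ?B - ?A) = measure lborel ?A + measure lborel ((+) T ` ?B)"
      by simp
  qed
  ultimately show ?thesis
    unfolding positive_occupation_half_open[OF z] positive_occupation_half_open[OF b] by simp
qed

section \<open>Measurability and independence for random paths\<close>

abbreviation path_space :: "(real \<Rightarrow> real) measure" where
  "path_space \<equiv> PiM {0..} (\<lambda>_. borel)"

text \<open>Evaluation at a real time is not jointly measurable on the product space of all functions.
  This version reads the path only at rational times, which makes it jointly measurable, and it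
  agrees with evaluation for continuous paths.\<close>
definition path_value :: "(real \<Rightarrow> real) \<Rightarrow> real \<Rightarrow> real" where
  "path_value b \<tau> = lim (\<lambda>n. b (real (nat \<lfloor>\<tau> * real (Suc n)\<rfloor>) / real (Suc n)))"

lemma path_value_measurable [measurable (raw)]:
  assumes [measurable]: "f \<in> measurable N path_space" "g \<in> borel_measurable N"
  shows "(\<lambda>x. path_value (f x) (g x)) \<in> borel_measurable N"
  unfolding path_value_def
proof (rule borel_measurable_lim_metric)
  fix n
  show "(\<lambda>x. f x (real (nat \<lfloor>g x * real (Suc n)\<rfloor>) / real (Suc n))) \<in> borel_measurable N"
  proof (rule measurable_compose_countable[where f="\<lambda>i x. f x (real i / real (Suc n))" and g="\<lambda>x. nat \<lfloor>g x * real (Suc n)\<rfloor>"])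
    fix i :: nat
    show "(\<lambda>x. f x (real i / real (Suc n))) \<in> borel_measurable N"
      by (rule measurable_compose[OF assms(1) measurable_component_singleton]) simp
  qed measurable
qed

lemma path_value_continuous:
  assumes f: "continuous_on {0..} f" and \<tau>: "0 \<le> \<tau>"
  shows "path_value (\<lambda>t\<in>{0..}. f t) \<tau> = f \<tau>"
proof -
  let ?x = "\<lambda>n. real (nat \<lfloor>\<tau> * real (Suc n)\<rfloor>) / real (Suc n)"
  have floor: "real (nat \<lfloor>\<tau> * real (Suc n)\<rfloor>) = real_of_int \<lfloor>\<tau> * real (Suc n)\<rfloor>" for n
    using \<tau> by (simp add: of_nat_nat)
  have lim0: "(\<lambda>n. 1 / real (Suc n)) \<longlonglongrightarrow> 0"
    using LIMSEQ_inverse_real_of_nat by (simp add: inverse_eq_divide)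
  have "?x \<longlonglongrightarrow> \<tau>"
  proof (rule tendsto_sandwich)
    show "(\<lambda>n. \<tau> - 1 / real (Suc n)) \<longlonglongrightarrow> \<tau>"
      using tendsto_diff[OF tendsto_const lim0, of \<tau>] by simp
    show "\<forall>\<^sub>F n in sequentially. \<tau> - 1 / real (Suc n) \<le> ?x n"
    proof (rule always_eventually, rule allI)
      fix n
      have "\<tau> * real (Suc n) - 1 \<le> real_of_int \<lfloor>\<tau> * real (Suc n)\<rfloor>" by linarith
      then have "(\<tau> * real (Suc n) - 1) / real (Suc n) \<le> ?x n"
        unfolding floor by (intro divide_right_mono) auto
      then show "\<tau> - 1 / real (Suc n) \<le> ?x n" by (simp add: diff_divide_distrib)
    qed
    show "\<forall>\<^sub>F n in sequentially. ?x n \<le> \<tau>"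
    proof (rule always_eventually, rule allI)
      fix n
      have "?x n \<le> \<tau> * real (Suc n) / real (Suc n)"
        unfolding floor by (intro divide_right_mono) auto
      then show "?x n \<le> \<tau>" by simp
    qed
  qed auto
  then have "(\<lambda>n. f (?x n)) \<longlonglongrightarrow> f \<tau>"
    by (rule continuous_on_tendsto_compose[OF f]) (use \<tau> in auto)
  then show ?thesis
    unfolding path_value_def by (intro limI) simp
qed

lemma occupation_measurable:
  assumes [measurable]: "f \<in> measurable N path_space" "s \<in> borel_measurable N"
  shows "(\<lambda>x. positive_occupation (path_value (f x)) (s x)) \<in> borel_measurable N"
proof -
  have "(\<lambda>x. positive_occupation (path_value (f x)) (s x)) =
    (\<lambda>x. \<integral>\<tau>. (if 0 \<le> \<tau> \<and> \<tau> \<le> s x \<and> 0 < path_value (f x) \<tau> then 1 else 0) \<partial>lborel)"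
    unfolding positive_occupation_def set_lebesgue_integral_def
    by (intro ext Bochner_Integration.integral_cong) (auto simp: indicator_def)
  also have "\<dots> \<in> borel_measurable N"
    by measurable
  finally show ?thesis .
qed

lemma continuous_positive_set:
  fixes f :: "real \<Rightarrow> real"
  assumes "continuous_on {0..} f"
  shows "{\<tau>. 0 \<le> \<tau> \<and> 0 < f \<tau>} \<in> sets borel"
proof -
  have "f -` {0<..} \<inter> {0..} \<in> sets (restrict_space borel {0..})"
    using measurable_sets[OF borel_measurable_continuous_on_restrict[OF assms], of "{0<..}"]
    by (simp add: space_restrict_space)
  then have "f -` {0<..} \<inter> {0..} \<in> sets borel"
    by (subst (asm) sets_restrict_space_iff) auto
  moreover have "f -` {0<..} \<inter> {0..} = {\<tau>. 0 \<le> \<tau> \<and> 0 < f \<tau>}" by auto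
  ultimately show ?thesis by simp
qed

text \<open>If two independent families are also independent of each other, then so are the pairs. The
  hypothesis states the mutual independence only for finite intersections of events, which is how
  it follows from independence of the generated algebras.\<close>
lemma (in prob_space) indep_vars_Pair:
  assumes X: "indep_vars N X I" and Y: "indep_vars N' Y I"
    and cross: "\<And>J A C. finite J \<Longrightarrow> J \<noteq> {} \<Longrightarrow> J \<subseteq> I \<Longrightarrow> (\<And>j. j \<in> J \<Longrightarrow> A j \<in> sets (N j)) \<Longrightarrow>
      (\<And>j. j \<in> J \<Longrightarrow> C j \<in> sets (N' j)) \<Longrightarrow>
      prob ((\<Inter>j\<in>J. X j -` A j \<inter> space M) \<inter> (\<Inter>j\<in>J. Y j -` C j \<inter> space M)) =
      prob (\<Inter>j\<in>J. X j -` A j \<inter> space M) * prob (\<Inter>j\<in>J. Y j -` C j \<inter> space M)"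
  shows "indep_vars (\<lambda>i. N i \<Otimes>\<^sub>M N' i) (\<lambda>i \<omega>. (X i \<omega>, Y i \<omega>)) I"
proof -
  have rvX: "i \<in> I \<Longrightarrow> X i \<in> measurable M (N i)" and rvY: "i \<in> I \<Longrightarrow> Y i \<in> measurable M (N' i)" for i
    using X Y by (auto simp: indep_vars_def2)
  define G where "G i = {(X i -` A \<inter> space M) \<inter> (Y i -` C \<inter> space M) | A C. A \<in> sets (N i) \<and> C \<in> sets (N' i)}" for i
  have "indep_sets G I"
  proof (rule indep_setsI)
    fix i assume "i \<in> I"
    then show "G i \<subseteq> events"
      using rvX rvY by (auto simp: G_def intro!: sets.Int measurable_sets)
  next
    fix D J assume J: "J \<noteq> {}" "J \<subseteq> I" "finite J" and D: "\<forall>j\<in>J. D j \<in> G j"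
    then have "\<forall>j\<in>J. \<exists>A C. D j = (X j -` A \<inter> space M) \<inter> (Y j -` C \<inter> space M) \<and> A \<in> sets (N j) \<and> C \<in> sets (N' j)"
      unfolding G_def by blast
    then obtain A C where AC: "\<And>j. j \<in> J \<Longrightarrow> D j = (X j -` A j \<inter> space M) \<inter> (Y j -` C j \<inter> space M)"
      "\<And>j. j \<in> J \<Longrightarrow> A j \<in> sets (N j)" "\<And>j. j \<in> J \<Longrightarrow> C j \<in> sets (N' j)"
      by metis
    have "(\<Inter>j\<in>J. D j) = (\<Inter>j\<in>J. X j -` A j \<inter> space M) \<inter> (\<Inter>j\<in>J. Y j -` C j \<inter> space M)"
      using AC(1) J(1) by auto
    then have "prob (\<Inter>j\<in>J. D j) = prob (\<Inter>j\<in>J. X j -` A j \<inter> space M) * prob (\<Inter>j\<in>J. Y j -` C j \<inter> space M)"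
      using cross[OF J(3,1,2) AC(2,3)] by simp
    also have "\<dots> = (\<Prod>j\<in>J. prob (X j -` A j \<inter> space M)) * (\<Prod>j\<in>J. prob (Y j -` C j \<inter> space M))"
      using indep_varsD[OF X J(1,3,2) AC(2)] indep_varsD[OF Y J(1,3,2) AC(3)] by simp
    also have "\<dots> = (\<Prod>j\<in>J. prob (X j -` A j \<inter> space M) * prob (Y j -` C j \<inter> space M))"
      by (simp add: prod.distrib)
    also have "\<dots> = (\<Prod>j\<in>J. prob (D j))"
    proof (rule prod.cong)
      fix j assume j: "j \<in> J"
      then show "prob (X j -` A j \<inter> space M) * prob (Y j -` C j \<inter> space M) = prob (D j)"
        using cross[of "{j}" A C] AC J(2) by auto
    qed simp
    finally show "prob (\<Inter>j\<in>J. D j) = (\<Prod>j\<in>J. prob (D j))" .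
  qed
  moreover have "Int_stable (G i)" for i
  proof (rule Int_stableI)
    fix a b assume "a \<in> G i" "b \<in> G i"
    then obtain A C A' C' where "a = (X i -` A \<inter> space M) \<inter> (Y i -` C \<inter> space M)" "A \<in> sets (N i)" "C \<in> sets (N' i)"
      "b = (X i -` A' \<inter> space M) \<inter> (Y i -` C' \<inter> space M)" "A' \<in> sets (N i)" "C' \<in> sets (N' i)"
      unfolding G_def by blast
    then show "a \<inter> b \<in> G i"
      unfolding G_def by (auto intro!: exI[of _ "A \<inter> A'"] exI[of _ "C \<inter> C'"])
  qed
  ultimately have "indep_sets (\<lambda>i. sigma_sets (space M) (G i)) I"
    by (rule indep_sets_sigma)
  moreover have "{(\<lambda>\<omega>. (X i \<omega>, Y i \<omega>)) -` D \<inter> space M | D. D \<in> sets (N i \<Otimes>\<^sub>M N' i)} \<subseteq> sigma_sets (space M) (G i)"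
    if i: "i \<in> I" for i
  proof -
    let ?R = "{A \<times> C | A C. A \<in> sets (N i) \<and> C \<in> sets (N' i)}"
    have "{(\<lambda>\<omega>. (X i \<omega>, Y i \<omega>)) -` D \<inter> space M | D. D \<in> sets (N i \<Otimes>\<^sub>M N' i)} =
        sigma_sets (space M) {(\<lambda>\<omega>. (X i \<omega>, Y i \<omega>)) -` D \<inter> space M | D. D \<in> ?R}"
      unfolding sets_pair_measure
      by (rule sigma_sets_vimage_commute) (use measurable_space[OF rvX[OF i]] measurable_space[OF rvY[OF i]] in auto)
    also have "{(\<lambda>\<omega>. (X i \<omega>, Y i \<omega>)) -` D \<inter> space M | D. D \<in> ?R} \<subseteq> G i"
      unfolding G_def by blast
    then have "sigma_sets (space M) {(\<lambda>\<omega>. (X i \<omega>, Y i \<omega>)) -` D \<inter> space M | D. D \<in> ?R} \<subseteq> sigma_sets (space M) (G i)"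
      by (rule sigma_sets_mono')
    finally show ?thesis .
  qed
  ultimately show ?thesis
    unfolding indep_vars_def2 using rvX rvY
    by (auto intro: indep_sets_mono_sets measurable_Pair)
qed

section \<open>Occupation times of Brownian motion\<close>

definition normal_tail :: "real \<Rightarrow> real \<Rightarrow> real" where
  "normal_tail \<delta> c = measure (density lborel (normal_density 0 (sqrt \<delta>))) {c<..}"

lemma normal_tail_pos:
  assumes "\<delta> > 0"
  shows "normal_tail \<delta> c > 0"
proof -
  interpret N: prob_space "density lborel (normal_density 0 (sqrt \<delta>))"
    using assms by (intro prob_space_normal_density) simp
  have "emeasure (density lborel (normal_density 0 (sqrt \<delta>))) {c<..} \<noteq> 0"
  proof
    assume "emeasure (density lborel (normal_density 0 (sqrt \<delta>))) {c<..} = 0"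
    then have "(\<integral>\<^sup>+x. ennreal (normal_density 0 (sqrt \<delta>) x) * indicator {c<..} x \<partial>lborel) = 0"
      by (simp add: emeasure_density)
    then have "AE x in lborel. ennreal (normal_density 0 (sqrt \<delta>) x) * indicator {c<..} x = 0"
      by (subst (asm) nn_integral_0_iff_AE) auto
    then have "AE x in lborel. x \<notin> {c<..<c+1}"
    proof eventually_elim
      case (elim x)
      have "normal_density 0 (sqrt \<delta>) x > 0" using assms by (intro normal_density_pos) simp
      with elim show ?case by (auto simp: indicator_def split: if_splits)
    qed
    then have "emeasure lborel {c<..<c+1} = 0"
      by (subst (asm) AE_iff_measurable[of "{c<..<c+1}"]) auto
    then show False by simp
  qed
  then show ?thesis
    unfolding normal_tail_def by (simp add: N.emeasure_eq_measure zero_less_measure_iff)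
qed

context prob_space
begin

lemma Brownian_independent_increments:
  "standard_Brownian_motion W \<Longrightarrow> 0 \<le> u 0 \<Longrightarrow> mono_on {..n} u \<Longrightarrow>
    indep_vars (\<lambda>_. borel) (\<lambda>i \<omega>. W (u (Suc i)) \<omega> - W (u i) \<omega>) {..<n}"
  by (simp add: standard_Brownian_motion_def)

lemma Brownian_increment:
  "standard_Brownian_motion W \<Longrightarrow> 0 \<le> s \<Longrightarrow> s < t \<Longrightarrow>
    distributed M lborel (\<lambda>\<omega>. W t \<omega> - W s \<omega>) (normal_density 0 (sqrt (t - s)))"
  by (simp add: standard_Brownian_motion_def)

lemma Brownian_path_measurable [measurable]:
  "standard_Brownian_motion W \<Longrightarrow> (\<lambda>\<omega>. \<lambda>t\<in>{0..}. W t \<omega>) \<in> measurable M path_space"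
  by (rule measurable_restrict) (auto simp: standard_Brownian_motion_def)

lemma Brownian_increment_law:
  assumes "standard_Brownian_motion W" "0 \<le> s" "s \<le> t"
  shows "distr M borel (\<lambda>\<omega>. W t \<omega> - W s \<omega>) =
    (if s < t then density lborel (normal_density 0 (sqrt (t - s))) else distr M borel (\<lambda>_. 0))"
proof (cases "s < t")
  case True
  then have "distributed M lborel (\<lambda>\<omega>. W t \<omega> - W s \<omega>) (normal_density 0 (sqrt (t - s)))"
    using assms by (auto simp: standard_Brownian_motion_def)
  then have "distr M lborel (\<lambda>\<omega>. W t \<omega> - W s \<omega>) = density lborel (normal_density 0 (sqrt (t - s)))"
    by (rule distributed_distr_eq_density)
  moreover have "distr M lborel (\<lambda>\<omega>. W t \<omega> - W s \<omega>) = distr M borel (\<lambda>\<omega>. W t \<omega> - W s \<omega>)"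
    by (rule distr_cong) auto
  ultimately show ?thesis using True by simp
qed (use assms in simp)

text \<open>The constant does not depend on the Brownian motion: sort the times of \<open>J\<close>, prepend \<open>0\<close>, and write
  the event in terms of the independent increments, whose laws are prescribed. A time \<open>0 \<in> J\<close> makes the
  first increment vanish, hence the second case in the law \<open>L\<close>.\<close>
lemma Brownian_marginals:
  assumes J: "finite J" "J \<subseteq> {0..}" "J \<noteq> {}" and A: "\<And>t. t \<in> J \<Longrightarrow> A t \<in> sets borel"
  shows "\<exists>c. \<forall>W. standard_Brownian_motion W \<longrightarrow>
    emeasure M {\<omega> \<in> space M. \<forall>t\<in>J. W t \<omega> \<in> A t} = c"
proof -
  define n where "n = card J"
  define xs where "xs = sorted_list_of_set J"
  define u where "u i = (if i = 0 then 0 else xs ! (i - 1))" for i :: nat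
  have xs: "set xs = J" "length xs = n" "sorted xs"
    using J by (auto simp: xs_def n_def)
  have n: "n > 0" using J by (auto simp: n_def card_gt_0_iff)
  have u0: "u 0 = 0" by (simp add: u_def)
  have uSuc: "u (Suc i) = xs ! i" for i by (simp add: u_def)
  have uJ: "u (Suc i) \<in> J" if "i < n" for i
    using that xs nth_mem[of i xs] by (simp add: uSuc)
  have J_eq: "J = (\<lambda>i. u (Suc i)) ` {..<n}"
    using xs by (auto simp: uSuc in_set_conv_nth image_iff Bex_def)
  have u_nonneg: "0 \<le> u i" if "i \<le> n" for i
    using that uJ[of "i - 1"] J(2) u0 by (cases i) auto
  have u_mono: "u i \<le> u j" if "i \<le> j" "j \<le> n" for i j
  proof (cases "i = 0")
    case True
    then show ?thesis using u_nonneg[OF that(2)] u0 by simp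
  next
    case False
    then show ?thesis
      unfolding u_def using that xs by (auto intro!: sorted_nth_mono)
  qed
  define L where "L i = (if u i < u (Suc i) then density lborel (normal_density 0 (sqrt (u (Suc i) - u i)))
    else distr M borel (\<lambda>_. 0 :: real))" for i
  define E where "E = {d \<in> space (PiM {..<n} (\<lambda>_. borel :: real measure)). \<forall>i\<in>{..<n}. (\<Sum>j<Suc i. d j) \<in> A (u (Suc i))}"
  have E: "E \<in> sets (PiM {..<n} (\<lambda>_. borel))"
    unfolding E_def
  proof (rule sets.sets_Collect_finite_All)
    fix i assume i: "i \<in> {..<n}"
    have [measurable]: "A (u (Suc i)) \<in> sets borel" using A uJ i by auto
    have [measurable]: "(\<lambda>d. \<Sum>j<Suc i. d j) \<in> borel_measurable (PiM {..<n} (\<lambda>_. borel :: real measure))"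
      using i by (intro borel_measurable_sum measurable_component_singleton) auto
    show "{d \<in> space (PiM {..<n} (\<lambda>_. borel)). (\<Sum>j<Suc i. d j) \<in> A (u (Suc i))} \<in> sets (PiM {..<n} (\<lambda>_. borel))"
      by measurable
  qed simp
  have main: "emeasure M {\<omega> \<in> space M. \<forall>t\<in>J. W t \<omega> \<in> A t} = emeasure (PiM {..<n} L) E"
    if W: "standard_Brownian_motion W" for W
  proof -
    define D where "D i \<omega> = W (u (Suc i)) \<omega> - W (u i) \<omega>" for i \<omega>
    have "mono_on {..n} u" by (rule mono_onI) (use u_mono in auto)
    then have "indep_vars (\<lambda>_. borel) D {..<n}"
      unfolding D_def[abs_def] by (intro Brownian_independent_increments[OF W]) (simp add: u0)
    moreover have D_meas: "D i \<in> borel_measurable M" if "i < n" for i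
      unfolding D_def using W u_nonneg[of i] u_nonneg[of "Suc i"] that
      by (intro borel_measurable_diff) (auto simp: standard_Brownian_motion_def)
    ultimately have "distr M (PiM {..<n} (\<lambda>_. borel)) (\<lambda>\<omega>. \<lambda>i\<in>{..<n}. D i \<omega>) = PiM {..<n} (\<lambda>i. distr M borel (D i))"
      using n by (subst (asm) indep_vars_iff_distr_eq_PiM') auto
    also have "\<dots> = PiM {..<n} L"
    proof (rule PiM_cong)
      fix i assume "i \<in> {..<n}"
      then show "distr M borel (D i) = L i"
        using Brownian_increment_law[OF W, of "u i" "u (Suc i)"] u_nonneg[of i] u_mono[of i "Suc i"]
        by (simp add: D_def[abs_def] L_def)
    qed simp
    finally have law: "distr M (PiM {..<n} (\<lambda>_. borel)) (\<lambda>\<omega>. \<lambda>i\<in>{..<n}. D i \<omega>) = PiM {..<n} L" .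
    have vec: "(\<lambda>\<omega>. \<lambda>i\<in>{..<n}. D i \<omega>) \<in> measurable M (PiM {..<n} (\<lambda>_. borel))"
      using D_meas by (intro measurable_restrict) auto
    have "(\<lambda>\<omega>. \<lambda>i\<in>{..<n}. D i \<omega>) -` E \<inter> space M = {\<omega> \<in> space M. \<forall>t\<in>J. W t \<omega> \<in> A t}"
    proof -
      have "(\<Sum>j<Suc i. (\<lambda>i\<in>{..<n}. D i \<omega>) j) = W (u (Suc i)) \<omega>" if "i < n" "\<omega> \<in> space M" for i \<omega>
      proof -
        have "(\<Sum>j<Suc i. (\<lambda>i\<in>{..<n}. D i \<omega>) j) = (\<Sum>j<Suc i. W (u (Suc j)) \<omega> - W (u j) \<omega>)"
          using that by (intro sum.cong) (auto simp: D_def)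
        also have "\<dots> = W (u (Suc i)) \<omega> - W (u 0) \<omega>"
          by (rule sum_lessThan_telescope)
        also have "W (u 0) \<omega> = 0" using W that u0 by (simp add: standard_Brownian_motion_def)
        finally show ?thesis by simp
      qed
      moreover have "(\<lambda>i\<in>{..<n}. D i \<omega>) \<in> space (PiM {..<n} (\<lambda>_. borel))" for \<omega>
        by (simp add: space_PiM)
      ultimately show ?thesis
        unfolding E_def J_eq by (auto simp del: sum.lessThan_Suc)
    qed
    then show ?thesis
      unfolding law[symmetric] emeasure_distr[OF vec E] by simp
  qed
  show ?thesis by (intro exI allI impI) (rule main)
qed

text \<open>The law on path space is determined by finitely many coordinates at a time. This is why the
  occupation times of different Brownian motions have the same law.\<close>
lemma Brownian_law_unique:
  assumes W: "standard_Brownian_motion W" and W': "standard_Brownian_motion W'"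
  shows "distr M path_space (\<lambda>\<omega>. \<lambda>t\<in>{0..}. W t \<omega>) = distr M path_space (\<lambda>\<omega>. \<lambda>t\<in>{0..}. W' t \<omega>)"
proof (rule measure_eqI_PiM_infinite)
  show "finite_measure (distr M path_space (\<lambda>\<omega>. \<lambda>t\<in>{0..}. W t \<omega>))"
    using W by (intro finite_measure_distr) measurable
  fix A and J :: "real set"
  assume J: "finite J" "J \<subseteq> {0..}" and A: "\<And>i. i \<in> J \<Longrightarrow> A i \<in> sets (borel :: real measure)"
  have emb: "prod_emb {0..} (\<lambda>_. borel) J (Pi\<^sub>E J A) \<in> sets path_space"
    using J A by (intro sets_PiM_I) auto
  have ev: "emeasure (distr M path_space (\<lambda>\<omega>. \<lambda>t\<in>{0..}. V t \<omega>)) (prod_emb {0..} (\<lambda>_. borel) J (Pi\<^sub>E J A)) =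
      emeasure M {\<omega> \<in> space M. \<forall>t\<in>J. V t \<omega> \<in> A t}" if "standard_Brownian_motion V" for V
  proof -
    have "(\<lambda>\<omega>. \<lambda>t\<in>{0..}. V t \<omega>) -` prod_emb {0..} (\<lambda>_. borel) J (Pi\<^sub>E J A) \<inter> space M = {\<omega> \<in> space M. \<forall>t\<in>J. V t \<omega> \<in> A t}"
      using J by (auto simp: prod_emb_def PiE_iff subset_eq)
    then show ?thesis
      using emeasure_distr[OF Brownian_path_measurable[OF that] emb] by simp
  qed
  show "emeasure (distr M path_space (\<lambda>\<omega>. \<lambda>t\<in>{0..}. W t \<omega>)) (prod_emb {0..} (\<lambda>_. borel) J (Pi\<^sub>E J A)) =
    emeasure (distr M path_space (\<lambda>\<omega>. \<lambda>t\<in>{0..}. W' t \<omega>)) (prod_emb {0..} (\<lambda>_. borel) J (Pi\<^sub>E J A))"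
  proof (cases "J = {}")
    case False
    have "\<exists>c. \<forall>W. standard_Brownian_motion W \<longrightarrow> emeasure M {\<omega> \<in> space M. \<forall>t\<in>J. W t \<omega> \<in> A t} = c"
      by (rule Brownian_marginals[OF J False]) (rule A)
    then obtain c where c: "\<forall>W. standard_Brownian_motion W \<longrightarrow> emeasure M {\<omega> \<in> space M. \<forall>t\<in>J. W t \<omega> \<in> A t} = c"
      by (elim exE)
    show ?thesis
      by (simp only: ev[OF W] ev[OF W'] c[rule_format, OF W] c[rule_format, OF W'])
  next
    case True
    then show ?thesis unfolding ev[OF W] ev[OF W'] by simp
  qed
qed auto

lemma Brownian_uminus:
  assumes "standard_Brownian_motion W"
  shows "standard_Brownian_motion (\<lambda>t \<omega>. - W t \<omega>)"
  unfolding standard_Brownian_motion_def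
proof (intro conjI allI impI ballI)
  fix t :: real assume "0 \<le> t"
  then show "(\<lambda>\<omega>. - W t \<omega>) \<in> borel_measurable M"
    using assms by (auto simp: standard_Brownian_motion_def)
next
  fix \<omega> assume "\<omega> \<in> space M"
  then show "- W 0 \<omega> = 0" "continuous_on {0..} (\<lambda>t. - W t \<omega>)"
    using assms by (auto simp: standard_Brownian_motion_def intro: continuous_on_minus)
next
  fix n :: nat and u :: "nat \<Rightarrow> real" assume "0 \<le> u 0 \<and> mono_on {..n} u"
  then have "indep_vars (\<lambda>_. borel) (\<lambda>i \<omega>. W (u (Suc i)) \<omega> - W (u i) \<omega>) {..<n}"
    using assms by (auto simp: standard_Brownian_motion_def)
  then have "indep_vars (\<lambda>_. borel) (\<lambda>i \<omega>. - (W (u (Suc i)) \<omega> - W (u i) \<omega>)) {..<n}"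
    by (rule indep_vars_compose2) measurable
  then show "indep_vars (\<lambda>_. borel) (\<lambda>i \<omega>. - W (u (Suc i)) \<omega> - - W (u i) \<omega>) {..<n}"
    by (simp add: algebra_simps)
next
  fix s t :: real assume st: "0 \<le> s \<and> s < t"
  then have "distributed M lborel (\<lambda>\<omega>. W t \<omega> - W s \<omega>) (normal_density 0 (sqrt (t - s)))"
    using assms by (auto simp: standard_Brownian_motion_def)
  from normal_density_affine[OF this, of "-1" 0] st
  show "distributed M lborel (\<lambda>\<omega>. - W t \<omega> - - W s \<omega>) (normal_density 0 (sqrt (t - s)))"
    by simp
qed

text \<open>Brownian scaling, for a single time: the probability does not depend on the horizon \<open>s\<close>.\<close>
lemma Brownian_scaled_tail:
  assumes W: "standard_Brownian_motion W" and "\<delta> > 0" "s > 0"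
  shows "prob {\<omega> \<in> space M. c * sqrt s < W (\<delta> * s) \<omega>} = normal_tail \<delta> c"
proof -
  have "distributed M lborel (\<lambda>\<omega>. W (\<delta> * s) \<omega> - W 0 \<omega>) (normal_density 0 (sqrt (\<delta> * s - 0)))"
    using assms(2,3) by (intro Brownian_increment[OF W]) auto
  from normal_density_affine[OF this, of "1 / sqrt s" 0] assms
  have "distributed M lborel (\<lambda>\<omega>. (W (\<delta> * s) \<omega> - W 0 \<omega>) / sqrt s) (normal_density 0 (sqrt \<delta>))"
    by (simp add: real_sqrt_mult)
  then have law: "distr M lborel (\<lambda>\<omega>. (W (\<delta> * s) \<omega> - W 0 \<omega>) / sqrt s) = density lborel (normal_density 0 (sqrt \<delta>))"
    and [measurable]: "(\<lambda>\<omega>. (W (\<delta> * s) \<omega> - W 0 \<omega>) / sqrt s) \<in> borel_measurable M"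
    by (auto dest: distributed_distr_eq_density distributed_measurable)
  have "normal_tail \<delta> c = prob ((\<lambda>\<omega>. (W (\<delta> * s) \<omega> - W 0 \<omega>) / sqrt s) -` {c<..} \<inter> space M)"
    unfolding normal_tail_def law[symmetric] by (subst measure_distr) auto
  also have "(\<lambda>\<omega>. (W (\<delta> * s) \<omega> - W 0 \<omega>) / sqrt s) -` {c<..} \<inter> space M = {\<omega> \<in> space M. c * sqrt s < W (\<delta> * s) \<omega>}"
    using W assms by (auto simp: standard_Brownian_motion_def field_simps)
  finally show ?thesis ..
qed

text \<open>Once \<open>W\<close> exceeds \<open>c \<surd>s\<close> at the early time \<open>\<delta> s\<close>, being non-positive at \<open>u\<close> requires an independent increment
  below \<open>- c \<surd>s\<close>, whose variance is at most \<open>s\<close>. By Chebyshev's inequality this has probability at most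
  \<open>1 / c\<^sup>2 = \<delta> / 2\<close>.\<close>
lemma Brownian_drop:
  assumes W: "standard_Brownian_motion W" and \<delta>: "\<delta> > 0" and s: "s > 0"
    and u: "\<delta> * s \<le> u" "u \<le> s" and c: "c > 0" "c\<^sup>2 = 2 / \<delta>"
  shows "prob {\<omega> \<in> space M. c * sqrt s < W (\<delta> * s) \<omega> \<and> W u \<omega> \<le> 0} \<le> normal_tail \<delta> c * (\<delta> / 2)"
proof (cases "u = \<delta> * s")
  case True
  have "0 < c * sqrt s" using c s by simp
  then have empty: "{\<omega> \<in> space M. c * sqrt s < W (\<delta> * s) \<omega> \<and> W u \<omega> \<le> 0} = {}"
    unfolding True by auto
  show ?thesis
    unfolding empty using normal_tail_pos[OF \<delta>, of c] \<delta> by simp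
next
  case False
  then have du: "\<delta> * s < u" using u by simp
  have ds: "0 < \<delta> * s" using \<delta> s by simp
  define v where "v i = (if i = 0 then 0 else if i = 1 then \<delta> * s else u)" for i :: nat
  define D where "D i \<omega> = W (v (Suc i)) \<omega> - W (v i) \<omega>" for i \<omega>
  have "mono_on {..2} v" using ds du by (auto simp: mono_on_def v_def)
  then have ind: "indep_vars (\<lambda>_. borel) D {..<2}"
    unfolding D_def[abs_def] by (intro Brownian_independent_increments[OF W]) (simp add: v_def)
  have D0: "D 0 \<omega> = W (\<delta> * s) \<omega>" if "\<omega> \<in> space M" for \<omega>
    using W that by (simp add: D_def v_def standard_Brownian_motion_def)
  have D1: "D 1 \<omega> = W u \<omega> - W (\<delta> * s) \<omega>" for \<omega>
    by (simp add: D_def v_def)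
  have rv [measurable]: "D 0 \<in> borel_measurable M" "D 1 \<in> borel_measurable M"
    using ind by (auto simp: indep_vars_def2)
  have [measurable]: "D (Suc 0) \<in> borel_measurable M" using rv(2) by simp
  define r where "r = c * sqrt s"
  have r: "r > 0" "r\<^sup>2 = 2 * s / \<delta>" using c s by (auto simp: r_def power_mult_distrib)
  have dist: "distributed M lborel (D 1) (normal_density 0 (sqrt (u - \<delta> * s)))"
    unfolding D1[abs_def] using ds du by (intro Brownian_increment[OF W]) auto
  have pos: "0 < sqrt (u - \<delta> * s)" using du by simp
  have "integrable M (\<lambda>\<omega>. (D 1 \<omega>)\<^sup>2)"
    using distributed_integrable[OF dist, of "\<lambda>x. x\<^sup>2"] integrable_normal_moment[OF pos, of 0 2] by simp
  then have "prob {\<omega> \<in> space M. r \<le> \<bar>D 1 \<omega> - expectation (D 1)\<bar>} \<le> variance (D 1) / r\<^sup>2"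
    using r(1) by (rule Chebyshev_inequality[OF rv(2)])
  moreover have "expectation (D 1) = 0"
    using normal_distributed_expectation[OF pos dist] .
  moreover have "variance (D 1) = u - \<delta> * s"
    using normal_distributed_variance[OF pos dist] du by simp
  ultimately have "prob {\<omega> \<in> space M. r \<le> \<bar>D 1 \<omega>\<bar>} \<le> (u - \<delta> * s) / r\<^sup>2" by simp
  also have "\<dots> \<le> s / r\<^sup>2" using u ds by (intro divide_right_mono) auto
  also have "\<dots> = \<delta> / 2" using r s by (simp add: field_simps)
  finally have cheb: "prob {\<omega> \<in> space M. r \<le> \<bar>D 1 \<omega>\<bar>} \<le> \<delta> / 2" .
  define A where "A i = (if i = 0 then {r<..} else {..- r})" for i :: nat
  have "prob {\<omega> \<in> space M. r < W (\<delta> * s) \<omega> \<and> W u \<omega> \<le> 0} \<le> prob (\<Inter>i\<in>{..<2}. D i -` A i \<inter> space M)"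
  proof (rule finite_measure_mono)
    show "{\<omega> \<in> space M. r < W (\<delta> * s) \<omega> \<and> W u \<omega> \<le> 0} \<subseteq> (\<Inter>i\<in>{..<2}. D i -` A i \<inter> space M)"
      using D0 D1 by (auto simp: A_def less_2_cases_iff)
    have "D i -` A i \<inter> space M \<in> events" if "i \<in> {..<2}" for i
      using that rv by (intro measurable_sets[of _ _ borel]) (auto simp: A_def less_2_cases_iff)
    moreover have "(0 :: nat) \<in> {..<2}" by simp
    ultimately show "(\<Inter>i\<in>{..<2}. D i -` A i \<inter> space M) \<in> events"
      by (intro sets.finite_INT) (blast intro: finite_lessThan)+
  qed
  also have "\<dots> = (\<Prod>i\<in>{..<2}. prob (D i -` A i \<inter> space M))"
    by (rule indep_varsD_finite[OF ind]) (auto simp: A_def lessThan_empty_iff)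
  also have "\<dots> = prob (D 0 -` {r<..} \<inter> space M) * prob (D 1 -` {..-r} \<inter> space M)"
    by (simp add: numeral_2_eq_2 A_def)
  also have "\<dots> \<le> normal_tail \<delta> c * (\<delta> / 2)"
  proof (rule mult_mono)
    have "D 0 -` {r<..} \<inter> space M = {\<omega> \<in> space M. c * sqrt s < W (\<delta> * s) \<omega>}"
      using D0 by (auto simp: r_def)
    then show "prob (D 0 -` {r<..} \<inter> space M) \<le> normal_tail \<delta> c"
      using Brownian_scaled_tail[OF W \<delta> s, of c] by simp
    have "prob (D 1 -` {..-r} \<inter> space M) \<le> prob {\<omega> \<in> space M. r \<le> \<bar>D 1 \<omega>\<bar>}"
      by (rule finite_measure_mono) (auto, measurable)
    with cheb show "prob (D 1 -` {..-r} \<inter> space M) \<le> \<delta> / 2" by linarith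
  qed (use normal_tail_pos[OF \<delta>, of c] in auto)
  finally show ?thesis by (simp add: r_def)
qed

lemma Brownian_occupation_measurable:
  assumes W: "standard_Brownian_motion W" and s: "0 \<le> s"
  shows "(\<lambda>\<omega>. positive_occupation (\<lambda>\<tau>. W \<tau> \<omega>) s) \<in> borel_measurable M"
proof -
  have "(\<lambda>\<omega>. positive_occupation (path_value (\<lambda>t\<in>{0..}. W t \<omega>)) s) \<in> borel_measurable M"
    using Brownian_path_measurable[OF W] by (intro occupation_measurable) auto
  also have "?this \<longleftrightarrow> (\<lambda>\<omega>. positive_occupation (\<lambda>\<tau>. W \<tau> \<omega>) s) \<in> borel_measurable M"
    using W by (intro measurable_cong positive_occupation_cong path_value_continuous)
      (auto simp: standard_Brownian_motion_def)
  finally show ?thesis .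
qed

text \<open>Let \<open>\<delta> = \<epsilon> / 2\<close>, and let \<open>E\<close> be the event that \<open>W\<close> exceeds \<open>c \<surd>s\<close> at time \<open>\<delta> s\<close>, of probability \<open>q\<close>. By \<open>Brownian_drop\<close> and Fubini
  the expected non-positive time between \<open>\<delta> s\<close> and \<open>s\<close>, on \<open>E\<close>, is at most \<open>q \<delta> s / 2\<close>. By Markov's inequality it
  is below \<open>\<delta> s\<close> on a part of \<open>E\<close> of probability at least \<open>q / 2\<close>; there at most \<open>2 \<delta> s = \<epsilon> s\<close> of the time up to \<open>s\<close>
  is lost. The bound \<open>q / 2\<close> depends on \<open>\<epsilon>\<close> alone.\<close>
lemma Brownian_occupation_high:
  assumes "0 < \<epsilon>"
  shows "\<exists>p>0. \<forall>W s. standard_Brownian_motion W \<longrightarrow> 0 < s \<longrightarrow>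
    p \<le> prob {\<omega> \<in> space M. (1 - \<epsilon>) * s \<le> positive_occupation (\<lambda>\<tau>. W \<tau> \<omega>) s}"
proof -
  define \<delta> where "\<delta> = \<epsilon> / 2"
  have \<delta>: "\<delta> > 0" using assms by (simp add: \<delta>_def)
  define c where "c = sqrt (2 / \<delta>)"
  have c: "c > 0" "c\<^sup>2 = 2 / \<delta>" using \<delta> by (auto simp: c_def)
  define q where "q = normal_tail \<delta> c"
  have q: "q > 0" unfolding q_def by (rule normal_tail_pos[OF \<delta>])
  show ?thesis
  proof (intro exI[of _ "q / 2"] conjI allI impI)
    show "0 < q / 2" using q by simp
  next
    fix W :: "real \<Rightarrow> 'a \<Rightarrow> real" and s :: real
    assume W: "standard_Brownian_motion W" and s: "0 < s"
    note [measurable] = Brownian_path_measurable[OF W] Brownian_occupation_measurable[OF W less_imp_le[OF s]]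
    have cont: "continuous_on {0..} (\<lambda>t. W t \<omega>)" if "\<omega> \<in> space M" for \<omega>
      using W that by (auto simp: standard_Brownian_motion_def)
    have pv: "path_value (\<lambda>t\<in>{0..}. W t \<omega>) \<tau> = W \<tau> \<omega>" if "\<omega> \<in> space M" "0 \<le> \<tau>" for \<omega> \<tau>
      using path_value_continuous[OF cont] that by simp
    define E where "E = {\<omega> \<in> space M. c * sqrt s < W (\<delta> * s) \<omega>}"
    have ds: "0 < \<delta> * s" using \<delta> s by simp
    have Wm: "W u \<in> borel_measurable M" if "0 \<le> u" for u
      using W that by (auto simp: standard_Brownian_motion_def)
    have E [measurable]: "E \<in> events" unfolding E_def using Wm[OF less_imp_le[OF ds]] by measurable
    have PE: "prob E = q"
      unfolding E_def q_def by (rule Brownian_scaled_tail[OF W \<delta> s])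
    define f where "f \<omega> u = (indicator E \<omega> * indicator {\<delta> * s..s} u *
        indicator {x. x \<le> 0} (path_value (\<lambda>t\<in>{0..}. W t \<omega>) u) :: ennreal)" for \<omega> u
    have f_meas [measurable]: "case_prod f \<in> borel_measurable (M \<Otimes>\<^sub>M lborel)"
      unfolding f_def by measurable
    interpret P: pair_sigma_finite M lborel
      by unfold_locales
    define N where "N \<omega> = (\<integral>\<^sup>+u. f \<omega> u \<partial>lborel)" for \<omega>
    have N_meas [measurable]: "N \<in> borel_measurable M" unfolding N_def by measurable
    have "(\<integral>\<^sup>+\<omega>. N \<omega> \<partial>M) = (\<integral>\<^sup>+u. \<integral>\<^sup>+\<omega>. f \<omega> u \<partial>M \<partial>lborel)"
      unfolding N_def by (rule P.Fubini'[symmetric]) measurable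
    also have "\<dots> \<le> (\<integral>\<^sup>+u. ennreal (q * (\<delta> / 2)) * indicator {\<delta> * s..s} u \<partial>lborel)"
    proof (rule nn_integral_mono)
      fix u
      show "(\<integral>\<^sup>+\<omega>. f \<omega> u \<partial>M) \<le> ennreal (q * (\<delta> / 2)) * indicator {\<delta> * s..s} u"
      proof (cases "u \<in> {\<delta> * s..s}")
        case True
        then have u: "\<delta> * s \<le> u" "u \<le> s" "0 \<le> u" using ds by auto
        have "(\<integral>\<^sup>+\<omega>. f \<omega> u \<partial>M) = (\<integral>\<^sup>+\<omega>. indicator {\<omega> \<in> space M. c * sqrt s < W (\<delta> * s) \<omega> \<and> W u \<omega> \<le> 0} \<omega> \<partial>M)"
          using True u(3) by (intro nn_integral_cong) (auto simp: f_def E_def pv indicator_def)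
        also have "\<dots> = emeasure M {\<omega> \<in> space M. c * sqrt s < W (\<delta> * s) \<omega> \<and> W u \<omega> \<le> 0}"
          using Wm[OF u(3)] Wm[OF less_imp_le[OF ds]] by (intro nn_integral_indicator) simp
        also have "\<dots> \<le> ennreal (q * (\<delta> / 2))"
          unfolding emeasure_eq_measure q_def using Brownian_drop[OF W \<delta> s u(1,2) c] by (intro ennreal_leI)
        finally show ?thesis using True by simp
      qed (simp add: f_def)
    qed
    also have "\<dots> = ennreal (q * (\<delta> / 2)) * emeasure lborel {\<delta> * s..s}"
      by (rule nn_integral_cmult_indicator) simp
    also have "\<dots> \<le> ennreal (q * (\<delta> / 2)) * ennreal s"
    proof (rule mult_left_mono)
      show "emeasure lborel {\<delta> * s..s} \<le> ennreal s"
        using ds s by (cases "\<delta> * s \<le> s") (auto intro!: ennreal_leI)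
    qed simp
    also have "\<dots> = ennreal (q / 2 * (\<delta> * s))"
      using q \<delta> s by (simp add: ennreal_mult[symmetric] mult_ac)
    finally have EN: "(\<integral>\<^sup>+\<omega>. N \<omega> \<partial>M) \<le> ennreal (q / 2 * (\<delta> * s))" .
    define Bad where "Bad = {\<omega> \<in> space M. ennreal (\<delta> * s) \<le> N \<omega>}"
    have [measurable]: "Bad \<in> events" unfolding Bad_def by measurable
    have "ennreal (\<delta> * s) * emeasure M Bad = (\<integral>\<^sup>+\<omega>. ennreal (\<delta> * s) * indicator Bad \<omega> \<partial>M)"
      by (rule nn_integral_cmult_indicator[symmetric]) measurable
    also have "\<dots> \<le> (\<integral>\<^sup>+\<omega>. N \<omega> \<partial>M)"
      by (rule nn_integral_mono) (auto simp: Bad_def indicator_def)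
    also note EN
    finally have "ennreal (\<delta> * s * prob Bad) \<le> ennreal (q / 2 * (\<delta> * s))"
      using ds by (subst ennreal_mult) (auto simp only: emeasure_eq_measure less_imp_le measure_nonneg)
    then have "\<delta> * s * prob Bad \<le> q / 2 * (\<delta> * s)"
      by (subst (asm) ennreal_le_iff) (use q ds in auto)
    then have "\<delta> * s * prob Bad \<le> \<delta> * s * (q / 2)"
      by (simp only: mult.commute[of "q / 2"])
    then have "prob Bad \<le> q / 2" using ds by (simp only: mult_le_cancel_left_pos)
    have "q / 2 \<le> prob E - prob Bad" using PE \<open>prob Bad \<le> q / 2\<close> by simp
    also have "\<dots> \<le> prob (E - Bad)"
      using measure_Diff[of M] finite_measure_Diff'[of E Bad] finite_measure_mono[of "E \<inter> Bad" Bad] by auto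
    also have "\<dots> \<le> prob {\<omega> \<in> space M. (1 - \<epsilon>) * s \<le> positive_occupation (\<lambda>\<tau>. W \<tau> \<omega>) s}"
    proof (rule finite_measure_mono, rule subsetI)
      fix \<omega> assume \<omega>: "\<omega> \<in> E - Bad"
      then have sp: "\<omega> \<in> space M" and Nlt: "N \<omega> < ennreal (\<delta> * s)" by (auto simp: E_def Bad_def)
      let ?Z = "{u. 0 \<le> u \<and> u \<le> s \<and> 0 < W u \<omega>}"
      let ?Y = "{u. \<delta> * s \<le> u \<and> u \<le> s \<and> W u \<omega> \<le> 0}"
      have Zm: "?Z \<in> sets borel"
      proof -
        have "?Z = {\<tau>. 0 \<le> \<tau> \<and> 0 < W \<tau> \<omega>} \<inter> {..s}" by auto
        then show ?thesis using continuous_positive_set[OF cont[OF sp]] by auto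
      qed
      have Yeq: "?Y = {\<delta> * s..s} - ?Z" using ds by auto
      then have Ym: "?Y \<in> sets borel" using Zm by auto
      have "N \<omega> = (\<integral>\<^sup>+u. indicator ?Y u \<partial>lborel)"
        unfolding N_def using \<omega> ds
        by (intro nn_integral_cong) (auto simp: f_def pv[OF sp] indicator_def)
      also have "\<dots> = emeasure lborel ?Y" using Ym by simp
      finally have N: "N \<omega> = emeasure lborel ?Y" .
      have fY: "?Y \<in> fmeasurable lborel" by (rule interval_part_lmeasurable[OF Ym, of "\<delta> * s" s]) auto
      have fZ: "?Z \<in> fmeasurable lborel" by (rule interval_part_lmeasurable[OF Zm, of 0 s]) auto
      have "measure lborel ?Y < \<delta> * s"
        using Nlt fY unfolding N by (simp add: emeasure_eq_measure2 ennreal_less_iff)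
      moreover have "s - \<delta> * s \<le> measure lborel {\<delta> * s..s}" by (cases "\<delta> * s \<le> s") auto
      moreover have "measure lborel {\<delta> * s..s} \<le> measure lborel (?Z \<union> ?Y)"
        using fY fZ ds by (intro measure_mono_fmeasurable fmeasurable.Un) auto
      moreover have "measure lborel (?Z \<union> ?Y) \<le> measure lborel ?Z + measure lborel ?Y"
        using Zm Ym by (intro measure_Un_le) auto
      ultimately have "(1 - 2 * \<delta>) * s \<le> measure lborel ?Z" by (simp add: algebra_simps)
      then show "\<omega> \<in> {\<omega> \<in> space M. (1 - \<epsilon>) * s \<le> positive_occupation (\<lambda>\<tau>. W \<tau> \<omega>) s}"
        using sp by (simp add: positive_occupation_eq_measure \<delta>_def)
    qed measurable
    finally show "q / 2 \<le> prob {\<omega> \<in> space M. (1 - \<epsilon>) * s \<le> positive_occupation (\<lambda>\<tau>. W \<tau> \<omega>) s}" .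
  qed
qed

text \<open>Times at which \<open>- W\<close> is positive are disjoint from those at which \<open>W\<close> is positive. As \<open>- W\<close> is again a
  Brownian motion, small occupation times inherit the lower bound for large ones.\<close>
lemma Brownian_occupation_low:
  assumes W: "standard_Brownian_motion W" and s: "0 < s"
  shows "prob {\<omega> \<in> space M. (1 - \<epsilon>) * s \<le> positive_occupation (\<lambda>\<tau>. - W \<tau> \<omega>) s}
    \<le> prob {\<omega> \<in> space M. positive_occupation (\<lambda>\<tau>. W \<tau> \<omega>) s \<le> \<epsilon> * s}"
proof (rule finite_measure_mono, rule subsetI)
  fix \<omega> assume \<omega>: "\<omega> \<in> {\<omega> \<in> space M. (1 - \<epsilon>) * s \<le> positive_occupation (\<lambda>\<tau>. - W \<tau> \<omega>) s}"
  then have cont: "continuous_on {0..} (\<lambda>t. W t \<omega>)" "continuous_on {0..} (\<lambda>t. - W t \<omega>)"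
    using W by (auto simp: standard_Brownian_motion_def intro: continuous_on_minus)
  define Z where "Z = {u. 0 \<le> u \<and> u \<le> s \<and> 0 < W u \<omega>}"
  define Y where "Y = {u. 0 \<le> u \<and> u \<le> s \<and> 0 < - W u \<omega>}"
  have "Z = {\<tau>. 0 \<le> \<tau> \<and> 0 < W \<tau> \<omega>} \<inter> {..s}" "Y = {\<tau>. 0 \<le> \<tau> \<and> 0 < - W \<tau> \<omega>} \<inter> {..s}"
    unfolding Z_def Y_def by auto
  then have m: "Z \<in> sets borel" "Y \<in> sets borel"
    using continuous_positive_set[OF cont(1)] continuous_positive_set[OF cont(2)] by auto
  have sub: "Z \<subseteq> {0..s}" "Y \<subseteq> {0..s}" and disj: "Y - Z = Y"
    unfolding Z_def Y_def by auto
  have f: "Z \<in> fmeasurable lborel" "Y \<in> fmeasurable lborel"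
    using m sub by (auto intro: interval_part_lmeasurable)
  have "measure lborel Z + measure lborel Y = measure lborel (Z \<union> Y)"
    using measure_Un2[OF f] disj by simp
  also have "\<dots> \<le> measure lborel {0..s}"
    using m sub by (intro measure_mono_fmeasurable Icc_fmeasurable) auto
  also have "\<dots> = s" using s by simp
  finally show "\<omega> \<in> {\<omega> \<in> space M. positive_occupation (\<lambda>\<tau>. W \<tau> \<omega>) s \<le> \<epsilon> * s}"
    using \<omega> by (auto simp: positive_occupation_eq_measure algebra_simps Z_def Y_def)
next
  show "{\<omega> \<in> space M. positive_occupation (\<lambda>\<tau>. W \<tau> \<omega>) s \<le> \<epsilon> * s} \<in> events"
    using Brownian_occupation_measurable[OF W] s by simp
qed

text \<open>For \<open>k \<ge> 0\<close> the event of a large occupation time is used, for \<open>k < 0\<close> that of a small one.\<close>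
lemma Brownian_occupation_mgf:
  assumes "0 < \<epsilon>"
  shows "\<exists>p>0. \<forall>W s. standard_Brownian_motion W \<longrightarrow> 0 \<le> s \<longrightarrow>
    ennreal (p * exp ((max k 0 - \<bar>k\<bar> * \<epsilon>) * s)) \<le>
      (\<integral>\<^sup>+\<omega>. ennreal (exp (k * positive_occupation (\<lambda>\<tau>. W \<tau> \<omega>) s)) \<partial>M)"
proof -
  obtain p where p: "p > 0" and high: "\<And>W s. standard_Brownian_motion W \<Longrightarrow> 0 < s \<Longrightarrow>
    p \<le> prob {\<omega> \<in> space M. (1 - \<epsilon>) * s \<le> positive_occupation (\<lambda>\<tau>. W \<tau> \<omega>) s}"
    using Brownian_occupation_high[OF assms] by blast
  show ?thesis
  proof (intro exI[of _ "min p 1"] conjI allI impI)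
    show "min p 1 > 0" using p by simp
  next
    fix W :: "real \<Rightarrow> 'a \<Rightarrow> real" and s :: real
    assume W: "standard_Brownian_motion W" and s: "0 \<le> s"
    note [measurable] = Brownian_occupation_measurable[OF W s]
    let ?occ = "\<lambda>\<omega>. positive_occupation (\<lambda>\<tau>. W \<tau> \<omega>) s"
    show "ennreal (min p 1 * exp ((max k 0 - \<bar>k\<bar> * \<epsilon>) * s)) \<le> (\<integral>\<^sup>+\<omega>. ennreal (exp (k * ?occ \<omega>)) \<partial>M)"
    proof (cases "s = 0")
      case True
      have "?occ \<omega> = 0" if "\<omega> \<in> space M" for \<omega>
        using positive_occupation_le[OF continuous_positive_set, of "\<lambda>\<tau>. W \<tau> \<omega>" 0] W that
          positive_occupation_nonneg[of "\<lambda>\<tau>. W \<tau> \<omega>" 0]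
        by (auto simp: True standard_Brownian_motion_def)
      then have "(\<integral>\<^sup>+\<omega>. ennreal (exp (k * ?occ \<omega>)) \<partial>M) = (\<integral>\<^sup>+\<omega>. 1 \<partial>M)"
        by (intro nn_integral_cong) simp
      then show ?thesis using True by (simp add: emeasure_space_1)
    next
      case False
      then have s: "0 < s" using s by simp
      define A where "A = {\<omega> \<in> space M. (max k 0 - \<bar>k\<bar> * \<epsilon>) * s \<le> k * ?occ \<omega>}"
      have [measurable]: "A \<in> events" unfolding A_def by measurable
      have "p \<le> prob A"
      proof (cases "k \<ge> 0")
        case True
        have "p \<le> prob {\<omega> \<in> space M. (1 - \<epsilon>) * s \<le> ?occ \<omega>}" by (rule high[OF W s])
        also have "\<dots> \<le> prob A"
        proof (rule finite_measure_mono, rule subsetI)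
          fix \<omega> assume \<omega>: "\<omega> \<in> {\<omega> \<in> space M. (1 - \<epsilon>) * s \<le> ?occ \<omega>}"
          then have "k * ((1 - \<epsilon>) * s) \<le> k * ?occ \<omega>" using True by (intro mult_left_mono) auto
          then show "\<omega> \<in> A" using True \<omega> by (auto simp: A_def algebra_simps)
        qed measurable
        finally show ?thesis .
      next
        case False
        have "p \<le> prob {\<omega> \<in> space M. (1 - \<epsilon>) * s \<le> positive_occupation (\<lambda>\<tau>. - W \<tau> \<omega>) s}"
          by (rule high[OF Brownian_uminus[OF W] s])
        also have "\<dots> \<le> prob {\<omega> \<in> space M. ?occ \<omega> \<le> \<epsilon> * s}"
          by (rule Brownian_occupation_low[OF W s])
        also have "\<dots> \<le> prob A"
        proof (rule finite_measure_mono, rule subsetI)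
          fix \<omega> assume \<omega>: "\<omega> \<in> {\<omega> \<in> space M. ?occ \<omega> \<le> \<epsilon> * s}"
          then have "k * (\<epsilon> * s) \<le> k * ?occ \<omega>" using False by (intro mult_left_mono_neg) auto
          then show "\<omega> \<in> A" using False \<omega> by (auto simp: A_def algebra_simps)
        qed measurable
        finally show ?thesis .
      qed
      then have "ennreal (min p 1 * exp ((max k 0 - \<bar>k\<bar> * \<epsilon>) * s)) \<le> ennreal (exp ((max k 0 - \<bar>k\<bar> * \<epsilon>) * s)) * emeasure M A"
        by (simp add: emeasure_eq_measure ennreal_mult[symmetric] mult.commute[of "min p 1"] ennreal_leI)
      also have "\<dots> = (\<integral>\<^sup>+\<omega>. ennreal (exp ((max k 0 - \<bar>k\<bar> * \<epsilon>) * s)) * indicator A \<omega> \<partial>M)"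
        by (rule nn_integral_cmult_indicator[symmetric]) measurable
      also have "\<dots> \<le> (\<integral>\<^sup>+\<omega>. ennreal (exp (k * ?occ \<omega>)) \<partial>M)"
        by (rule nn_integral_mono) (auto simp: A_def indicator_def intro!: ennreal_leI)
      finally show ?thesis .
    qed
  qed
qed

end

section \<open>The reset process\<close>

context reset_Brownian_motion
begin

definition trajectory :: "nat \<Rightarrow> 'a \<Rightarrow> real \<Rightarrow> real" where
  "trajectory i \<omega> = (\<lambda>t\<in>{0..}. B i t \<omega>)"

definition cycle :: "nat \<Rightarrow> 'a \<Rightarrow> real \<times> real" where
  "cycle i \<omega> = (S i \<omega>, positive_occupation (path_value (trajectory i \<omega>)) (S i \<omega>))"

lemma S_measurable: "n \<ge> 1 \<Longrightarrow> S n \<in> borel_measurable M"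
  using S_indep by (auto simp: indep_vars_def2)

lemma trajectory_measurable: "n \<ge> 1 \<Longrightarrow> trajectory n \<in> measurable M path_space"
  using Brownian_path_measurable[OF B_Brownian] by (simp add: trajectory_def[abs_def])

lemma B_continuous: "i \<ge> 1 \<Longrightarrow> \<omega> \<in> space M \<Longrightarrow> continuous_on {0..} (\<lambda>t. B i t \<omega>)"
  using B_Brownian[of i] by (auto simp: standard_Brownian_motion_def)

lemma path_value_trajectory: "i \<ge> 1 \<Longrightarrow> \<omega> \<in> space M \<Longrightarrow> 0 \<le> t \<Longrightarrow> path_value (trajectory i \<omega>) t = B i t \<omega>"
  unfolding trajectory_def by (intro path_value_continuous B_continuous)

lemma snd_cycle:
  assumes "i \<ge> 1" "\<omega> \<in> space M"
  shows "snd (cycle i \<omega>) = positive_occupation (\<lambda>\<tau>. B i \<tau> \<omega>) (S i \<omega>)"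
  unfolding cycle_def snd_conv
  by (rule positive_occupation_cong) (use assms path_value_trajectory in auto)

text \<open>The sigma-algebras generated by all waiting times and by all Brownian motions, whose independence
  is part of the model.\<close>
definition waiting_algebra :: "'a measure" where
  "waiting_algebra = vimage_algebra (space M) (\<lambda>\<omega>. \<lambda>n\<in>{1..}. S n \<omega>) (PiM {1..} (\<lambda>_. borel))"

definition path_algebra :: "'a measure" where
  "path_algebra = vimage_algebra (space M) (\<lambda>\<omega>. \<lambda>(i, t)\<in>{1..} \<times> {0..}. B i t \<omega>)
    (PiM ({1..} \<times> {0..}) (\<lambda>_. borel))"

lemma space_algebras: "space waiting_algebra = space M" "space path_algebra = space M"
  by (simp_all add: waiting_algebra_def path_algebra_def)

lemma indep_algebras: "indep_set (sets waiting_algebra) (sets path_algebra)"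
  unfolding waiting_algebra_def path_algebra_def by (rule S_B_indep)

lemma waiting_algebra_event:
  assumes i: "i \<ge> 1" and A: "A \<in> sets borel"
  shows "S i -` A \<inter> space M \<in> sets waiting_algebra"
proof -
  have f: "(\<lambda>\<omega>. \<lambda>n\<in>{1..}. S n \<omega>) \<in> measurable waiting_algebra (PiM {1..} (\<lambda>_. borel))"
    unfolding waiting_algebra_def by (rule measurable_vimage_algebra1) (simp add: space_PiM)
  have "i \<in> {1..}" using i by simp
  then have "(\<lambda>\<omega>. (\<lambda>n\<in>{1..}. S n \<omega>) i) \<in> borel_measurable waiting_algebra"
    by (rule measurable_compose[OF f measurable_component_singleton])
  then have "S i \<in> borel_measurable waiting_algebra" using i by simp
  from measurable_sets[OF this A] show ?thesis by (simp only: space_algebras)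
qed

lemma path_algebra_event:
  assumes i: "i \<ge> 1" and C: "C \<in> sets path_space"
  shows "trajectory i -` C \<inter> space M \<in> sets path_algebra"
proof -
  let ?g = "\<lambda>\<omega>. \<lambda>(i, t)\<in>{1..} \<times> {0..}. B i t \<omega>"
  have g: "?g \<in> measurable path_algebra (PiM ({1..} \<times> {0..}) (\<lambda>_. borel))"
    unfolding path_algebra_def by (rule measurable_vimage_algebra1) (simp add: space_PiM)
  have "(\<lambda>\<omega>. \<lambda>t\<in>{0..}. ?g \<omega> (i, t)) \<in> measurable path_algebra path_space"
  proof (rule measurable_restrict)
    fix t :: real assume "t \<in> {0..}"
    with i have "(i, t) \<in> {1..} \<times> {0..}" by simp
    then show "(\<lambda>\<omega>. ?g \<omega> (i, t)) \<in> borel_measurable path_algebra"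
      by (rule measurable_compose[OF g measurable_component_singleton])
  qed
  also have "(\<lambda>\<omega>. \<lambda>t\<in>{0..}. ?g \<omega> (i, t)) = trajectory i"
    using i by (auto simp: trajectory_def fun_eq_iff)
  finally have "trajectory i \<in> measurable path_algebra path_space" .
  from measurable_sets[OF this C] show ?thesis by (simp only: space_algebras)
qed

lemma indep_waiting_path: "indep_vars (\<lambda>_. borel \<Otimes>\<^sub>M path_space) (\<lambda>i \<omega>. (S i \<omega>, trajectory i \<omega>)) {1..}"
proof (rule indep_vars_Pair[OF S_indep])
  show "indep_vars (\<lambda>_. path_space) trajectory {1..}"
    using B_indep by (simp add: trajectory_def[abs_def])
  fix J :: "nat set" and A C assume J: "finite J" "J \<noteq> {}" "J \<subseteq> {1..}"
    and A: "\<And>j. j \<in> J \<Longrightarrow> A j \<in> sets (borel :: real measure)" and C: "\<And>j. j \<in> J \<Longrightarrow> C j \<in> sets path_space"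
  show "prob ((\<Inter>j\<in>J. S j -` A j \<inter> space M) \<inter> (\<Inter>j\<in>J. trajectory j -` C j \<inter> space M)) =
      prob (\<Inter>j\<in>J. S j -` A j \<inter> space M) * prob (\<Inter>j\<in>J. trajectory j -` C j \<inter> space M)"
  proof (rule indep_setD[OF indep_algebras])
    show "(\<Inter>j\<in>J. S j -` A j \<inter> space M) \<in> sets waiting_algebra"
      using J A by (intro sets.finite_INT waiting_algebra_event) auto
    show "(\<Inter>j\<in>J. trajectory j -` C j \<inter> space M) \<in> sets path_algebra"
      using J C by (intro sets.finite_INT path_algebra_event) auto
  qed
qed

lemma waiting_path_law:
  assumes i: "i \<ge> 1"
  shows "distr M borel (S i) \<Otimes>\<^sub>M distr M path_space (trajectory i) =
    distr M (borel \<Otimes>\<^sub>M path_space) (\<lambda>\<omega>. (S i \<omega>, trajectory i \<omega>))"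
proof (rule pair_measure_eqI)
  have [measurable]: "S i \<in> borel_measurable M" "trajectory i \<in> measurable M path_space"
    using i by (rule S_measurable trajectory_measurable)+
  show "sigma_finite_measure (distr M borel (S i))" "sigma_finite_measure (distr M path_space (trajectory i))"
    by (intro finite_measure.sigma_finite_measure finite_measure_distr; measurable)+
  show "sets (distr M borel (S i) \<Otimes>\<^sub>M distr M path_space (trajectory i)) =
      sets (distr M (borel \<Otimes>\<^sub>M path_space) (\<lambda>\<omega>. (S i \<omega>, trajectory i \<omega>)))"
    by (simp cong: sets_pair_measure_cong)
  fix A C assume "A \<in> sets (distr M borel (S i))" "C \<in> sets (distr M path_space (trajectory i))"
  then have A [measurable]: "A \<in> sets borel" and C [measurable]: "C \<in> sets path_space" by auto
  have "prob ((S i -` A \<inter> space M) \<inter> (trajectory i -` C \<inter> space M)) =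
      prob (S i -` A \<inter> space M) * prob (trajectory i -` C \<inter> space M)"
    by (intro indep_setD[OF indep_algebras] waiting_algebra_event path_algebra_event i A C)
  moreover have "(\<lambda>\<omega>. (S i \<omega>, trajectory i \<omega>)) -` (A \<times> C) \<inter> space M = (S i -` A \<inter> space M) \<inter> (trajectory i -` C \<inter> space M)"
    by auto
  ultimately show "emeasure (distr M borel (S i)) A * emeasure (distr M path_space (trajectory i)) C =
      emeasure (distr M (borel \<Otimes>\<^sub>M path_space) (\<lambda>\<omega>. (S i \<omega>, trajectory i \<omega>))) (A \<times> C)"
    by (simp add: emeasure_distr emeasure_eq_measure ennreal_mult)
qed

lemma cycle_map_measurable:
  "(\<lambda>(s, b). (s, positive_occupation (path_value b) s)) \<in> measurable (borel \<Otimes>\<^sub>M path_space) borel"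
  unfolding split_def
  by (intro borel_measurable_Pair occupation_measurable measurable_fst measurable_snd)

lemma indep_cycles: "indep_vars (\<lambda>_. borel) cycle {1..}"
  using indep_vars_compose2[OF indep_waiting_path, of "\<lambda>_ (s, b). (s, positive_occupation (path_value b) s)" "\<lambda>_. borel"]
    cycle_map_measurable by (simp add: cycle_def[abs_def])

text \<open>The cycle is the same function of the pair of waiting time and path for every index, and the law of
  that pair is the product of two laws that do not depend on the index.\<close>
lemma cycle_law:
  assumes n: "n \<ge> 1"
  shows "distr M borel (cycle n) = distr M borel (cycle 1)"
proof -
  have law: "distr M borel (cycle i) = distr (distr M borel (S i) \<Otimes>\<^sub>M distr M path_space (trajectory i)) borel
      (\<lambda>(s, b). (s, positive_occupation (path_value b) s))" if i: "i \<ge> 1" for i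
  proof -
    show ?thesis
      unfolding waiting_path_law[OF i]
      using S_measurable[OF i] trajectory_measurable[OF i] cycle_map_measurable
      by (subst distr_distr) (auto simp: comp_def cycle_def[abs_def])
  qed
  have "distr M path_space (trajectory n) = distr M path_space (trajectory 1)"
    unfolding trajectory_def[abs_def] using B_Brownian n by (intro Brownian_law_unique) auto
  then show ?thesis
    unfolding law[OF n] law[OF order_refl] S_ident[OF n] by simp
qed

sublocale renewal_reward M cycle
proof unfold_locales
  show "indep_vars (\<lambda>_. borel) cycle {1..}" by (rule indep_cycles)
  fix n :: nat assume n: "n \<ge> 1"
  then show "distr M borel (cycle n) = distr M borel (cycle 1)" by (rule cycle_law)
  fix \<omega> assume \<omega>: "\<omega> \<in> space M"
  show "0 \<le> snd (cycle n \<omega>)"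
    unfolding snd_cycle[OF n \<omega>] by (rule positive_occupation_nonneg)
  show "snd (cycle n \<omega>) \<le> fst (cycle n \<omega>)"
    unfolding snd_cycle[OF n \<omega>] using S_nonneg[OF n \<omega>] continuous_positive_set[OF B_continuous[OF n \<omega>]]
    by (simp add: cycle_def positive_occupation_le)
next
  show "prob {\<omega> \<in> space M. fst (cycle 1 \<omega>) = 0} < 1"
    using S_nontrivial by (simp add: cycle_def)
qed

lemma renewal_time_eq: "renewal_time S n \<omega> = time n \<omega>"
  by (simp add: renewal_time_def partial_def fst_sum cycle_def)

text \<open>On the null event of infinitely many renewals up to \<open>\<tau>\<close> the supremum is that of all natural numbers,
  an unspecified constant. Keeping this case explicit makes the count measurable everywhere.\<close>
lemma renewal_count_eq:
  assumes \<omega>: "\<omega> \<in> space M"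
  shows "renewal_count S \<tau> \<omega> = (if \<forall>n. time n \<omega> \<le> \<tau> then Sup UNIV else (LEAST n. \<tau> < time n \<omega>) - 1)"
proof (cases "\<forall>n. time n \<omega> \<le> \<tau>")
  case True
  then show ?thesis by (simp add: renewal_count_def renewal_time_eq)
next
  case False
  define m where "m = (LEAST n. \<tau> < time n \<omega>)"
  have m: "\<tau> < time m \<omega>" 
    unfolding m_def by (rule LeastI_ex[of "\<lambda>n. \<tau> < time n \<omega>"]) (use False in \<open>auto simp: not_le\<close>)
  have "{n. time n \<omega> \<le> \<tau>} = {..<m}"
  proof (intro set_eqI iffI)
    fix n assume "n \<in> {n. time n \<omega> \<le> \<tau>}"
    then show "n \<in> {..<m}" using m time_mono[OF _ \<omega>, of m n] by (force simp: not_less[symmetric])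
  next
    fix n assume "n \<in> {..<m}"
    then show "n \<in> {n. time n \<omega> \<le> \<tau>}"
      using not_less_Least[of n "\<lambda>n. \<tau> < time n \<omega>"] by (auto simp: m_def not_less)
  qed
  moreover have "Sup {..<m} = m - 1"
  proof (cases m)
    case (Suc k)
    then show ?thesis by (intro cSup_eq_maximum) auto
  qed (simp add: Sup_nat_def)
  ultimately have "renewal_count S \<tau> \<omega> = m - 1"
    by (simp add: renewal_count_def renewal_time_eq)
  with False show ?thesis by (simp only: m_def if_False)
qed

lemma renewal_count_between:
  assumes \<omega>: "\<omega> \<in> space M" and "time n \<omega> \<le> \<tau>" "\<tau> < time (Suc n) \<omega>"
  shows "renewal_count S \<tau> \<omega> = n"
proof -
  have "(LEAST n. \<tau> < time n \<omega>) = Suc n"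
  proof (rule Least_equality)
    fix m assume "\<tau> < time m \<omega>"
    then show "Suc n \<le> m" using assms(2) time_mono[OF _ \<omega>, of m n] by (force simp: not_less_eq_eq)
  qed fact
  moreover have "\<not> (\<forall>n. time n \<omega> \<le> \<tau>)" using assms(3) by (auto simp: not_le)
  ultimately show ?thesis by (simp only: renewal_count_eq[OF \<omega>] if_False diff_Suc_1)
qed

lemma last_renewal_le:
  assumes \<omega>: "\<omega> \<in> space M" and \<tau>: "0 \<le> \<tau>"
  shows "time (renewal_count S \<tau> \<omega>) \<omega> \<le> \<tau>"
proof (cases "\<forall>n. time n \<omega> \<le> \<tau>")
  case False
  define m where "m = (LEAST n. \<tau> < time n \<omega>)"
  have m: "\<tau> < time m \<omega>" 
    unfolding m_def by (rule LeastI_ex[of "\<lambda>n. \<tau> < time n \<omega>"]) (use False in \<open>auto simp: not_le\<close>)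
  then obtain k where k: "m = Suc k" using \<tau> by (cases m) auto
  have "\<not> \<tau> < time k \<omega>" using not_less_Least[of k "\<lambda>n. \<tau> < time n \<omega>"] k by (simp add: m_def)
  then show ?thesis
    using False k by (simp add: renewal_count_eq[OF \<omega>] m_def)
qed simp

text \<open>The reset process, with evaluation of paths replaced by \<open>path_value\<close>, so that it is jointly
  measurable in time and chance.\<close>
definition position :: "real \<times> 'a \<Rightarrow> real" where
  "position p = (let n = renewal_count S (fst p) (snd p)
     in path_value (trajectory (Suc n) (snd p)) (fst p - time n (snd p)))"

lemma position_eq:
  assumes "\<omega> \<in> space M" "0 \<le> \<tau>"
  shows "position (\<tau>, \<omega>) = reset_process S B \<tau> \<omega>"
  using assms last_renewal_le[OF assms]
  by (simp add: position_def reset_process_def Let_def renewal_time_eq path_value_trajectory)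

lemma position_measurable [measurable]: "position \<in> borel_measurable (borel \<Otimes>\<^sub>M M)"
  unfolding position_def[abs_def] Let_def
proof (rule measurable_compose_countable[where f="\<lambda>n p. path_value (trajectory (Suc n) (snd p)) (fst p - time n (snd p))"])
  have [measurable]: "trajectory (Suc n) \<in> measurable M path_space" for n by (rule trajectory_measurable) simp
  fix n
  show "(\<lambda>p. path_value (trajectory (Suc n) (snd p)) (fst p - time n (snd p))) \<in> borel_measurable (borel \<Otimes>\<^sub>M M)"
    by measurable
next
  have "(\<lambda>p. if \<forall>n. time n (snd p) \<le> fst p then Sup UNIV else (LEAST n. fst p < time n (snd p)) - 1)
      \<in> measurable (borel \<Otimes>\<^sub>M M) (count_space UNIV)"
    by measurable
  then show "(\<lambda>p. renewal_count S (fst p) (snd p)) \<in> measurable (borel \<Otimes>\<^sub>M M) (count_space UNIV)"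
    by (rule measurable_cong[THEN iffD1, rotated]) (auto simp: renewal_count_eq space_pair_measure)
qed

lemma occupation_eq_position:
  "\<omega> \<in> space M \<Longrightarrow> reset_occupation_time S B t \<omega> = positive_occupation (\<lambda>\<tau>. position (\<tau>, \<omega>)) t"
  unfolding reset_occupation_time_def
  by (rule positive_occupation_cong) (simp add: position_eq)

lemma reset_occupation_time_measurable: "reset_occupation_time S B t \<in> borel_measurable M"
proof -
  have "(\<lambda>\<omega>. \<integral>\<tau>. (if 0 \<le> \<tau> \<and> \<tau> \<le> t \<and> 0 < position (\<tau>, \<omega>) then 1 else 0 :: real) \<partial>lborel) \<in> borel_measurable M"
    by measurable
  also have "?this \<longleftrightarrow> reset_occupation_time S B t \<in> borel_measurable M"
  proof (rule measurable_cong)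
    fix \<omega> assume \<omega>: "\<omega> \<in> space M"
    show "(\<integral>\<tau>. (if 0 \<le> \<tau> \<and> \<tau> \<le> t \<and> 0 < position (\<tau>, \<omega>) then 1 else 0 :: real) \<partial>lborel) = reset_occupation_time S B t \<omega>"
      unfolding occupation_eq_position[OF \<omega>] positive_occupation_def set_lebesgue_integral_def
      by (intro Bochner_Integration.integral_cong) (auto simp: indicator_def)
  qed
  finally show ?thesis .
qed

lemma position_section:
  assumes "\<omega> \<in> space M"
  shows "{\<tau>. 0 \<le> \<tau> \<and> 0 < position (\<tau>, \<omega>)} \<in> sets borel"
proof -
  have [measurable]: "(\<lambda>\<tau>. position (\<tau>, \<omega>)) \<in> borel_measurable borel"
    by (rule measurable_Pair1[OF position_measurable assms])
  show ?thesis by measurable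
qed

text \<open>Between the \<open>n\<close>-th renewal and the next one the process follows the Brownian motion with index
  \<open>n + 1\<close> from its start, so this stretch adds exactly the reward of that cycle.\<close>
lemma occupation_at_renewal:
  assumes \<omega>: "\<omega> \<in> space M"
  shows "reset_occupation_time S B (time n \<omega>) \<omega> = reward n \<omega>"
  unfolding occupation_eq_position[OF \<omega>]
proof (induction n)
  case 0
  show ?case
    using positive_occupation_le[OF position_section[OF \<omega>], of 0]
      positive_occupation_nonneg[of "\<lambda>\<tau>. position (\<tau>, \<omega>)" 0] by simp
next
  case (Suc n)
  have time_Suc: "time (Suc n) \<omega> = time n \<omega> + S (Suc n) \<omega>"
    by (simp add: partial_Suc cycle_def)
  have "positive_occupation (\<lambda>\<tau>. position (\<tau>, \<omega>)) (time n \<omega> + S (Suc n) \<omega>) =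
    positive_occupation (\<lambda>\<tau>. position (\<tau>, \<omega>)) (time n \<omega>) + positive_occupation (\<lambda>\<tau>. B (Suc n) \<tau> \<omega>) (S (Suc n) \<omega>)"
  proof (rule positive_occupation_concat)
    show "{\<tau>. 0 \<le> \<tau> \<and> 0 < position (\<tau>, \<omega>)} \<in> sets borel" by (rule position_section[OF \<omega>])
    show "{\<tau>. 0 \<le> \<tau> \<and> 0 < B (Suc n) \<tau> \<omega>} \<in> sets borel"
      by (intro continuous_positive_set B_continuous \<omega>) simp
    show "0 \<le> time n \<omega>" by (rule time_nonneg[OF \<omega>])
    show "0 \<le> S (Suc n) \<omega>" by (rule S_nonneg[OF _ \<omega>]) simp
    fix \<tau> assume \<tau>: "time n \<omega> \<le> \<tau>" "\<tau> < time n \<omega> + S (Suc n) \<omega>"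
    then have "renewal_count S \<tau> \<omega> = n"
      by (intro renewal_count_between[OF \<omega>]) (auto simp: time_Suc)
    then show "position (\<tau>, \<omega>) = B (Suc n) (\<tau> - time n \<omega>) \<omega>"
      using \<tau> \<omega> by (simp add: position_def path_value_trajectory)
  qed
  also have "positive_occupation (\<lambda>\<tau>. B (Suc n) \<tau> \<omega>) (S (Suc n) \<omega>) = snd (cycle (Suc n) \<omega>)"
    by (rule snd_cycle[symmetric]) (use \<omega> in auto)
  finally show ?case
    unfolding time_Suc using Suc by (simp add: partial_Suc)
qed

text \<open>Conditionally on \<open>S\<^sub>1 = s\<close>, the reward \<open>X\<^sub>1\<close> is the occupation time of a Brownian motion up to \<open>s\<close>, whose
  exponential moment is at least \<open>p exp ((max k 0 - \<bar>k\<bar> \<epsilon>) s)\<close>. The loss \<open>\<bar>k\<bar> \<epsilon>\<close> fits into the gap between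
  \<open>\<zeta>\<close> and \<open>\<zeta>'\<close>.\<close>
lemma occupation_mgf_ge_waiting_mgf:
  assumes "\<zeta> < \<zeta>'"
  shows "\<exists>p>0. ennreal p * (\<integral>\<^sup>+\<omega>. ennreal (exp ((\<zeta> + max k 0) * S 1 \<omega>)) \<partial>M) \<le> mgf \<zeta>' k"
proof -
  define \<epsilon> where "\<epsilon> = (\<zeta>' - \<zeta>) / (\<bar>k\<bar> + 1)"
  have \<epsilon>: "\<epsilon> > 0" using assms by (simp add: \<epsilon>_def add_nonneg_pos)
  have k\<epsilon>: "\<bar>k\<bar> * \<epsilon> \<le> \<zeta>' - \<zeta>"
  proof -
    have "\<bar>k\<bar> * \<epsilon> \<le> (\<bar>k\<bar> + 1) * \<epsilon>" using \<epsilon> by (intro mult_right_mono) auto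
    also have "\<dots> = \<zeta>' - \<zeta>" by (simp add: \<epsilon>_def add_nonneg_pos less_imp_neq[symmetric])
    finally show ?thesis .
  qed
  obtain p where p: "p > 0" and low: "\<And>W s. standard_Brownian_motion W \<Longrightarrow> 0 \<le> s \<Longrightarrow>
    ennreal (p * exp ((max k 0 - \<bar>k\<bar> * \<epsilon>) * s)) \<le>
      (\<integral>\<^sup>+\<omega>. ennreal (exp (k * positive_occupation (\<lambda>\<tau>. W \<tau> \<omega>) s)) \<partial>M)"
    using Brownian_occupation_mgf[OF \<epsilon>, of k] by blast
  have [measurable]: "S 1 \<in> borel_measurable M" "trajectory 1 \<in> measurable M path_space"
    using S_measurable[of 1] trajectory_measurable[of 1] by auto
  define g where "g = (\<lambda>(s, b). ennreal (exp (\<zeta>' * s + k * positive_occupation (path_value b) s)))"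
  have [measurable]: "(\<lambda>p. positive_occupation (path_value (snd p)) (fst p)) \<in> borel_measurable (borel \<Otimes>\<^sub>M path_space)"
    by (intro occupation_measurable measurable_fst measurable_snd)
  have g_meas: "g \<in> borel_measurable (borel \<Otimes>\<^sub>M path_space)"
    unfolding g_def split_def by measurable
  have "mgf \<zeta>' k = (\<integral>\<^sup>+\<omega>. g (S 1 \<omega>, trajectory 1 \<omega>) \<partial>M)"
    by (simp add: mgf_def g_def cycle_def)
  also have "\<dots> = (\<integral>\<^sup>+\<omega>. \<integral>\<^sup>+\<omega>'. g (S 1 \<omega>, trajectory 1 \<omega>') \<partial>M \<partial>M)"
    by (rule nn_integral_product_law[OF _ _ waiting_path_law g_meas]) (simp_all add: S_measurable trajectory_measurable)
  finally have mgf: "mgf \<zeta>' k = (\<integral>\<^sup>+\<omega>. \<integral>\<^sup>+\<omega>'. g (S 1 \<omega>, trajectory 1 \<omega>') \<partial>M \<partial>M)" .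
  have "ennreal p * (\<integral>\<^sup>+\<omega>. ennreal (exp ((\<zeta> + max k 0) * S 1 \<omega>)) \<partial>M) =
      (\<integral>\<^sup>+\<omega>. ennreal p * ennreal (exp ((\<zeta> + max k 0) * S 1 \<omega>)) \<partial>M)"
    by (rule nn_integral_cmult[symmetric]) measurable
  also have "\<dots> \<le> (\<integral>\<^sup>+\<omega>. \<integral>\<^sup>+\<omega>'. g (S 1 \<omega>, trajectory 1 \<omega>') \<partial>M \<partial>M)"
  proof (rule nn_integral_mono)
    fix \<omega> assume \<omega>: "\<omega> \<in> space M"
    define s where "s = S 1 \<omega>"
    have s: "0 \<le> s" unfolding s_def by (rule S_nonneg[OF _ \<omega>]) simp
    have [measurable]: "(\<lambda>\<omega>'. positive_occupation (path_value (trajectory 1 \<omega>')) s) \<in> borel_measurable M"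
      by (intro occupation_measurable) measurable
    have "(\<zeta> + max k 0) * s \<le> \<zeta>' * s + (max k 0 - \<bar>k\<bar> * \<epsilon>) * s"
    proof -
      have "\<bar>k\<bar> * \<epsilon> * s \<le> (\<zeta>' - \<zeta>) * s" using k\<epsilon> s by (intro mult_right_mono) auto
      then show ?thesis by (simp add: algebra_simps)
    qed
    then have "p * exp ((\<zeta> + max k 0) * s) \<le> exp (\<zeta>' * s) * (p * exp ((max k 0 - \<bar>k\<bar> * \<epsilon>) * s))"
      using p by (simp add: exp_add[symmetric] mult.left_commute[of _ p])
    then have "ennreal p * ennreal (exp ((\<zeta> + max k 0) * s)) \<le>
        ennreal (exp (\<zeta>' * s)) * ennreal (p * exp ((max k 0 - \<bar>k\<bar> * \<epsilon>) * s))"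
      using p by (simp add: ennreal_mult[symmetric] ennreal_leI)
    also have "\<dots> \<le> ennreal (exp (\<zeta>' * s)) * (\<integral>\<^sup>+\<omega>'. ennreal (exp (k * positive_occupation (\<lambda>\<tau>. B 1 \<tau> \<omega>') s)) \<partial>M)"
      by (intro mult_left_mono low[OF B_Brownian s]) auto
    also have "(\<integral>\<^sup>+\<omega>'. ennreal (exp (k * positive_occupation (\<lambda>\<tau>. B 1 \<tau> \<omega>') s)) \<partial>M) =
        (\<integral>\<^sup>+\<omega>'. ennreal (exp (k * positive_occupation (path_value (trajectory 1 \<omega>')) s)) \<partial>M)"
    proof (rule nn_integral_cong)
      fix \<omega>' assume "\<omega>' \<in> space M"
      then have "positive_occupation (\<lambda>\<tau>. B 1 \<tau> \<omega>') s = positive_occupation (path_value (trajectory 1 \<omega>')) s"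
        by (intro positive_occupation_cong) (simp add: path_value_trajectory)
      then show "ennreal (exp (k * positive_occupation (\<lambda>\<tau>. B 1 \<tau> \<omega>') s)) =
        ennreal (exp (k * positive_occupation (path_value (trajectory 1 \<omega>')) s))" by simp
    qed
    also have "ennreal (exp (\<zeta>' * s)) * \<dots> =
        (\<integral>\<^sup>+\<omega>'. ennreal (exp (\<zeta>' * s)) * ennreal (exp (k * positive_occupation (path_value (trajectory 1 \<omega>')) s)) \<partial>M)"
      by (rule nn_integral_cmult[symmetric]) measurable
    also have "\<dots> = (\<integral>\<^sup>+\<omega>'. g (s, trajectory 1 \<omega>') \<partial>M)"
      by (simp add: g_def exp_add ennreal_mult)
    finally show "ennreal p * ennreal (exp ((\<zeta> + max k 0) * S 1 \<omega>)) \<le> (\<integral>\<^sup>+\<omega>'. g (S 1 \<omega>, trajectory 1 \<omega>') \<partial>M)"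
      by (simp only: s_def)
  qed
  also note mgf[symmetric]
  finally show ?thesis using p by blast
qed

text \<open>For a non-negative exponent this is Markov's inequality applied to the bound of
  \<open>occupation_mgf_ge_waiting_mgf\<close>; a negative exponent makes both factors at most one.\<close>
lemma waiting_time_tail:
  assumes "mgf \<zeta>' k \<le> 1" "\<zeta> < \<zeta>'"
  shows "\<exists>K. \<forall>u\<ge>0. exp ((\<zeta> + max k 0) * u) * prob {\<omega> \<in> space M. u < fst (cycle 1 \<omega>)} \<le> K"
proof -
  define a where "a = \<zeta> + max k 0"
  obtain p where p: "p > 0" and le: "ennreal p * (\<integral>\<^sup>+\<omega>. ennreal (exp (a * S 1 \<omega>)) \<partial>M) \<le> mgf \<zeta>' k"
    using occupation_mgf_ge_waiting_mgf[OF assms(2), of k] unfolding a_def by blast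
  have [measurable]: "S 1 \<in> borel_measurable M" by (rule S_measurable) simp
  show ?thesis
  proof (intro exI[of _ "max 1 (1 / p)"] allI impI)
    fix u :: real assume u: "0 \<le> u"
    define A where "A = {\<omega> \<in> space M. u < S 1 \<omega>}"
    have [measurable]: "A \<in> events" unfolding A_def by measurable
    have "exp (a * u) * prob A \<le> max 1 (1 / p)"
    proof (cases "a \<ge> 0")
      case True
      have "ennreal (exp (a * u)) * emeasure M A = (\<integral>\<^sup>+\<omega>. ennreal (exp (a * u)) * indicator A \<omega> \<partial>M)"
        by (rule nn_integral_cmult_indicator[symmetric]) measurable
      also have "\<dots> \<le> (\<integral>\<^sup>+\<omega>. ennreal (exp (a * S 1 \<omega>)) \<partial>M)"
        using True by (intro nn_integral_mono) (auto simp: A_def indicator_def intro!: ennreal_leI mult_left_mono)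
      finally have "ennreal p * (ennreal (exp (a * u)) * emeasure M A) \<le> 1"
        using le assms(1) by (meson mult_left_mono order_trans zero_le)
      then have "ennreal (p * (exp (a * u) * prob A)) \<le> ennreal 1"
        using p by (simp add: emeasure_eq_measure ennreal_mult)
      then have "p * (exp (a * u) * prob A) \<le> 1"
        by (subst (asm) ennreal_le_iff) auto
      then have "exp (a * u) * prob A \<le> 1 / p" using p by (simp add: field_simps)
      then show ?thesis by simp
    next
      case False
      then have "exp (a * u) \<le> 1" using u by (simp add: mult_le_0_iff)
      then have "exp (a * u) * prob A \<le> 1 * 1" by (intro mult_mono) auto
      then show ?thesis by simp
    qed
    then show "exp ((\<zeta> + max k 0) * u) * prob {\<omega> \<in> space M. u < fst (cycle 1 \<omega>)} \<le> max 1 (1 / p)"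
      by (simp add: a_def A_def cycle_def)
  qed
qed

sublocale cumulative_reward M cycle "reset_occupation_time S B"
proof unfold_locales
  fix t :: real
  show "reset_occupation_time S B t \<in> borel_measurable M" by (rule reset_occupation_time_measurable)
next
  fix \<omega> and t :: real and n assume \<omega>: "\<omega> \<in> space M" and t: "0 \<le> t"
  note Lip = positive_occupation_Lipschitz[OF position_section[OF \<omega>], folded occupation_eq_position[OF \<omega>]]
  show "reward n \<omega> \<le> reset_occupation_time S B t \<omega> \<and> reset_occupation_time S B t \<omega> \<le> reward n \<omega> + (t - time n \<omega>)"
    if "time n \<omega> \<le> t"
    using Lip[OF that] occupation_at_renewal[OF \<omega>, of n] by simp
  show "reset_occupation_time S B t \<omega> \<le> reward n \<omega> \<and> reward n \<omega> \<le> reset_occupation_time S B t \<omega> + (time n \<omega> - t)"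
    if "t \<le> time n \<omega>"
    using Lip[OF that] occupation_at_renewal[OF \<omega>, of n] by simp
next
  fix k \<zeta> \<zeta>' assume "mgf \<zeta>' k \<le> 1" "\<zeta> < \<zeta>'"
  then show "\<exists>K. \<forall>u\<ge>0. exp ((\<zeta> + max k 0) * u) * prob {\<omega> \<in> space M. u < fst (cycle 1 \<omega>)} \<le> K"
    by (rule waiting_time_tail)
qed

lemma phi_eq_exponent: "phi M S B k = exponent k"
proof -
  have "(\<integral>\<^sup>+\<omega>. ennreal (exp (\<zeta> * S 1 \<omega> + k * first_reward S B \<omega>)) \<partial>M) = mgf \<zeta> k" for \<zeta>
    unfolding mgf_def
  proof (rule nn_integral_cong)
    fix \<omega> assume "\<omega> \<in> space M"
    then show "ennreal (exp (\<zeta> * S 1 \<omega> + k * first_reward S B \<omega>)) =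
        ennreal (exp (\<zeta> * fst (cycle 1 \<omega>) + k * snd (cycle 1 \<omega>)))"
      using snd_cycle[of 1 \<omega>] by (simp add: first_reward_def) (simp add: cycle_def)
  qed
  then show ?thesis by (simp add: phi_def exponent_def)
qed

end

theorem proposition4p1:
  fixes M :: "'a measure" and S :: "nat \<Rightarrow> 'a \<Rightarrow> real" and B :: "nat \<Rightarrow> real \<Rightarrow> 'a \<Rightarrow> real"
    and l :: ereal
  assumes "reset_Brownian_motion M S B"
    and "0 \<le> l"
    and "((\<lambda>s::real. - (ereal (1 / s) * ln_ennreal (emeasure M {\<omega> \<in> space M. S 1 \<omega> > s}))) \<longlongrightarrow> l) at_top"
  shows "full_LDP M (reset_occupation_time S B) (\<lambda>w. SUP k::real. ereal (w * k) + phi M S B k) \<and>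
    (\<forall>k::real. ((\<lambda>t::real. ereal (1 / t) *
        ln_ennreal (\<integral>\<^sup>+\<omega>. ennreal (exp (k * reset_occupation_time S B t \<omega>)) \<partial>M))
      \<longlongrightarrow> - phi M S B k) at_top)"
proof -
  interpret reset_Brownian_motion M S B by fact
  show ?thesis
    using full_LDP_rate log_mgf_limit by (simp add: phi_eq_exponent rate_def[abs_def])
qed

end
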